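(* Let $p$ take values in an infinite set of primes of the form $p=x^2+4y^2$ for $x,y\in\mathbb{Z}$ (depending on $p$) such that $y^2(\log p)^3/p\to0$ as $p\to\infty$. For each $p$, let $D$ be the union of two (distinct) cyclotomic classes of $\mathbb{F}_p$ of order four, let $f$ be a characteristic polynomial of $D$, and let $r,t$ be integers with $t\ge 0$ (depending on $p$). Let $R$ and $T>0$ be real. If $r/p\to R$ and $t/p\to T$, then $F(f_{r,t})\to\varphi_1(R,T)$ as $p\to\infty$.
   Context: Merit factor: for $f\in\mathbb{C}[z]$ and $1\le\alpha<\infty$ put $\|f\|_\alpha=\left(\frac{1}{2\pi}\int_0^{2\pi}|f(e^{i\phi})|^\alpha\,d\phi\right)^{1/\alpha}$. The merit factor of $f$ is $F(f)=\frac{\|f\|_2^4}{\|f\|_4^4-\|f\|_2^4}$, provided that the denominator is nonzero. Cyclotomic classes: for a positive integer $m$ and a prime $p\equiv1\pmod m$, fix a primitive element $\omega$ of $\mathbb{F}_p$. Let $C_0$ be the set of $m$-th powers in $\mathbb{F}_p^*$ and $C_s=\omega^sC_0$ for $s\in\mathbb{Z}$. The sets $C_0,\dots,C_{m-1}$ partition $\mathbb{F}_p^*$ and are called the cyclotomic classes of $\mathbb{F}_p$ of order $m$. (Primes of the form $x^2+4y^2$ are exactly the primes congruent to $1$ modulo $4$.) Characteristic polynomials: for $D\subseteq\mathbb{F}_p$ put $\mathbf{1}_D(y)=1$ for $y\in D$ and $\mathbf{1}_D(y)=-1$ for $y\in\mathbb{F}_p\setminus D$. Fix a generator $v\in\mathbb{F}_p^*$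 of the additive group of $\mathbb{F}_p$. For integers $r,t$ with $t\ge0$, put $f_{r,t}(z)=\sum_{j=0}^{t-1}\mathbf{1}_D((j+r)v)z^j$. The polynomial $f=f_{0,p}$ is called a characteristic polynomial of $D$ (it depends on the choice of $v$), and $f_{r,t}$ denotes the associated polynomial formed with the same $v$. The function $\varphi_\nu$: for real $\nu$, $R\in\mathbb{R}$ and $T>0$, $$\frac{1}{\varphi_\nu(R,T)}=1-\frac{2(1+\nu)T}{3}+4\sum_{m=1}^{\infty}\max\Big(0,1-\frac{m}{T}\Big)^2+\nu\sum_{m\in\mathbb{Z}}\max\Big(0,1-\Big|1+\frac{2R-m}{T}\Big|\Big)^2$$ (here $m$ is a summation index). *)

theory Defs
  imports
    "HOL-Analysis.Analysis"
    "HOL-Computational_Algebra.Polynomial"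
    "HOL-Number_Theory.Residues"
begin

definition poly_norm :: "real \<Rightarrow> complex poly \<Rightarrow> real" where
  "poly_norm \<alpha> f =
     (1 / (2 * pi) * integral {0..2 * pi} (\<lambda>\<phi>. norm (poly f (exp (\<i> * of_real \<phi>))) powr \<alpha>))
       powr (1 / \<alpha>)"

text \<open>
  The merit factor is only meaningful when the denominator is nonzero; otherwise the value
  below is the usual \<open>x / 0 = 0\<close>.
\<close>

definition merit_factor :: "complex poly \<Rightarrow> real" where
  "merit_factor f = poly_norm 2 f ^ 4 / (poly_norm 4 f ^ 4 - poly_norm 2 f ^ 4)"

text \<open>
  The field with \<open>p\<close> elements is \<^term>\<open>residue_ring (int p)\<close>, whose carrier is the set of
  integers \<open>0, \<dots>, p - 1\<close> with addition and multiplication modulo \<open>p\<close>.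
\<close>

abbreviation prime_field :: "nat \<Rightarrow> int ring" where
  "prime_field p \<equiv> residue_ring (int p)"

definition primitive_element :: "nat \<Rightarrow> int \<Rightarrow> bool" where
  "primitive_element p \<omega> \<longleftrightarrow>
     \<omega> \<in> carrier (mult_of (prime_field p)) \<and>
     generate (mult_of (prime_field p)) {\<omega>} = carrier (mult_of (prime_field p))"

definition additive_generator :: "nat \<Rightarrow> int \<Rightarrow> bool" where
  "additive_generator p v \<longleftrightarrow>
     v \<in> carrier (mult_of (prime_field p)) \<and>
     generate (add_monoid (prime_field p)) {v} = carrier (prime_field p)"

text \<open>\<open>cyclotomic_class p m \<omega> s\<close> is the coset of the \<open>m\<close>-th powers containing \<open>\<omega>\<^sup>s\<close>.\<close>

definition cyclotomic_class :: "nat \<Rightarrow> nat \<Rightarrow> int \<Rightarrow> int \<Rightarrow> int set" where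
  "cyclotomic_class p m \<omega> s =
     (\<omega> [^]\<^bsub>mult_of (prime_field p)\<^esub> s) <#\<^bsub>mult_of (prime_field p)\<^esub>
       {x [^]\<^bsub>mult_of (prime_field p)\<^esub> m | x. x \<in> carrier (mult_of (prime_field p))}"

definition pm_indicator :: "'a set \<Rightarrow> 'a \<Rightarrow> complex" where
  "pm_indicator D y = (if y \<in> D then 1 else -1)"

text \<open>
  The polynomials \<open>f\<^bsub>r,t\<^esub>\<close>, formed with the generator \<open>v\<close>.  The characteristic polynomial of
  \<open>D\<close> with respect to \<open>v\<close> is \<open>char_poly_segment p D v 0 p\<close>.
\<close>

definition char_poly_segment :: "nat \<Rightarrow> int set \<Rightarrow> int \<Rightarrow> int \<Rightarrow> nat \<Rightarrow> complex poly" where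
  "char_poly_segment p D v r t =
     (\<Sum>j<t. Polynomial.monom (pm_indicator D (add_pow (prime_field p) (int j + r) v)) j)"

definition \<phi> :: "real \<Rightarrow> real \<Rightarrow> real \<Rightarrow> real" where
  "\<phi> \<nu> R T = 1 /
     (1 - 2 * (1 + \<nu>) * T / 3
        + 4 * (\<Sum>\<^sub>\<infinity>m\<in>{1::nat..}. (max 0 (1 - real m / T))\<^sup>2)
        + \<nu> * (\<Sum>\<^sub>\<infinity>m\<in>(UNIV::int set). (max 0 (1 - \<bar>1 + (2 * R - of_int m) / T\<bar>))\<^sup>2))"

end

theory Submission
  imports
    Defs
    "HOL-Computational_Algebra.Polynomial_Factorial"
    "HOL-Real_Asymp.Real_Asymp"
begin

text \<open>
  By Parseval, \<open>\<parallel>f\<parallel>\<^sub>4\<^sup>4\<close> is a sum of products of four signs over the additive quadruples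
  \<open>i + j = k + l\<close>.  Expanding the signs in additive characters modulo \<open>p\<close> turns it into a weighted sum
  of the correlations \<open>\<Sum>\<^sub>k S(k) S(k + a) S(k + b)* S(k + c)*\<close> of the Fourier transform \<open>S\<close> of the
  indicator of \<open>D\<close>.  By Gauss sums, \<open>S / \<surd>p\<close> is up to \<open>O(1 / \<surd>p)\<close> a combination of characters of order
  dividing four, it is real or purely imaginary, and its squared modulus is \<open>1 + \<delta> \<eta>\<close> with \<open>\<eta>\<close> the
  quadratic character and \<open>\<delta>\<^sup>2 \<le> 4 y\<^sup>2 / p\<close>.  Stepanov's method bounds the character sums that occur by
  \<open>O(\<surd>p)\<close>, so that only those correlations survive in which \<open>0, a, b, c\<close> coincide in pairs.  The weights
  have \<open>l\<^sup>1\<close> norm \<open>O(p\<^sup>3 log\<^sup>4 p)\<close>, which the saving of \<open>\<surd>p\<close> absorbs, and the surviving terms count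
  quadruples subject to a congruence modulo \<open>p\<close>; these counts are the Riemann-type sums in \<open>\<phi>\<close>.
\<close>

section \<open>Integer polynomials modulo a prime\<close>

text \<open>The bounds on quartic character sums are instances of Weil's theorem, which Stepanov's
  polynomial method yields elementarily. It is carried out in \<open>int poly\<close>, with equality
  up to a summand \<open>[:p:] * U\<close>, so that the modulus remains a variable over which the
  limit can be taken. Two features of the unions of classes decide the result. Because
  \<open>H\<close> is real or purely imaginary, the conjugates in the correlations are immaterial;
  hence the frequencies attached to \<open>i\<close> and \<open>j\<close> may pair with each other,
  besides the two pairings across the equation \<open>i + j = k + l\<close>. This third pairing
  produces the sum involving \<open>R\<close>, that is, the value \<nu> = 1. Because
  \<open>|H|^2\<close> is only nearly constant, there is an excess when all four frequencies
  coincide; it costs \<open>\<delta>^2 * t^3 / p\<close> against the normalisation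
  \<open>t^2\<close>, which is controlled by \<open>y^2 / p\<close>. Since the merit factor is a
  quotient, convergence of \<open>||f||_4^4 / ||f||_2^4\<close> is not enough: its limit must also
  be shown to exceed 1.\<close>

lemma prime_elem_const_int:
  fixes p :: int assumes "prime p" shows "prime_elem [:p:]"
  using assms prime_elem_const_poly_iff by blast

lemma const_dvd_poly_imp_dvd_poly:
  fixes p :: int assumes "[:p:] dvd P" shows "p dvd poly P a"
  using assms by auto

lemma linear_factor_mod:
  fixes p :: int assumes "p dvd poly P a"
  shows "\<exists>Q U. P = [:-a, 1:] * Q + [:p:] * U"
proof -
  from assms obtain u where u: "poly P a = p * u" by auto
  have "P = [:-a, 1:] * synthetic_div P a + [:p:] * [:u:]"
    using synthetic_div_correct'[of a P] u by (simp add: mult.commute)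
  then show ?thesis by blast
qed

text \<open>Taylor expansion at \<open>a\<close>: the \<open>k\<close>-th derivative at
  \<open>a\<close> is \<open>k!\<close> times the \<open>k\<close>-th coefficient of the shifted
  polynomial, and \<open>k!\<close> is invertible modulo \<open>p\<close> because
  \<open>k < l <= p\<close>. So the coefficients below \<open>l\<close> are multiples of
  \<open>p\<close>.\<close>

lemma power_linear_factor_mod:
  fixes p :: int
  assumes p: "prime p" and l: "int l \<le> p"
    and van: "\<And>k. k < l \<Longrightarrow> p dvd poly ((pderiv ^^ k) P) a"
  shows "\<exists>Q U. P = [:-a, 1:] ^ l * Q + [:p:] * U"
proof -
  define T where "T = pcompose P [:a, 1:]"
  have T: "(pderiv ^^ k) T = pcompose ((pderiv ^^ k) P) [:a, 1:]" for k
    by (induction k) (simp_all add: T_def pderiv_pcompose pderiv_pCons)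
  have c: "p dvd Polynomial.coeff T k" if k: "k < l" for k
  proof -
    have "Polynomial.coeff ((pderiv ^^ k) T) 0 = pochhammer (of_nat (Suc 0)) k * Polynomial.coeff T k"
      by (subst coeff_higher_pderiv) simp
    also have "pochhammer (of_nat (Suc 0)) k = (fact k :: int)"
      by (simp add: pochhammer_fact)
    finally have "Polynomial.coeff ((pderiv ^^ k) T) 0 = fact k * Polynomial.coeff T k" .
    moreover have "Polynomial.coeff ((pderiv ^^ k) T) 0 = poly ((pderiv ^^ k) P) a"
      by (simp add: T poly_pcompose flip: poly_0_coeff_0)
    ultimately have "p dvd fact k * Polynomial.coeff T k" using van[OF k] by simp
    moreover have "\<not> p dvd fact k"
    proof
      assume "p dvd fact k"
      moreover obtain q where q: "p = int q" using p prime_ge_0_int zero_le_imp_eq_int by blast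
      ultimately have "q dvd fact k" by (metis of_nat_dvd_iff of_nat_fact)
      then have "q \<le> k" using p q by (simp add: prime_dvd_fact_iff)
      then show False using k l q by simp
    qed
    ultimately show ?thesis using p by (simp add: prime_dvd_mult_iff)
  qed
  have "T = Polynomial.monom 1 l * poly_shift l T + poly_cutoff l T"
    by (rule poly_eqI) (auto simp: coeff_monom_mult coeff_poly_shift coeff_poly_cutoff)
  moreover have "[:p:] dvd poly_cutoff l T"
    using c by (auto simp: const_poly_dvd_iff coeff_poly_cutoff)
  ultimately obtain U where U: "T = [:0, 1:] ^ l * poly_shift l T + [:p:] * U"
    by (metis dvdE monom_altdef smult_1_left)
  have "P = pcompose T [:-a, 1:]"
    by (simp add: T_def flip: pcompose_assoc) (simp add: pcompose_pCons pcompose_idR)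
  also have "\<dots> = pcompose ([:0, 1:] ^ l * poly_shift l T + [:p:] * U) [:-a, 1:]"
    using U by (rule arg_cong)
  also have "pcompose ([:0, 1:] ^ l) [:-a, 1:] = [:-a, 1:] ^ l"
    by (induction l) (simp_all add: pcompose_mult pcompose_1 pcompose_pCons)
  then have "pcompose ([:0, 1:] ^ l * poly_shift l T + [:p:] * U) [:-a, 1:]
    = [:-a, 1:] ^ l * pcompose (poly_shift l T) [:-a, 1:] + [:p:] * pcompose U [:-a, 1:]"
    by (simp add: pcompose_add pcompose_mult pcompose_smult)
  finally show ?thesis by blast
qed

text \<open>The factors \<open>X - b\<close> are split off one at a time. Evaluation at
  \<open>b\<close>, where \<open>M\<close> is invertible modulo \<open>p\<close>, shows that
  \<open>b\<close> is a root of \<open>Q\<close>; then \<open>X - b\<close> may be cancelled because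
  \<open>[:p:]\<close> is a prime element of \<open>int poly\<close> and does not divide
  \<open>X - b\<close>.\<close>

lemma cancel_power_linear_factor_mod:
  fixes p :: int
  assumes p: "prime p" and M: "\<not> p dvd poly M b"
    and eq: "M * Q = [:-b, 1:] ^ l * W + [:p:] * V"
  shows "\<exists>Q' U. Q = [:-b, 1:] ^ l * Q' + [:p:] * U"
  using eq
proof (induction l arbitrary: Q W V)
  case 0
  then show ?case by (intro exI[of _ Q] exI[of _ 0]) simp
next
  case (Suc l)
  have "poly M b * poly Q b = p * poly V b"
    using arg_cong[OF Suc.prems, of "\<lambda>P. poly P b"] by simp
  then have "p dvd poly M b * poly Q b" by simp
  then have "p dvd poly Q b" using p M by (simp add: prime_dvd_mult_iff)
  then obtain Q1 U where Q: "Q = [:-b, 1:] * Q1 + [:p:] * U" using linear_factor_mod by blast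
  have "[:-b, 1:] * (M * Q1 - [:-b, 1:] ^ l * W) = [:p:] * (V - M * U)"
    using Suc.prems unfolding Q by (simp add: algebra_simps)
  then have "[:p:] dvd [:-b, 1:] * (M * Q1 - [:-b, 1:] ^ l * W)" by (rule dvdI)
  moreover have "\<not> [:p:] dvd [:-b, 1:]"
  proof
    assume "[:p:] dvd [:-b, 1:]"
    then have "p dvd Polynomial.coeff [:-b, 1:] 1" by (simp only: const_poly_dvd_iff)
    then show False using p by auto
  qed
  ultimately have "[:p:] dvd M * Q1 - [:-b, 1:] ^ l * W"
    using prime_elem_dvd_mult_iff[OF prime_elem_const_int[OF p]] by blast
  then obtain V' where "M * Q1 - [:-b, 1:] ^ l * W = [:p:] * V'" by (elim dvdE)
  then have "M * Q1 = [:-b, 1:] ^ l * W + [:p:] * V'" by (simp add: algebra_simps)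
  from Suc.IH[OF this] obtain Q' U' where "Q1 = [:-b, 1:] ^ l * Q' + [:p:] * U'" by blast
  then have "Q = [:-b, 1:] ^ Suc l * Q' + [:p:] * ([:-b, 1:] * U' + U)"
    unfolding Q by (simp add: algebra_simps)
  then show ?case by blast
qed

text \<open>Distinct representatives in \<open>{0..<p}\<close> are incongruent, so the product of
  the factors already split off is invertible at the next root and can be cancelled there.\<close>

lemma prod_power_linear_factor_mod:
  fixes p :: int
  assumes p: "prime p" and S: "finite S" "S \<subseteq> {0..<p}"
    and van: "\<And>a. a \<in> S \<Longrightarrow> \<exists>Q U. P = [:-a, 1:] ^ l * Q + [:p:] * U"
  shows "\<exists>Q U. P = (\<Prod>a\<in>S. [:-a, 1:] ^ l) * Q + [:p:] * U"
  using S van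
proof (induction S rule: finite_induct)
  case empty
  then show ?case by (intro exI[of _ P] exI[of _ 0]) simp
next
  case (insert b S)
  define M where "M = (\<Prod>a\<in>S. [:-a, 1:] ^ l)"
  obtain Q U where PQ: "P = M * Q + [:p:] * U" unfolding M_def using insert by blast
  obtain W V where PW: "P = [:-b, 1:] ^ l * W + [:p:] * V" using insert by blast
  have M: "\<not> p dvd poly M b"
  proof
    assume "p dvd poly M b"
    then have "p dvd (\<Prod>a\<in>S. (b - a) ^ l)" by (simp add: M_def poly_prod)
    then obtain a where a: "a \<in> S" "p dvd (b - a) ^ l"
      using p insert.hyps by (auto simp: prime_dvd_prod_iff)
    then have "p dvd b - a" using p prime_dvd_power by blast
    moreover have "a \<in> {0..<p}" "b \<in> {0..<p}" using a insert.prems by auto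
    ultimately have "a = b"
      by (metis (mono_tags, opaque_lifting) atLeastLessThan_iff mod_eq_dvd_iff mod_pos_pos_trivial)
    then show False using a insert.hyps by simp
  qed
  have "M * Q = [:-b, 1:] ^ l * W + [:p:] * (V - U)"
    using PQ PW by (simp add: smult_diff_right)
  from cancel_power_linear_factor_mod[OF p M this]
  obtain Q' U' where "Q = [:-b, 1:] ^ l * Q' + [:p:] * U'" by blast
  then have "P = (\<Prod>a\<in>insert b S. [:-a, 1:] ^ l) * Q' + [:p:] * (M * U' + U)"
    using insert.hyps PQ unfolding M_def by (simp add: algebra_simps)
  then show ?case by blast
qed

text \<open>If \<open>p\<close> divides the leading coefficient of \<open>Q\<close>, the leading
  term is moved into \<open>U\<close> and the degree of \<open>Q\<close> drops. Otherwise the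
  leading coefficient of \<open>M * Q\<close> survives modulo \<open>p\<close>, and \<open>P\<close>
  has a nonzero coefficient in degree \<open>degree M + degree Q\<close>.\<close>

lemma degree_ge_of_monic_dvd_mod:
  fixes p :: int
  assumes p: "prime p" and M: "lead_coeff M = 1"
    and P: "P = M * Q + [:p:] * U" "\<not> [:p:] dvd P"
  shows "degree M \<le> degree P"
  using P
proof (induction "degree Q" arbitrary: Q U rule: less_induct)
  case less
  have "Q \<noteq> 0"
  proof
    assume "Q = 0"
    then have "P = [:p:] * U" using less.prems by simp
    then show False using less.prems(2) by (metis dvdI)
  qed
  show ?case
  proof (cases "p dvd lead_coeff Q")
    case False
    have "Polynomial.coeff (M * Q) (degree M + degree Q) = lead_coeff Q"
      using M by (simp add: coeff_mult_degree_sum)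
    then have "Polynomial.coeff P (degree M + degree Q) \<noteq> 0"
      using less.prems(1) False
      by (metis (no_types, lifting) add_eq_0_iff coeff_add dvd_minus_iff coeff_smult dvd_triv_left mult_pCons_left add.right_neutral pCons_0_0 mult_zero_left)
    then show ?thesis using le_degree by fastforce
  next
    case True
    then obtain u where u: "lead_coeff Q = p * u" by auto
    define n where "n = degree Q"
    define Q' where "Q' = Q - Polynomial.monom (lead_coeff Q) n"
    have eq: "P = M * Q' + [:p:] * (U + M * Polynomial.monom u n)"
      using less.prems u by (simp add: Q'_def algebra_simps smult_monom)
    show ?thesis
    proof (cases "Q' = 0")
      case True
      then have "P = [:p:] * (U + M * Polynomial.monom u n)" using eq by simp
      then have "[:p:] dvd P" by (rule dvdI)
      then show ?thesis using less.prems(2) by blast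
    next
      case False
      have "degree Q' \<le> n"
        unfolding Q'_def n_def by (intro degree_diff_le degree_monom_le order_refl)
      moreover have "Polynomial.coeff Q' n = 0" by (simp add: Q'_def n_def)
      ultimately have "degree Q' < degree Q"
        using False unfolding n_def by (metis le_neq_implies_less leading_coeff_0_iff)
      from less.hyps[OF this eq less.prems(2)] show ?thesis .
    qed
  qed
qed

text \<open>The root count with multiplicity on which Stepanov's method rests: many zeros of high
  order force a large degree.\<close>

lemma card_multiple_roots_mod_le:
  fixes p :: int
  assumes p: "prime p" and l: "int l \<le> p" and S: "S \<subseteq> {0..<p}"
    and van: "\<And>a k. a \<in> S \<Longrightarrow> k < l \<Longrightarrow> p dvd poly ((pderiv ^^ k) P) a"
    and P: "\<not> [:p:] dvd P"
  shows "l * card S \<le> degree P"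
proof -
  have fin: "finite S" using S finite_subset by blast
  have "\<exists>Q U. P = (\<Prod>a\<in>S. [:-a, 1:] ^ l) * Q + [:p:] * U"
    by (intro prod_power_linear_factor_mod power_linear_factor_mod p fin S l van)
  moreover have "lead_coeff (\<Prod>a\<in>S. [:-a, 1:] ^ l) = 1"
    by (simp add: lead_coeff_prod lead_coeff_power)
  ultimately have "degree (\<Prod>a\<in>S. [:-a, 1:] ^ l) \<le> degree P"
    using degree_ge_of_monic_dvd_mod[OF p _ _ P] by blast
  moreover have "degree (\<Prod>a\<in>S. [:-a, 1:] ^ l) = l * card S"
    by (subst degree_prod_eq_sum_degree) (auto simp: degree_power_eq)
  ultimately show ?thesis by simp
qed

section \<open>Stepanov's method\<close>

text \<open>Modulo \<open>p\<close>, the derivative of \<open>f ^ n * r * X ^ (p * j)\<close> is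
  \<open>f ^ (n - 1) * stepanov_deriv f n r * X ^ (p * j)\<close>.\<close>

definition stepanov_deriv :: "int poly \<Rightarrow> nat \<Rightarrow> int poly \<Rightarrow> int poly" where
  "stepanov_deriv f n r = f * pderiv r + of_nat n * (pderiv f * r)"

text \<open>Every derivative lowers the exponent of \<open>f\<close> by one, hence
  \<open>n - k\<close> at step \<open>k\<close>. The truncated subtraction is harmless because the
  link with derivatives is made for \<open>k <= n\<close> only.\<close>

primrec stepanov_deriv_iter :: "int poly \<Rightarrow> nat \<Rightarrow> nat \<Rightarrow> int poly \<Rightarrow> int poly" where
  "stepanov_deriv_iter f n 0 r = r"
| "stepanov_deriv_iter f n (Suc k) r = stepanov_deriv f (n - k) (stepanov_deriv_iter f n k r)"

lemma stepanov_deriv_iter_diff: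
  "stepanov_deriv_iter f n k (r - r') = stepanov_deriv_iter f n k r - stepanov_deriv_iter f n k r'"
proof (induction k)
  case (Suc k)
  have "stepanov_deriv f n (a - b) = stepanov_deriv f n a - stepanov_deriv f n b" for n a b
    by (simp add: stepanov_deriv_def pderiv_diff algebra_simps)
  then show ?case using Suc by simp
qed simp

lemma degree_stepanov_deriv_iter:
  "degree (stepanov_deriv_iter f n k r) \<le> degree r + k * degree f"
proof (induction k)
  case (Suc k)
  let ?s = "stepanov_deriv_iter f n k r"
  have "degree (f * pderiv ?s) \<le> degree f + degree ?s"
    by (rule order_trans[OF degree_mult_le]) (simp add: degree_pderiv)
  moreover have "degree (of_nat (n - k) * (pderiv f * ?s)) \<le> degree f + degree ?s"
    by (rule order_trans[OF degree_mult_le])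
       (simp add: order_trans[OF degree_mult_le] degree_pderiv)
  ultimately have "degree (stepanov_deriv f (n - k) ?s) \<le> degree f + degree ?s"
    unfolding stepanov_deriv_def by (rule degree_add_le)
  then show ?case using Suc by simp
qed simp

text \<open>Powers of \<open>X ^ p\<close> are constants for differentiation modulo
  \<open>p\<close>: they enlarge the supply of auxiliary polynomials without complicating the
  derivatives.\<close>

lemma pderiv_monom_mod:
  "\<exists>U. pderiv (Polynomial.monom 1 (p * j) :: int poly) = [:int p:] * U"
  by (rule exI[of _ "Polynomial.monom (int j) (p * j - 1)"]) (simp add: pderiv_monom smult_monom)

lemma pderiv_stepanov_term:
  "\<exists>U. pderiv (f ^ Suc n * r * Polynomial.monom 1 (p * j)) =
     f ^ n * stepanov_deriv f (Suc n) r * Polynomial.monom 1 (p * j) + [:int p:] * U"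
proof -
  let ?X = "Polynomial.monom 1 (p * j) :: int poly"
  obtain U where U: "pderiv ?X = [:int p:] * U" using pderiv_monom_mod by blast
  have "pderiv (f ^ Suc n) = of_nat (Suc n) * (f ^ n * pderiv f)"
    unfolding pderiv_power_Suc of_nat_poly by (simp del: of_nat_Suc)
  then have "pderiv (f ^ Suc n * r * ?X) =
    f ^ n * stepanov_deriv f (Suc n) r * ?X + f ^ Suc n * r * pderiv ?X"
    unfolding stepanov_deriv_def pderiv_mult by (simp only: algebra_simps power_Suc)
  also have "\<dots> = f ^ n * stepanov_deriv f (Suc n) r * ?X + [:int p:] * (f ^ Suc n * r * U)"
    unfolding U by (simp only: mult_ac)
  finally show ?thesis by blast
qed

lemma higher_pderiv_stepanov_term:
  "k \<le> n \<Longrightarrow> \<exists>U. (pderiv ^^ k) (f ^ n * r * Polynomial.monom 1 (p * j)) =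
     f ^ (n - k) * stepanov_deriv_iter f n k r * Polynomial.monom 1 (p * j) + [:int p:] * U"
proof (induction k)
  case 0
  show ?case by (intro exI[of _ 0]) simp
next
  case (Suc k)
  let ?X = "Polynomial.monom 1 (p * j) :: int poly"
  let ?s = "stepanov_deriv_iter f n k r"
  obtain U where U: "(pderiv ^^ k) (f ^ n * r * ?X) = f ^ (n - k) * ?s * ?X + [:int p:] * U"
    using Suc by auto
  have n: "n - k = Suc (n - Suc k)" using Suc.prems by simp
  obtain V where V: "pderiv (f ^ Suc (n - Suc k) * ?s * ?X) =
     f ^ (n - Suc k) * stepanov_deriv f (Suc (n - Suc k)) ?s * ?X + [:int p:] * V"
    using pderiv_stepanov_term by blast
  have "(pderiv ^^ Suc k) (f ^ n * r * ?X) = pderiv (f ^ (n - k) * ?s * ?X) + [:int p:] * pderiv U"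
    by (simp add: U pderiv_add pderiv_smult)
  also have "\<dots> = f ^ (n - Suc k) * stepanov_deriv_iter f n (Suc k) r * ?X + [:int p:] * (V + pderiv U)"
    unfolding n V by (simp add: n smult_add_right)
  finally show ?case by blast
qed

lemma int_fermat_little:
  fixes a :: int assumes "prime p"
  shows "[a ^ p = a] (mod int p)"
proof -
  define b where "b = nat (a mod int p)"
  have p0: "p > 0" using assms prime_gt_0_nat by blast
  have ab: "[a = int b] (mod int p)" using p0 by (simp add: b_def cong_def)
  have "[b ^ p = b] (mod p)"
  proof (cases "p dvd b")
    case True
    then show ?thesis using p0
      by (metis cong_0_iff cong_sym cong_trans dvd_power dvd_trans)
  next
    case False
    then have "[b ^ (p - 1) = 1] (mod p)" using assms fermat_theorem by blast
    then have "[b * b ^ (p - 1) = b * 1] (mod p)" by (rule cong_scalar_left)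
    then show ?thesis using p0 by (metis mult.right_neutral power_eq_if less_not_refl)
  qed
  then have "[int b ^ p = int b] (mod int p)" by (metis cong_int_iff of_nat_power)
  then show ?thesis using ab by (meson cong_pow cong_sym cong_trans)
qed

lemma int_fermat_little_power:
  fixes a :: int assumes "prime p"
  shows "[a ^ (p * j) = a ^ j] (mod int p)"
  using cong_pow[OF int_fermat_little[OF assms]] by (simp add: power_mult)

text \<open>Where \<open>f ^ c\<close> takes the value \<open>\<zeta>\<close> modulo \<open>p\<close>, the \<open>k\<close>-th derivative of \<open>stepanov_poly\<close> equals
  \<open>stepanov_system\<close> up to a power of \<open>f\<close>, since \<open>a ^ p\<close> and \<open>a\<close> are congruent.  The latter has low degree,
  so that it can be made to vanish identically for all \<open>k < l\<close>.\<close>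

definition stepanov_poly ::
  "nat \<Rightarrow> nat \<Rightarrow> nat \<Rightarrow> nat \<Rightarrow> nat \<Rightarrow> int poly \<Rightarrow> (nat \<Rightarrow> nat \<Rightarrow> int poly) \<Rightarrow> int poly" where
  "stepanov_poly p c l d J f r =
     (\<Sum>i<d. \<Sum>j<J. f ^ (l + c * i) * r i j * Polynomial.monom 1 (p * j))"

definition stepanov_system ::
  "nat \<Rightarrow> nat \<Rightarrow> nat \<Rightarrow> nat \<Rightarrow> int poly \<Rightarrow> int \<Rightarrow> nat \<Rightarrow> (nat \<Rightarrow> nat \<Rightarrow> int poly) \<Rightarrow> int poly" where
  "stepanov_system c l d J f \<zeta> k r =
     (\<Sum>i<d. \<Sum>j<J. Polynomial.smult (\<zeta> ^ i) (Polynomial.monom 1 j * stepanov_deriv_iter f (l + c * i) k (r i j)))"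

lemma stepanov_poly_vanishes:
  assumes p: "prime p" and k: "k < l" and a: "[poly f a ^ c = \<zeta>] (mod int p)"
    and sys: "[:int p:] dvd stepanov_system c l d J f \<zeta> k r"
  shows "int p dvd poly ((pderiv ^^ k) (stepanov_poly p c l d J f r)) a"
proof -
  let ?X = "\<lambda>j. Polynomial.monom 1 (p * j) :: int poly"
  let ?s = "\<lambda>i j. stepanov_deriv_iter f (l + c * i) k (r i j)"
  have "[poly ((pderiv ^^ k) (f ^ (l + c * i) * r i j * ?X j)) a =
         poly f a ^ (l - k) * poly (Polynomial.smult (\<zeta> ^ i) (Polynomial.monom 1 j * ?s i j)) a] (mod int p)" for i j
  proof -
    obtain U where U: "(pderiv ^^ k) (f ^ (l + c * i) * r i j * ?X j) =
       f ^ (l + c * i - k) * ?s i j * ?X j + [:int p:] * U"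
      using higher_pderiv_stepanov_term[of k "l + c * i" f "r i j" p j] k by auto
    have e: "l + c * i - k = (l - k) + c * i" using k by simp
    have "[poly ((pderiv ^^ k) (f ^ (l + c * i) * r i j * ?X j)) a =
        poly f a ^ (l - k) * (poly f a ^ c) ^ i * poly (?s i j) a * a ^ (p * j)] (mod int p)"
      unfolding U e by (simp add: poly_monom power_add power_mult cong_def)
    also have "[poly f a ^ (l - k) * (poly f a ^ c) ^ i * poly (?s i j) a * a ^ (p * j) =
        poly f a ^ (l - k) * \<zeta> ^ i * poly (?s i j) a * a ^ j] (mod int p)"
      by (intro cong_mult cong_pow a cong_refl int_fermat_little_power p)
    finally show ?thesis by (simp add: poly_monom mult_ac)
  qed
  then have "[(\<Sum>i<d. \<Sum>j<J. poly ((pderiv ^^ k) (f ^ (l + c * i) * r i j * ?X j)) a) =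
    (\<Sum>i<d. \<Sum>j<J. poly f a ^ (l - k) * poly (Polynomial.smult (\<zeta> ^ i) (Polynomial.monom 1 j * ?s i j)) a)] (mod int p)"
    by (intro cong_sum) auto
  moreover have "(\<Sum>i<d. \<Sum>j<J. poly f a ^ (l - k) * poly (Polynomial.smult (\<zeta> ^ i) (Polynomial.monom 1 j * ?s i j)) a)
     = poly f a ^ (l - k) * poly (stepanov_system c l d J f \<zeta> k r) a"
    by (simp only: stepanov_system_def poly_sum sum_distrib_left)
  moreover have "int p dvd poly (stepanov_system c l d J f \<zeta> k r) a"
    using sys by (rule const_dvd_poly_imp_dvd_poly)
  moreover have "poly ((pderiv ^^ k) (stepanov_poly p c l d J f r)) a =
    (\<Sum>i<d. \<Sum>j<J. poly ((pderiv ^^ k) (f ^ (l + c * i) * r i j * ?X j)) a)"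
    by (simp only: stepanov_poly_def higher_pderiv_sum poly_sum)
  ultimately show ?thesis by (metis cong_dvd_iff dvd_mult)
qed

lemma degree_stepanov_term:
  assumes "lead_coeff f = 1" "r \<noteq> (0 :: int poly)"
  shows "degree (f ^ n * r * Polynomial.monom 1 k) = n * degree f + degree r + k"
    and "lead_coeff (f ^ n * r * Polynomial.monom 1 k) = lead_coeff r"
proof -
  have "f \<noteq> 0" using assms by auto
  then show "degree (f ^ n * r * Polynomial.monom 1 k) = n * degree f + degree r + k"
    using assms by (simp add: degree_mult_eq degree_power_eq degree_monom_eq monom_eq_0_iff)
  show "lead_coeff (f ^ n * r * Polynomial.monom 1 k) = lead_coeff r"
    using assms by (simp add: lead_coeff_mult lead_coeff_power degree_monom_eq)
qed

lemma degree_stepanov_poly: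
  assumes f: "lead_coeff f = 1" and A: "\<And>i j. i < d \<Longrightarrow> j < J \<Longrightarrow> degree (r i j) \<le> A"
  shows "degree (stepanov_poly p c l d J f r)
    \<le> (l + c * (d - 1)) * degree f + A + p * (J - 1)"
  unfolding stepanov_poly_def
proof (intro degree_sum_le finite_lessThan)
  fix i j assume ij: "i \<in> {..<d}" "j \<in> {..<J}"
  show "degree (f ^ (l + c * i) * r i j * Polynomial.monom 1 (p * j))
    \<le> (l + c * (d - 1)) * degree f + A + p * (J - 1)"
  proof (cases "r i j = 0")
    case False
    have "(l + c * i) * degree f \<le> (l + c * (d - 1)) * degree f"
      using ij by (intro mult_right_mono add_left_mono mult_left_mono) auto
    moreover have "p * j \<le> p * (J - 1)" using ij by (intro mult_left_mono) auto
    moreover have "degree (r i j) \<le> A" using A ij by simp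
    ultimately show ?thesis by (subst degree_stepanov_term(1)[OF f False]) linarith
  qed simp
qed

text \<open>Hence the summands of \<open>stepanov_poly\<close> have distinct degrees, and it cannot vanish.\<close>

lemma stepanov_exponent_gap:
  fixes p c d m A i j i' j' :: nat
  assumes dc: "d * c = p - 1" and A: "d * A + d * m \<le> p" and co: "coprime m d"
    and i: "i < d" "i' < d" and ne: "(i, j) \<noteq> (i', j')"
    and le: "c * i * m + p * j \<le> c * i' * m + p * j'" and p: "p > 0"
  shows "c * i * m + p * j + A \<le> c * i' * m + p * j'"
proof -
  let ?E = "\<lambda>i j. c * i * m + p * j"
  \<comment> \<open>Since \<open>d * c = p - 1\<close>, the exponent times \<open>d\<close> is
    \<open>p * (i * m + d * j)\<close> up to the small term \<open>i * m\<close>. Different values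
    of \<open>i * m + d * j\<close> therefore put the exponents at least \<open>A\<close> apart, and
    equal values force \<open>i = i'\<close> because \<open>m\<close> and \<open>d\<close> are
    coprime.\<close>
  have E: "int d * int (?E i j) = int p * (int i * int m + int d * int j) - int i * int m" for i j
  proof -
    have "int (d * c) = int p - 1" unfolding dc using p by simp
    moreover have "int d * int (?E i j) = int (d * c) * (int i * int m) + int d * int p * int j"
      by (simp add: algebra_simps)
    ultimately have "int d * int (?E i j) = (int p - 1) * (int i * int m) + int d * int p * int j"
      by (simp only:)
    then show ?thesis by (simp add: algebra_simps)
  qed
  let ?u = "int i * int m + int d * int j" and ?u' = "int i' * int m + int d * int j'"
  have im: "int i * int m \<ge> 0" "int i' * int m \<ge> 0"
     "int i * int m \<le> int d * int m" "int i' * int m \<le> int d * int m" using i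
    by (simp_all add: mult_right_mono)
  have A': "int d * int A + int d * int m \<le> int p" using A by (metis of_nat_add of_nat_le_iff of_nat_mult)
  have d0: "int d > 0" using i by simp
  have key: "int d * int A \<le> int d * int (?E i2 j2) - int d * int (?E i1 j1)"
    if lt: "int i1 * int m + int d * int j1 < int i2 * int m + int d * int j2"
     and "i1 < d" "i2 < d" for i1 j1 i2 j2
  proof -
    have "int p * 1 \<le> int p * ((int i2 * int m + int d * int j2) - (int i1 * int m + int d * int j1))"
      using lt by (intro mult_left_mono) auto
    moreover have "int i2 * int m \<le> int d * int m" "int i1 * int m \<ge> 0"
      using that by (simp_all add: mult_right_mono)
    ultimately show ?thesis unfolding E right_diff_distrib using A' by linarith
  qed
  consider "?u < ?u'" | "?u' < ?u" | "?u = ?u'" by linarith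
  then show ?thesis
  proof cases
    case 1
    from key[OF 1] i have "int d * int A \<le> int d * (int (?E i' j') - int (?E i j))"
      by (simp add: algebra_simps)
    then have "int A \<le> int (?E i' j') - int (?E i j)" using d0 by (simp only: mult_le_cancel_left_pos)
    then show ?thesis by linarith
  next
    case 2
    from key[OF 2] i have "int d * int A \<le> int d * (int (?E i j) - int (?E i' j'))"
      by (simp add: algebra_simps)
    then have "int A \<le> int (?E i j) - int (?E i' j')" using d0 by (simp only: mult_le_cancel_left_pos)
    then show ?thesis using le by linarith
  next
    case 3
    then have "int m * (int i - int i') = int d * (int j' - int j)" by (simp add: algebra_simps)
    then have "int d dvd int m * (int i - int i')" by simp
    moreover have "coprime (int d) (int m)" using co by (simp add: coprime_commute)
    ultimately have "int d dvd int i - int i'" by (simp add: coprime_dvd_mult_right_iff)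
    then have "int i = int i'" using i
      by (metis mod_eq_dvd_iff mod_pos_pos_trivial of_nat_0_le_iff of_nat_less_iff)
    then have "i = i'" by simp
    with 3 d0 have "j = j'" by simp
    then show ?thesis using ne \<open>i = i'\<close> by simp
  qed
qed

text \<open>Among the nonzero \<open>r i j\<close>, take the one with the largest exponent. The gap
  \<open>A\<close> exceeds all degrees of the \<open>r i j\<close>, so its summand alone reaches the
  top degree. Its leading coefficient is a nonzero integer below \<open>p\<close> in absolute value
  and hence survives modulo \<open>p\<close>.\<close>

lemma stepanov_poly_nonzero:
  assumes p: "prime p" and dc: "d * c = p - 1" and f: "lead_coeff f = 1"
    and A: "d * A + d * degree f \<le> p" and co: "coprime (degree f) d"
    and r: "\<And>i j. i < d \<Longrightarrow> j < J \<Longrightarrow> degree (r i j) < A"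
    and small: "\<And>i j n. i < d \<Longrightarrow> j < J \<Longrightarrow> \<bar>Polynomial.coeff (r i j) n\<bar> < int p"
    and nz: "i0 < d" "j0 < J" "r i0 j0 \<noteq> 0"
  shows "\<not> [:int p:] dvd stepanov_poly p c l d J f r"
proof -
  define I where "I = {x \<in> {..<d} \<times> {..<J}. r (fst x) (snd x) \<noteq> 0}"
  define m where "m = degree f"
  define e where "e = (\<lambda>x :: nat \<times> nat. c * fst x * m + p * snd x)"
  define tm where "tm = (\<lambda>x. f ^ (l + c * fst x) * r (fst x) (snd x) * Polynomial.monom 1 (p * snd x))"
  have fin: "finite I" by (simp add: I_def)
  have "I \<noteq> {}" using nz by (auto simp: I_def)
  then obtain x where x: "x \<in> I" "\<And>y. y \<in> I \<Longrightarrow> e y \<le> e x"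
    using finite_has_maximal[of "e ` I"] fin by (metis (no_types, lifting) finite_imageI image_iff image_is_empty linorder_linear obtains_MAX)
  define N where "N = degree (tm x)"
  have dterm: "degree (tm y) = l * m + e y + degree (r (fst y) (snd y))" if "y \<in> I" for y
  proof -
    have "r (fst y) (snd y) \<noteq> 0" using that by (simp add: I_def)
    then show ?thesis
      unfolding tm_def e_def m_def by (subst degree_stepanov_term(1)[OF f]) (simp_all add: algebra_simps)
  qed
  have less: "degree (tm y) < N" if y: "y \<in> I" "y \<noteq> x" for y
  proof -
    have "e y + A \<le> e x" unfolding e_def m_def
      using stepanov_exponent_gap[OF dc A co, of "fst y" "fst x" "snd y" "snd x"] x y prime_gt_0_nat[OF p]
      by (auto simp: I_def e_def m_def prod_eq_iff)
    moreover have "degree (r (fst y) (snd y)) < A" using y r by (auto simp: I_def)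
    ultimately show ?thesis unfolding N_def dterm[OF y(1)] dterm[OF x(1)] by linarith
  qed
  have "stepanov_poly p c l d J f r = (\<Sum>y\<in>{..<d} \<times> {..<J}. tm y)"
    by (simp add: stepanov_poly_def tm_def sum.cartesian_product case_prod_beta)
  also have "\<dots> = (\<Sum>y\<in>I. tm y)"
    by (rule sum.mono_neutral_right) (auto simp: I_def tm_def)
  finally have "Polynomial.coeff (stepanov_poly p c l d J f r) N = (\<Sum>y\<in>I. Polynomial.coeff (tm y) N)"
    by (simp add: coeff_sum)
  also have "\<dots> = Polynomial.coeff (tm x) N + (\<Sum>y\<in>I - {x}. Polynomial.coeff (tm y) N)"
    using fin x by (simp add: sum.remove)
  also have "(\<Sum>y\<in>I - {x}. Polynomial.coeff (tm y) N) = 0"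
    by (rule sum.neutral) (auto intro!: coeff_eq_0 less)
  also have "Polynomial.coeff (tm x) N = lead_coeff (r (fst x) (snd x))"
    unfolding N_def tm_def using x by (subst degree_stepanov_term(2)[OF f]) (auto simp: I_def)
  finally have "Polynomial.coeff (stepanov_poly p c l d J f r) N = lead_coeff (r (fst x) (snd x))" by simp
  moreover have "\<not> int p dvd lead_coeff (r (fst x) (snd x))"
  proof
    assume "int p dvd lead_coeff (r (fst x) (snd x))"
    moreover have "lead_coeff (r (fst x) (snd x)) \<noteq> 0" using x by (simp add: I_def)
    ultimately have "int p \<le> \<bar>lead_coeff (r (fst x) (snd x))\<bar>"
      using zdvd_imp_le by (metis dvd_abs_iff zero_less_abs_iff)
    moreover have "\<bar>lead_coeff (r (fst x) (snd x))\<bar> < int p"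
      using x(1) by (intro small) (auto simp: I_def)
    ultimately show False by linarith
  qed
  ultimately show ?thesis by (metis const_poly_dvd_iff)
qed

lemma degree_stepanov_system:
  assumes r: "\<And>i j. i < d \<Longrightarrow> j < J \<Longrightarrow> degree (r i j) \<le> A"
  shows "degree (stepanov_system c l d J f \<zeta> k r) \<le> A + k * degree f + J"
  unfolding stepanov_system_def
proof (intro degree_sum_le finite_lessThan)
  fix i j assume ij: "i \<in> {..<d}" "j \<in> {..<J}"
  let ?s = "stepanov_deriv_iter f (l + c * i) k (r i j)"
  have "degree ?s \<le> A + k * degree f"
    using degree_stepanov_deriv_iter[of f "l + c * i" k "r i j"] r[of i j] ij by simp
  moreover have "degree (Polynomial.monom (1::int) j) \<le> j" by (rule degree_monom_le)
  ultimately have "degree (Polynomial.monom 1 j * ?s) \<le> A + k * degree f + J"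
    using degree_mult_le[of "Polynomial.monom (1::int) j" ?s] ij by simp
  then show "degree (Polynomial.smult (\<zeta> ^ i) (Polynomial.monom 1 j * ?s)) \<le> A + k * degree f + J"
    using degree_smult_le order_trans by blast
qed

text \<open>There are more coefficient vectors with entries in \<open>{0..<p}\<close> than right-hand sides, so two of them
  agree on the system; \<open>r\<close> is their difference.\<close>

lemma exists_stepanov_solution:
  assumes p: "prime p" and A: "A \<ge> 1"
    and count: "l * (A + l * degree f + J) < d * J * A"
  obtains r i0 j0 where
    "\<And>i j. degree (r i j) < A"
    "\<And>i j n. \<bar>Polynomial.coeff (r i j) n\<bar> < int p"
    "i0 < d" "j0 < J" "r i0 j0 \<noteq> 0"
    "\<And>k. k < l \<Longrightarrow> [:int p:] dvd stepanov_system c l d J f \<zeta> k r"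
proof -
  \<comment> \<open>\<open>E\<close> exceeds the degree of each system polynomial, so
    \<open>l * E\<close> residues have to vanish while \<open>d * J * A\<close> coefficients are
    free.\<close>
  define E where "E = A + l * degree f + J"
  define W where "W = PiE (({..<d} \<times> {..<J}) \<times> {..<A}) (\<lambda>_. {0..<int p})"
  define Y where "Y = PiE ({..<l} \<times> {..<E}) (\<lambda>_. {0..<int p})"
  define q where "q = (\<lambda>w :: (nat \<times> nat) \<times> nat \<Rightarrow> int. \<lambda>i j. \<Sum>n<A. Polynomial.monom (w ((i, j), n)) n)"
  define \<Phi> where "\<Phi> = (\<lambda>w. \<lambda>x\<in>{..<l} \<times> {..<E}.
     Polynomial.coeff (stepanov_system c l d J f \<zeta> (fst x) (q w)) (snd x) mod int p)"
  have p1: "p > 1" using p prime_gt_1_nat by blast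
  have cq: "Polynomial.coeff (q w i j) n = (if n < A then w ((i, j), n) else 0)" for w i j n
    by (simp add: q_def coeff_sum coeff_monom if_distrib cong: if_cong)
  have sys: "stepanov_system c l d J f \<zeta> k (\<lambda>i j. q w i j - q w' i j) =
     stepanov_system c l d J f \<zeta> k (q w) - stepanov_system c l d J f \<zeta> k (q w')" for k w w'
    by (simp add: stepanov_system_def stepanov_deriv_iter_diff algebra_simps smult_diff_right sum_subtractf)
  have "card Y = p ^ (l * E)" by (simp add: Y_def card_PiE card_cartesian_product)
  moreover have "card W = p ^ (d * J * A)" by (simp add: W_def card_PiE card_cartesian_product)
  moreover have "p ^ (l * E) < p ^ (d * J * A)"
    using count p1 by (simp add: E_def)
  moreover have fY: "finite Y" by (auto simp: Y_def intro!: finite_PiE)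
  moreover have \<Phi>Y: "\<Phi> ` W \<subseteq> Y" 
    unfolding \<Phi>_def Y_def by (intro image_subsetI restrict_PiE[THEN iffD2]) (use p1 in simp)
  then have "card (\<Phi> ` W) \<le> card Y" using fY by (rule card_mono[rotated])
  ultimately have "card (\<Phi> ` W) < card W" by linarith
  then have "\<not> inj_on \<Phi> W" by (rule pigeonhole)
  then obtain w w' where w: "w \<in> W" "w' \<in> W" "w \<noteq> w'" "\<Phi> w = \<Phi> w'" unfolding inj_on_def by blast
  define r where "r = (\<lambda>i j. q w i j - q w' i j)"
  have "\<exists>x\<in>({..<d} \<times> {..<J}) \<times> {..<A}. w x \<noteq> w' x"
  proof (rule ccontr)
    assume "\<not> ?thesis"
    then have "w x = w' x" if "x \<in> ({..<d} \<times> {..<J}) \<times> {..<A}" for x using that by blast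
    then have "w = w'" using PiE_ext[OF w(1,2)[unfolded W_def]] by blast
    then show False using w(3) by simp
  qed
  then obtain i0 j0 n0 where x: "i0 < d" "j0 < J" "n0 < A" "w ((i0, j0), n0) \<noteq> w' ((i0, j0), n0)"
    by auto
  \<comment> \<open>Outside the index box the extensional functions \<open>w\<close> and
    \<open>w'\<close> are \<open>undefined\<close>; the solution is set to 0 there.\<close>
  define r' where "r' = (\<lambda>i j. if i < d \<and> j < J then r i j else 0)"
  show thesis
  proof (rule that[of r' i0 j0])
    show dr: "degree (r' i j) < A" for i j
    proof -
      have "degree (r' i j) \<le> A - 1"
        by (rule degree_le) (auto simp: r'_def r_def cq)
      then show ?thesis using A by simp
    qed
    show "\<bar>Polynomial.coeff (r' i j) n\<bar> < int p" for i j n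
    proof (cases "i < d \<and> j < J \<and> n < A")
      case True
      then have "w ((i, j), n) \<in> {0..<int p}" "w' ((i, j), n) \<in> {0..<int p}"
        using w(1,2) unfolding W_def by (auto dest!: PiE_mem[where x = "((i, j), n)"])
      then show ?thesis using True by (auto simp: r'_def r_def cq)
    next
      case False
      then show ?thesis using p1 by (auto simp: r'_def r_def cq)
    qed
    show "i0 < d" "j0 < J" using x by auto
    have "Polynomial.coeff (r' i0 j0) n0 \<noteq> 0" using x by (simp add: r'_def r_def cq)
    then show "r' i0 j0 \<noteq> 0" by auto
    fix k assume k: "k < l"
    have eq: "stepanov_system c l d J f \<zeta> k r' = stepanov_system c l d J f \<zeta> k r"
      by (auto simp: stepanov_system_def r'_def intro!: sum.cong)
    have "int p dvd Polynomial.coeff (stepanov_system c l d J f \<zeta> k r') n" for n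
    proof (cases "n < E")
      case True
      then have "\<Phi> w (k, n) = \<Phi> w' (k, n)" using w by simp
      then show ?thesis using True k unfolding eq r_def sys
        by (simp add: \<Phi>_def mod_eq_dvd_iff)
    next
      case False
      have "degree (stepanov_system c l d J f \<zeta> k r') \<le> (A - 1) + k * degree f + J"
      proof (rule degree_stepanov_system)
        show "degree (r' i j) \<le> A - 1" for i j using dr[of i j] by linarith
      qed
      also have "\<dots> < E"
      proof -
        have "k * degree f \<le> l * degree f" using k by (intro mult_right_mono) auto
        then show ?thesis unfolding E_def using A by linarith
      qed
      finally show ?thesis using False by (simp add: coeff_eq_0)
    qed
    then show "[:int p:] dvd stepanov_system c l d J f \<zeta> k r'" by (simp add: const_poly_dvd_iff)
  qed
qed

text \<open>Every point of the level set is a zero of order \<open>l\<close> of the auxiliary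
  polynomial, so its degree limits their number. The sizes \<open>A\<close>, \<open>J\<close> and
  \<open>l\<close> stay free and are balanced afterwards.\<close>

theorem stepanov_bound_params:
  fixes f :: "int poly"
  assumes p: "prime p" and dc: "d * c = p - 1" and f: "lead_coeff f = 1"
    and A: "A \<ge> 1" "d * A + d * degree f \<le> p"
    and co: "coprime (degree f) d" and l: "l \<le> p"
    and count: "l * (A + l * degree f + J) < d * J * A"
  shows "l * card {a\<in>{0..<int p}. [poly f a ^ c = \<zeta>] (mod int p)}
    \<le> (l + c * (d - 1)) * degree f + A + p * (J - 1)"
proof -
  obtain r i0 j0 where r: "\<And>i j. degree (r i j) < A"
    "\<And>i j n. \<bar>Polynomial.coeff (r i j) n\<bar> < int p"
    "i0 < d" "j0 < J" "r i0 j0 \<noteq> 0"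
    "\<And>k. k < l \<Longrightarrow> [:int p:] dvd stepanov_system c l d J f \<zeta> k r"
    using exists_stepanov_solution[OF p A(1) count, of c \<zeta>] by metis
  have "l * card {a\<in>{0..<int p}. [poly f a ^ c = \<zeta>] (mod int p)}
     \<le> degree (stepanov_poly p c l d J f r)"
  proof (rule card_multiple_roots_mod_le)
    show "prime (int p)" using p by simp
    show "\<not> [:int p:] dvd stepanov_poly p c l d J f r"
      by (rule stepanov_poly_nonzero[where r = r, OF p dc f A(2) co _ _ r(3-5)]) (use r(1,2) in auto)
    show "int p dvd poly ((pderiv ^^ k) (stepanov_poly p c l d J f r)) a"
      if "a \<in> {a\<in>{0..<int p}. [poly f a ^ c = \<zeta>] (mod int p)}" "k < l" for a k
      using that(1) by (intro stepanov_poly_vanishes[OF p that(2) _ r(6)[OF that(2)]]) simp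
    show "int l \<le> int p" using l by simp
  qed blast
  also have "\<dots> \<le> (l + c * (d - 1)) * degree f + A + p * (J - 1)"
    by (rule degree_stepanov_poly[OF f]) (simp add: r(1) less_imp_le)
  finally show ?thesis .
qed

text \<open>With \<open>l = d * L\<close> and \<open>J = L + 1\<close> the degree bound divided by
  \<open>l\<close> has the main term \<open>p * L / (d * L) = p / d\<close>, the expected count;
  choosing \<open>L\<close> of order \<open>sqrt p\<close> makes the remaining terms
  \<open>O(sqrt p)\<close>.\<close>

theorem stepanov_bound:
  fixes f :: "int poly"
  defines "m \<equiv> degree f"
  assumes p: "prime p" and dc: "d * c = p - 1" and f: "lead_coeff f = 1"
    and co: "coprime m d" and d: "d \<ge> 1"
  shows "real (card {a\<in>{0..<int p}. [poly f a ^ c = \<zeta>] (mod int p)})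
    \<le> real p / real d + (real m + 2 * (real m + 1) * sqrt (2 * real d * (real d * real m + 2))) * sqrt (real p)"
    (is "real ?N \<le> _")
proof -
  define B where "B = 2 * real d * (real d * real m + 2)"
  have p1: "p > 1" using p prime_gt_1_nat by blast
  have B0: "B > 0" using d by (simp add: B_def add_nonneg_pos)
  have sp: "sqrt (real p) * sqrt (real p) = real p" by simp
  have "real ?N \<le> real p / real d + (real m + 2 * (real m + 1) * sqrt B) * sqrt (real p)"
  proof (cases "real p < B")
    \<comment> \<open>Below the threshold \<open>B\<close> the trivial bound
      \<open>p = sqrt p * sqrt p\<close> is already good enough.\<close>
    case True
    have "?N \<le> card {0..<int p}" by (rule card_mono) auto
    then have "real ?N \<le> real p" by simp
    also have "\<dots> = sqrt (real p) * sqrt (real p)" by simp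
    also have "\<dots> \<le> sqrt B * sqrt (real p)" using True by (intro mult_right_mono) auto
    also have "\<dots> \<le> (real m + 2 * (real m + 1) * sqrt B) * sqrt (real p)"
      using B0 by (intro mult_right_mono) (auto simp: algebra_simps)
    also have "\<dots> \<le> real p / real d + (real m + 2 * (real m + 1) * sqrt B) * sqrt (real p)" by simp
    finally show ?thesis .
  next
    case False
    then have pB: "B \<le> real p" by simp
    \<comment> \<open>\<open>A\<close> exhausts the condition \<open>d * A + d * m <= d * c\<close>.
      \<open>B\<close> is chosen such that \<open>y^2 * (d * m + 2) = p / (2 * d)\<close>, which
      lies below \<open>A\<close>; with \<open>L\<close> the integer part of \<open>y\<close> this
      is what the count of unknowns against equations requires.\<close>
    define A where "A = c - m"
    define y where "y = sqrt (real p / B)"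
    define L where "L = nat \<lfloor>y\<rfloor>"
    have y1: "y \<ge> 1" using pB B0 by (simp add: y_def)
    have L1: "L \<ge> 1" using y1 by (simp add: L_def le_nat_floor)
    have Ly: "real L \<le> y" using y1 by (simp add: L_def)
    have yL: "y \<le> 2 * real L"
    proof -
      have "y < real L + 1" using y1 unfolding L_def by linarith
      then show ?thesis using L1 by linarith
    qed
    have rdc: "real d * real c = real p - 1" using dc p1 by (metis One_nat_def Suc_leI less_imp_le_nat of_nat_1 of_nat_diff of_nat_mult)
    have cm: "real c - real m > real p / (2 * real d)"
    proof -
      have "2 * real d * real m + 2 < B"
      proof -
        have "1 * (real d * real m) \<le> real d * (real d * real m)" using d by (intro mult_right_mono) auto
        moreover have "real d \<ge> 1" using d by simp
        ultimately have "2 * real d * real m + 2 < 2 * (real d * (real d * real m)) + 4 * real d"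
          unfolding mult.assoc by linarith
        then show ?thesis by (simp add: B_def algebra_simps)
      qed
      then have "2 * real d * real m + 2 < real p" using pB by simp
      then have "real p < 2 * (real d * (real c - real m))" using rdc by (simp add: algebra_simps)
      then show ?thesis using d by (simp add: field_simps)
    qed
    then have "real c > real m" using d by (smt (verit) divide_nonneg_nonneg of_nat_0_le_iff)
    then have rA: "real A = real c - real m" by (simp add: A_def of_nat_diff)
    have LA: "real L * (real L * (real d * real m + 2)) < real A"
    proof -
      have "real L * real L \<le> y * y" using Ly by (intro mult_mono) auto
      also have "y * y = real p / B" unfolding y_def using B0 by simp
      finally have "(real L * real L) * (real d * real m + 2) \<le> real p / B * (real d * real m + 2)"
        by (intro mult_right_mono) auto
      also have "\<dots> = real p / (2 * real d)" using d B0 by (simp add: B_def field_simps)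
      finally show ?thesis using cm rA by simp
    qed
    then have LA': "L * (L * (d * m + 2)) < A" by (metis of_nat_add of_nat_less_iff of_nat_mult of_nat_numeral)
    have A1: "A \<ge> 1" using LA' by simp
    have dA: "d * A + d * m \<le> p"
    proof -
      have "A + m = c" using \<open>real c > real m\<close> by (simp add: A_def)
      then have "d * A + d * m = d * c" by (metis distrib_left)
      then show ?thesis using dc by simp
    qed
    have lp: "d * L \<le> p"
    proof -
      have "L * 1 \<le> L * (L * (d * m + 2))" using L1 by (intro mult_left_mono) auto
      then have "L \<le> A" using LA' by linarith
      then have "d * L \<le> d * A" by (intro mult_left_mono) auto
      then show ?thesis using dA by linarith
    qed
    have count: "d * L * (A + d * L * m + (L + 1)) < d * (L + 1) * A"
    proof -
      have "L * (d * L * m + L + 1) \<le> L * (L * (d * m + 2))" using L1 by (simp add: algebra_simps)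
      then have "L * (d * L * m + L + 1) < A" using LA' by simp
      then have "L * (A + d * L * m + (L + 1)) < (L + 1) * A" by (simp add: algebra_simps)
      then have "d * (L * (A + d * L * m + (L + 1))) < d * ((L + 1) * A)" using d by simp
      then show ?thesis by (simp only: mult.assoc)
    qed
    have "d * L * ?N \<le> (d * L + c * (d - 1)) * m + A + p * (L + 1 - 1)"
      using stepanov_bound_params[OF p dc f A1 _ _ lp, of "L + 1" \<zeta>] dA co count unfolding m_def by blast
    also have "\<dots> \<le> d * L * m + p * m + p + p * L"
    proof -
      have "c * (d - 1) \<le> p" using dc d
        by (metis diff_le_self le_trans mult.commute mult_le_mono2)
      then have "c * (d - 1) * m \<le> p * m" by (rule mult_right_mono) simp
      moreover have "1 * A \<le> d * A" using d by (intro mult_right_mono) auto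
      then have "A \<le> p" using dA by linarith
      ultimately show ?thesis unfolding add_mult_distrib add_diff_cancel_right' by linarith
    qed
    finally have "real (d * L * ?N) \<le> real (d * L * m + p * m + p + p * L)" by (simp only: of_nat_le_iff)
    then have "real d * real L * real ?N \<le> real p * real L + real d * real L * real m + real p * (real m + 1)"
      by (simp add: algebra_simps)
    then have "real ?N \<le> (real p * real L + real d * real L * real m + real p * (real m + 1)) / (real d * real L)"
      using d L1 by (simp add: pos_le_divide_eq algebra_simps)
    also have "\<dots> = real p / real d + real m + real p * (real m + 1) / (real d * real L)"
      using d L1 by (simp add: field_simps)
    also have "real p * (real m + 1) / (real d * real L) \<le> 2 * (real m + 1) * sqrt B * sqrt (real p)"
    proof -
      have "sqrt (real p) = y * sqrt B" unfolding y_def using B0 by (simp add: real_sqrt_divide)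
      then have "sqrt (real p) \<le> 2 * real L * sqrt B" using yL B0 by (simp add: mult_right_mono)
      then have "sqrt (real p) * sqrt (real p) \<le> 2 * real L * sqrt B * sqrt (real p)"
        by (rule mult_right_mono) simp
      then have "real p \<le> 2 * real L * sqrt B * sqrt (real p)" by simp
      then have "real p * (real m + 1) \<le> 2 * real L * sqrt B * sqrt (real p) * (real m + 1)"
        by (rule mult_right_mono) simp
      also have "\<dots> \<le> 2 * real L * sqrt B * sqrt (real p) * (real m + 1) * real d"
        using mult_left_mono[of 1 "real d" "2 * real L * sqrt B * sqrt (real p) * (real m + 1)"] d B0
        by simp
      finally show ?thesis using d L1 by (simp add: field_simps)
    qed
    finally have "real ?N \<le> real p / real d + real m + 2 * (real m + 1) * sqrt B * sqrt (real p)"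
      by simp
    moreover have "real m \<le> real m * sqrt (real p)" using p1 by (simp add: mult_le_cancel_left1)
    ultimately show ?thesis unfolding distrib_right by linarith
  qed
  then show ?thesis by (simp add: B_def)
qed

section \<open>Sums of quartic characters\<close>

lemma ii_power_eq_iff: "\<i> ^ n = \<i> ^ m \<longleftrightarrow> n mod 4 = m mod 4"
proof -
  have red: "\<i> ^ n = \<i> ^ (n mod 4)" for n
  proof -
    have "\<i> ^ n = \<i> ^ (4 * (n div 4) + n mod 4)" by simp
    also have "\<dots> = \<i> ^ (n mod 4)" unfolding power_add power_mult by simp
    finally show ?thesis .
  qed
  have inj: "a = b" if "\<i> ^ a = \<i> ^ b" "a < 4" "b < 4" for a b
  proof -
    have "a \<in> {0,1,2,3}" "b \<in> {0,1,2,3}" using that by auto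
    then show ?thesis using that(1) by (auto simp: power3_eq_cube complex_eq_iff)
  qed
  show ?thesis
  proof
    assume "\<i> ^ n = \<i> ^ m"
    then have "\<i> ^ (n mod 4) = \<i> ^ (m mod 4)" using red by metis
    then show "n mod 4 = m mod 4" by (intro inj) auto
  next
    assume "n mod 4 = m mod 4" then show "\<i> ^ n = \<i> ^ m" using red by metis
  qed
qed

text \<open>Of a primitive element only the fact is recorded that its powers cover all nonzero
  residues. Stating it for integers modulo \<open>p\<close> separates the character theory from the
  algebraic structure \<open>prime_field\<close>.\<close>

locale quartic_character =
  fixes p :: nat and \<omega> :: int
  assumes prime_p: "prime p" and p_mod_4: "p mod 4 = 1"
    and not_dvd_omega: "\<not> int p dvd \<omega>"
    and omega_surj: "\<And>x. \<not> int p dvd x \<Longrightarrow> \<exists>n::nat. [x = \<omega> ^ n] (mod int p)"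
begin

abbreviation residues where "residues \<equiv> {0..<int p}"

lemma p_gt_1: "p > 1" using prime_p prime_gt_1_nat by blast

lemma p_ge_5: "p \<ge> 5"
proof -
  have "p \<noteq> 2" "p \<noteq> 3" "p \<noteq> 4" using p_mod_4 by auto
  then show ?thesis using p_gt_1 by linarith
qed

lemma prime_int_p: "prime (int p)" using prime_p by simp

lemma dvd_residue_iff: "a \<in> residues \<Longrightarrow> int p dvd a \<longleftrightarrow> a = 0"
  using zdvd_imp_le by fastforce

lemma omega_power_period: "[\<omega> ^ (p - 1) = 1] (mod int p)"
proof -
  have "[\<omega> ^ (p - 1) * \<omega> = 1 * \<omega>] (mod int p)"
    using int_fermat_little[OF prime_p, of \<omega>] p_gt_1
    by (metis mult_1 power_minus_mult zero_less_one less_trans)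
  moreover have "coprime \<omega> (int p)" using not_dvd_omega prime_int_p
    by (metis coprime_commute prime_imp_coprime_int)
  ultimately show ?thesis using cong_mult_rcancel by blast
qed

lemma omega_power_mod: "[\<omega> ^ n = \<omega> ^ (n mod (p - 1))] (mod int p)"
proof -
  have "[\<omega> ^ ((p - 1) * (n div (p - 1)) + n mod (p - 1)) = 1 ^ (n div (p - 1)) * \<omega> ^ (n mod (p - 1))] (mod int p)"
    unfolding power_add power_mult by (intro cong_mult cong_pow omega_power_period cong_refl)
  then show ?thesis by simp
qed

lemma not_dvd_omega_power: "\<not> int p dvd \<omega> ^ n"
  using not_dvd_omega prime_int_p prime_dvd_power by blast

text \<open>The first \<open>p - 1\<close> powers cover the \<open>p - 1\<close> nonzero residues,
  and a surjection between finite sets of equal size is injective.\<close>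

lemma omega_power_inj: "inj_on (\<lambda>n. \<omega> ^ n mod int p) {..<p - 1}"
proof (rule eq_card_imp_inj_on)
  have "{1..<int p} \<subseteq> (\<lambda>n. \<omega> ^ n mod int p) ` {..<p - 1}"
  proof
    fix x assume x: "x \<in> {1..<int p}"
    then have "\<not> int p dvd x" using zdvd_imp_le by fastforce
    then obtain n :: nat where "[x = \<omega> ^ n] (mod int p)" using omega_surj by blast
    then have "[x = \<omega> ^ (n mod (p - 1))] (mod int p)" using omega_power_mod cong_trans by blast
    then have "x = \<omega> ^ (n mod (p - 1)) mod int p" using x by (simp add: cong_def)
    then show "x \<in> (\<lambda>n. \<omega> ^ n mod int p) ` {..<p - 1}" using p_gt_1 by auto
  qed
  then have "card {1..<int p} \<le> card ((\<lambda>n. \<omega> ^ n mod int p) ` {..<p - 1})"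
    by (intro card_mono) auto
  then show "card ((\<lambda>n. \<omega> ^ n mod int p) ` {..<p - 1}) = card {..<p - 1}"
    using card_image_le[of "{..<p - 1}" "\<lambda>n. \<omega> ^ n mod int p"] by simp
qed simp

lemma omega_power_cong_iff: "[\<omega> ^ n = \<omega> ^ m] (mod int p) \<longleftrightarrow> n mod (p - 1) = m mod (p - 1)"
proof
  assume "[\<omega> ^ n = \<omega> ^ m] (mod int p)"
  then have "[\<omega> ^ (n mod (p - 1)) = \<omega> ^ (m mod (p - 1))] (mod int p)"
    by (meson cong_sym cong_trans omega_power_mod)
  then show "n mod (p - 1) = m mod (p - 1)"
    using inj_onD[OF omega_power_inj, of "n mod (p - 1)" "m mod (p - 1)"] p_gt_1 by (simp add: cong_def)
next
  assume "n mod (p - 1) = m mod (p - 1)"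
  then show "[\<omega> ^ n = \<omega> ^ m] (mod int p)" by (metis cong_sym cong_trans omega_power_mod)
qed

lemma four_dvd: "4 dvd p - 1" using p_mod_4 by (metis dvd_minus_mod)

lemma omega_power_cong_imp: "[\<omega> ^ n = \<omega> ^ m] (mod int p) \<Longrightarrow> \<i> ^ n = \<i> ^ m"
  unfolding omega_power_cong_iff ii_power_eq_iff using four_dvd by (metis mod_mod_cancel)

text \<open>The quartic residue character with value \<open>\<i>\<close> at \<open>\<omega>\<close>,
  extended by 0. The choice of the exponent does not matter: it is determined modulo
  \<open>p - 1\<close>, a multiple of 4.\<close>

definition chi :: "int \<Rightarrow> complex" where
  "chi x = (if int p dvd x then 0 else \<i> ^ (SOME n. [x = \<omega> ^ n] (mod int p)))"

lemma chi_eq_power: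
  assumes "[x = \<omega> ^ n] (mod int p)"
  shows "chi x = \<i> ^ n"
proof -
  have "\<not> int p dvd x" using assms not_dvd_omega_power cong_dvd_iff by blast
  moreover have "[x = \<omega> ^ (SOME n. [x = \<omega> ^ n] (mod int p))] (mod int p)"
    using assms by (rule someI)
  then have "\<i> ^ n = \<i> ^ (SOME n. [x = \<omega> ^ n] (mod int p))"
    using assms by (meson cong_sym cong_trans omega_power_cong_imp)
  ultimately show ?thesis by (simp add: chi_def)
qed

lemma chi_eq_0_iff: "chi x = 0 \<longleftrightarrow> int p dvd x"
  by (simp add: chi_def)

lemma chi_cong: "[x = y] (mod int p) \<Longrightarrow> chi x = chi y"
  using omega_surj chi_eq_power chi_eq_0_iff by (metis cong_dvd_iff cong_trans)

lemma chi_mult: "chi (x * y) = chi x * chi y"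
proof (cases "int p dvd x \<or> int p dvd y")
  case True
  then show ?thesis using chi_eq_0_iff by (metis dvd_mult dvd_mult2 mult_eq_0_iff)
next
  case False
  then obtain n m :: nat where nm: "[x = \<omega> ^ n] (mod int p)" "[y = \<omega> ^ m] (mod int p)"
    using omega_surj by blast
  then have "[x * y = \<omega> ^ (n + m)] (mod int p)" by (simp add: power_add cong_mult)
  then show ?thesis using nm chi_eq_power by (metis power_add)
qed

lemma chi_1: "chi 1 = 1"
  using chi_eq_power[of 1 0] by simp

lemma chi_power: "chi (x ^ n) = chi x ^ n"
  by (induction n) (simp_all add: chi_1 chi_mult)

lemma chi_prod: "chi (\<Prod>i\<in>A. f i) = (\<Prod>i\<in>A. chi (f i))"
  by (induction A rule: infinite_finite_induct) (simp_all add: chi_1 chi_mult)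

lemma chi_cases:
  assumes "\<not> int p dvd x" obtains n :: nat where "chi x = \<i> ^ n" "[x = \<omega> ^ n] (mod int p)"
  using omega_surj[OF assms] chi_eq_power that by blast

lemma norm_chi: "norm (chi x) = (if int p dvd x then 0 else 1)"
  by (auto simp: chi_def norm_power)

lemma norm_chi_le: "norm (chi x) \<le> 1"
  by (simp add: norm_chi)

lemma chi_pow_4: "\<not> int p dvd x \<Longrightarrow> chi x ^ 4 = 1"
  by (metis chi_cases ii_power_eq_iff mod_mult_self1_is_0 mod_0 power_0 power_mult mult.commute)

lemma chi_mod [simp]: "chi (x mod int p) = chi x"
  by (rule chi_cong) simp

lemma card_poly_roots_mod_le:
  assumes f: "lead_coeff f = (1 :: int)"
  shows "card {a \<in> residues. int p dvd poly f a} \<le> degree f"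
proof -
  have "1 * card {a \<in> residues. int p dvd poly f a} \<le> degree f"
  proof (rule card_multiple_roots_mod_le[OF prime_int_p])
    show "\<not> [:int p:] dvd f" using f p_gt_1
      by (metis const_poly_dvd_iff prime_int_p not_prime_unit)
  qed (use p_gt_1 in auto)
  then show ?thesis by simp
qed

text \<open>\<open>chi ^ e\<close> has order \<open>d\<close>, so the sum is a combination of the
  powers of \<open>\<tau>\<close> with the sizes of the level sets \<open>N s\<close> as
  coefficients. Stepanov's method bounds these sizes only from above, by \<open>B\<close>. Since the
  powers of \<open>\<tau>\<close> sum to 0, \<open>B\<close> may be subtracted from every
  coefficient; all become nonpositive, and their absolute values add up to \<open>d * B\<close>
  minus the total size, which is at least \<open>p - m\<close>.\<close>

lemma polynomial_character_sum_bound: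
  assumes de: "d * e = 4" and d: "d \<ge> 2" and f: "lead_coeff f = (1 :: int)"
    and co: "coprime (degree f) d"
  defines "m \<equiv> degree f"
  shows "norm (\<Sum>a\<in>residues. chi (poly f a) ^ e) \<le>
    (real d * (real m + 2 * (real m + 1) * sqrt (2 * real d * (real d * real m + 2))) + real m) * sqrt (real p)"
proof -
  define K where "K = (real m + 2 * (real m + 1) * sqrt (2 * real d * (real d * real m + 2)))"
  define c where "c = (p - 1) div d"
  have "d dvd p - 1" using de four_dvd by (metis dvd_mult_left)
  then have dc: "d * c = p - 1" by (simp add: c_def)
  define \<tau> where "\<tau> = \<i> ^ e"
  define N where "N s = {a \<in> residues. \<not> int p dvd poly f a \<and> chi (poly f a) ^ e = \<tau> ^ s}" for s
  define B where "B = real p / real d + K * sqrt (real p)"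
  have e: "e \<noteq> 0" using de by (metis mult_is_0 zero_neq_numeral)
  have \<tau>_eq: "\<tau> ^ s = \<tau> ^ s' \<longleftrightarrow> s mod d = s' mod d" for s s'
  proof -
    have "\<tau> ^ s = \<tau> ^ s' \<longleftrightarrow> (e * s) mod (e * d) = (e * s') mod (e * d)"
      using ii_power_eq_iff[of "e * s" "e * s'"] de by (simp add: \<tau>_def power_mult mult.commute)
    then show ?thesis using e by (simp add: mult_mod_right[symmetric])
  qed
  have NB: "real (card (N s)) \<le> B" for s
  proof -
    \<comment> \<open>Raising to the power \<open>c = (p - 1) / d\<close> translates a value of the
      character of order \<open>d\<close> into a polynomial congruence of the kind treated by
      Stepanov's bound.\<close>
    have "N s \<subseteq> {a \<in> residues. [poly f a ^ c = \<omega> ^ (s * c)] (mod int p)}"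
    proof
      fix a assume a: "a \<in> N s"
      then obtain n where n: "chi (poly f a) = \<i> ^ n" "[poly f a = \<omega> ^ n] (mod int p)"
        using chi_cases[of "poly f a"] unfolding N_def by blast
      have "\<tau> ^ n = \<tau> ^ s" using a n(1) by (simp add: N_def \<tau>_def mult.commute flip: power_mult)
      then have "n mod d = s mod d" by (simp add: \<tau>_eq)
      then have "(n * c) mod (p - 1) = (s * c) mod (p - 1)"
        by (metis dc mult.commute mult_mod_right)
      then have "[\<omega> ^ (n * c) = \<omega> ^ (s * c)] (mod int p)" by (simp add: omega_power_cong_iff)
      moreover have "[poly f a ^ c = \<omega> ^ (n * c)] (mod int p)"
        using cong_pow[OF n(2)] by (simp add: power_mult)
      ultimately show "a \<in> {a \<in> residues. [poly f a ^ c = \<omega> ^ (s * c)] (mod int p)}"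
        using a cong_trans by (auto simp: N_def)
    qed
    then have "card (N s) \<le> card {a \<in> residues. [poly f a ^ c = \<omega> ^ (s * c)] (mod int p)}"
      by (intro card_mono finite_subset[OF _ finite_atLeastLessThan_int[of 0 "int p"]]) blast
    also have "real \<dots> \<le> B"
      using stepanov_bound[OF prime_p dc f co, of "\<omega> ^ (s * c)"] d by (simp add: B_def K_def m_def)
    finally show ?thesis by simp
  qed
  have disj: "disjoint_family_on N {..<d}"
    by (auto simp: disjoint_family_on_def N_def \<tau>_eq)
  have un: "(\<Union>s<d. N s) = {a \<in> residues. \<not> int p dvd poly f a}"
  proof -
    have "\<exists>s<d. chi (poly f a) ^ e = \<tau> ^ s" if a: "\<not> int p dvd poly f a" for a
    proof -
      obtain n where "chi (poly f a) = \<i> ^ n" using chi_cases[OF a] by blast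
      then have "chi (poly f a) ^ e = \<tau> ^ n" by (simp add: \<tau>_def mult.commute flip: power_mult)
      also have "\<tau> ^ n = \<tau> ^ (n mod d)" by (simp add: \<tau>_eq)
      finally show ?thesis using d by (intro exI[of _ "n mod d"]) auto
    qed
    then show ?thesis by (auto simp: N_def)
  qed
  have fin: "finite (N s)" for s by (rule finite_subset[of _ residues]) (auto simp: N_def)
  have "real (\<Sum>s<d. card (N s)) \<ge> real p - real m"
  proof -
    have "(\<Sum>s<d. card (N s)) = card (\<Union>s<d. N s)"
      using disj fin by (subst card_UN_disjoint) (auto simp: disjoint_family_on_def)
    also have "\<dots> = card (residues - {a \<in> residues. int p dvd poly f a})"
      unfolding un by (rule arg_cong[of _ _ card]) auto
    also have "\<dots> = p - card {a \<in> residues. int p dvd poly f a}"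
      by (subst card_Diff_subset) (auto intro: finite_subset[OF _ finite_atLeastLessThan_int[of 0 "int p"]])
    finally show ?thesis using card_poly_roots_mod_le[OF f] unfolding m_def by linarith
  qed
  have "(\<Sum>a\<in>residues. chi (poly f a) ^ e) = (\<Sum>a\<in>(\<Union>s<d. N s). chi (poly f a) ^ e)"
    unfolding un using e by (intro sum.mono_neutral_right) (auto simp: chi_eq_0_iff)
  also have "\<dots> = (\<Sum>s<d. \<Sum>a\<in>N s. chi (poly f a) ^ e)"
    using disj fin by (intro sum.UNION_disjoint) (auto simp: disjoint_family_on_def)
  also have "\<dots> = (\<Sum>s<d. of_nat (card (N s)) * \<tau> ^ s)"
    by (intro sum.cong refl) (simp add: N_def)
  also have "\<dots> = (\<Sum>s<d. of_real (real (card (N s)) - B) * \<tau> ^ s)"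
  proof -
    have "(\<Sum>s<d. \<tau> ^ s) = 0"
    proof -
      have "\<tau> ^ 1 \<noteq> \<tau> ^ 0" "\<tau> ^ d = \<tau> ^ 0" unfolding \<tau>_eq using d by auto
      then show ?thesis by (simp add: geometric_sum)
    qed
    then show ?thesis by (simp add: algebra_simps sum_subtractf flip: sum_distrib_left)
  qed
  finally have "norm (\<Sum>a\<in>residues. chi (poly f a) ^ e) \<le> (\<Sum>s<d. norm (of_real (real (card (N s)) - B) * \<tau> ^ s))"
    by (simp only: norm_sum)
  also have "\<dots> = (\<Sum>s<d. B - real (card (N s)))"
  proof (intro sum.cong refl)
    fix s
    have "norm (\<tau> ^ s) = 1" by (simp add: \<tau>_def norm_power)
    then show "norm (of_real (real (card (N s)) - B) * \<tau> ^ s) = B - real (card (N s))"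
      unfolding norm_mult norm_of_real using NB[of s] by simp
  qed
  also have "\<dots> = real d * B - real (\<Sum>s<d. card (N s))" by (simp add: sum_subtractf)
  also have "\<dots> \<le> real d * B - (real p - real m)" using \<open>real (\<Sum>s<d. card (N s)) \<ge> real p - real m\<close> by simp
  also have "\<dots> = real d * K * sqrt (real p) + real m"
    using d by (simp add: B_def algebra_simps)
  also have "\<dots> \<le> real d * K * sqrt (real p) + real m * sqrt (real p)"
    using p_gt_1 by (simp add: mult_le_cancel_left1)
  finally show ?thesis by (simp add: K_def algebra_simps)
qed

end

context quartic_character begin

lemma linear_factors_character_sum_bound:
  assumes I: "finite I" and de: "d * e = 4" and d: "d \<ge> 2"
    and co: "coprime (\<Sum>i\<in>I. g i) d" and le: "(\<Sum>i\<in>I. g i) \<le> 16"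
  shows "norm (\<Sum>a\<in>residues. \<Prod>i\<in>I. chi (a + y i) ^ (e * g i)) \<le> 4000 * sqrt (real p)"
proof -
  define f where "f = (\<Prod>i\<in>I. [:y i, 1:] ^ g i)"
  define m where "m = degree f"
  have m: "m = (\<Sum>i\<in>I. g i)"
    unfolding m_def f_def by (subst degree_prod_eq_sum_degree) (auto simp: degree_power_eq)
  have m16: "m \<le> 16" using le m by simp
  have f: "lead_coeff f = 1" by (simp add: f_def lead_coeff_prod lead_coeff_power)
  have "d dvd 4" using de by (metis dvd_triv_left)
  then have d4: "d \<le> 4" by (rule dvd_imp_le) simp
  \<comment> \<open>For \<open>d <= 4\<close> and \<open>m <= 16\<close> the radicand is at most
    \<open>8 * 66 = 528 < 23^2\<close>. The whole constant is then at most 3208, rounded up to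
    4000.\<close>
  have sq: "sqrt (2 * real d * (real d * real m + 2)) \<le> 23"
  proof -
    have "real d * real m \<le> 4 * 16" using d4 m16 by (intro mult_mono) auto
    then have "2 * real d * (real d * real m + 2) \<le> (2 * 4) * (64 + 2)" using d4 by (intro mult_mono) auto
    then have "2 * real d * (real d * real m + 2) \<le> 23\<^sup>2" by simp
    then show ?thesis by (rule real_le_lsqrt[rotated 1]) auto
  qed
  have "(\<Sum>a\<in>residues. \<Prod>i\<in>I. chi (a + y i) ^ (e * g i)) = (\<Sum>a\<in>residues. chi (poly f a) ^ e)"
    by (simp add: f_def poly_prod chi_prod chi_power prod_power_distrib add.commute mult.commute flip: power_mult)
  also have "norm \<dots> \<le>
    (real d * (real m + 2 * (real m + 1) * sqrt (2 * real d * (real d * real m + 2))) + real m) * sqrt (real p)"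
    unfolding m_def using polynomial_character_sum_bound[OF de d f] co m m_def by metis
  also have "\<dots> \<le> (4 * (16 + 2 * (16 + 1) * 23) + 16) * sqrt (real p)"
    using d4 m16 sq by (intro mult_right_mono add_mono mult_mono) auto
  also have "\<dots> \<le> 4000 * sqrt (real p)" by (intro mult_right_mono) auto
  finally show ?thesis .
qed

section \<open>Inverses modulo \<open>p\<close> and moving a point of a character sum to
  infinity\<close>

definition inv_mod :: "int \<Rightarrow> int" where
  "inv_mod z = (SOME w. [z * w = 1] (mod int p))"

lemma inv_mod: "\<not> int p dvd z \<Longrightarrow> [z * inv_mod z = 1] (mod int p)"
  unfolding inv_mod_def
  by (rule someI_ex, rule cong_solve_coprime_int)
     (use prime_int_p prime_imp_coprime_int coprime_commute in blast)

lemma not_dvd_inv_mod: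
  assumes "\<not> int p dvd z" shows "\<not> int p dvd inv_mod z"
proof
  assume "int p dvd inv_mod z"
  then have "int p dvd 1" using inv_mod[OF assms] by (meson cong_dvd_iff dvd_mult)
  then show False using p_gt_1 by simp
qed

lemma cong_inv_modI:
  assumes "[z * w = 1] (mod int p)"
  shows "[inv_mod z = w] (mod int p)"
proof -
  have z: "\<not> int p dvd z"
  proof
    assume "int p dvd z"
    then have "int p dvd 1" using assms by (meson cong_dvd_iff dvd_mult2)
    then show False using p_gt_1 by simp
  qed
  have "[z * inv_mod z = z * w] (mod int p)" using inv_mod[OF z] assms by (meson cong_sym cong_trans)
  moreover have "coprime z (int p)" using z prime_int_p prime_imp_coprime_int coprime_commute by blast
  ultimately show ?thesis using cong_mult_lcancel by blast
qed

text \<open>The substitution \<open>a + x\<^sub>0 = 1 / u\<close> moves the point \<open>-x\<^sub>0\<close> to infinity, so that the total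
  exponent becomes \<open>- g x\<^sub>0\<close>, which is coprime to \<open>d\<close>.\<close>

lemma character_sum_bound_of_odd_exponent:
  assumes X: "finite X" "card X \<le> 4" and x0: "x0 \<in> X"
    and inc: "\<And>x. x \<in> X \<Longrightarrow> x \<noteq> x0 \<Longrightarrow> \<not> int p dvd x - x0"
    and de: "d * e = 4" and d: "d \<ge> 2" "even d"
    and g: "odd (g x0)" "\<And>x. x \<in> X \<Longrightarrow> g x \<le> 3"
  shows "norm (\<Sum>a\<in>residues. \<Prod>x\<in>X. chi (a + x) ^ (e * g x)) \<le> 4000 * sqrt (real p)"
proof -
  \<comment> \<open>The exponent at \<open>u = 0\<close>, the image of infinity: \<open>h\<close>
    plus the sum of the \<open>g x\<close> is a multiple of \<open>d\<close>, which turns the powers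
    of \<open>chi (1/u)\<close> into \<open>chi u ^ (e * h)\<close>. Taking \<open>h\<close> from
    \<open>1..d\<close> instead of \<open>0..d - 1\<close> makes the term \<open>u = 0\<close>
    vanish.\<close>
  define h where "h = d - (\<Sum>x\<in>X. g x) mod d"
  define g' where "g' = g(x0 := h)"
  define y where "y x = (if x = x0 then 0 else inv_mod (x - x0))" for x
  define F where "F a = (\<Prod>x\<in>X. chi (a + x) ^ (e * g x))" for a
  define F' where "F' u = (\<Prod>x\<in>X. chi (u + y x) ^ (e * g' x))" for u
  define C where "C = (\<Prod>x\<in>X - {x0}. chi (x - x0) ^ (e * g x))"
  have "d dvd 4" using de by (metis dvd_triv_left)
  then have d4: "d \<le> 4" by (rule dvd_imp_le) simp
  have e0: "e \<noteq> 0" using de by (metis mult_is_0 zero_neq_numeral)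
  have h: "h \<ge> 1" "h \<le> d" "d dvd h + (\<Sum>x\<in>X. g x)"
  proof -
    have "(\<Sum>x\<in>X. g x) mod d < d" using d by simp
    then show "h \<ge> 1" "h \<le> d" by (auto simp: h_def)
    have "h + (\<Sum>x\<in>X. g x) = d + d * ((\<Sum>x\<in>X. g x) div d)"
      unfolding h_def using \<open>(\<Sum>x\<in>X. g x) mod d < d\<close> mult_div_mod_eq[of d "\<Sum>x\<in>X. g x"] by linarith
    then show "d dvd h + (\<Sum>x\<in>X. g x)" by (metis dvd_add dvd_refl dvd_triv_left)
  qed
  have sum_g: "(\<Sum>x\<in>X. g x) = g x0 + (\<Sum>x\<in>X - {x0}. g x)"
    using X x0 by (simp add: sum.remove)
  have sum_g': "(\<Sum>x\<in>X. g' x) = h + (\<Sum>x\<in>X - {x0}. g x)"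
  proof -
    have "(\<Sum>x\<in>X. g' x) = g' x0 + (\<Sum>x\<in>X - {x0}. g' x)" using X x0 by (simp add: sum.remove)
    also have "(\<Sum>x\<in>X - {x0}. g' x) = (\<Sum>x\<in>X - {x0}. g x)" by (intro sum.cong) (auto simp: g'_def)
    finally show ?thesis by (simp add: g'_def)
  qed
  have "even (h + (\<Sum>x\<in>X. g x))" using h(3) d(2) by (meson dvd_trans)
  then have "odd (\<Sum>x\<in>X. g' x)" using g(1) unfolding sum_g sum_g' by auto
  then have "coprime (\<Sum>x\<in>X. g' x) (2 * 2)"
    by (simp only: coprime_mult_right_iff coprime_right_2_iff_odd simp_thms)
  then have co: "coprime (\<Sum>x\<in>X. g' x) d"
    using coprime_divisors[OF dvd_refl \<open>d dvd 4\<close>] by simp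
  have le: "(\<Sum>x\<in>X. g' x) \<le> 16"
  proof -
    have "g' x \<le> 4" if "x \<in> X" for x using g(2)[OF that] h(2) d4 by (auto simp: g'_def)
    then have "(\<Sum>x\<in>X. g' x) \<le> card X * 4" using sum_bounded_above[of X g' 4] by simp
    then show ?thesis using X by linarith
  qed
  have key: "F ((inv_mod u - x0) mod int p) = C * F' u" if u: "u \<in> residues - {0}" for u
  proof -
    have u0: "\<not> int p dvd u" using u dvd_residue_iff by auto
    have cu: "chi u * chi (inv_mod u) = 1" using inv_mod[OF u0] chi_cong chi_mult chi_1 by metis
    have 1: "chi ((inv_mod u - x0) mod int p + x) = chi (inv_mod u + (x - x0))" for x
      by (rule chi_cong) (simp add: cong_def mod_simps algebra_simps)
    \<comment> \<open>In terms of inverses modulo \<open>p\<close>: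
      \<open>1/u + (x - x0) = (1/u) * (x - x0) * (u + 1/(x - x0))\<close>. The factors
      \<open>x - x0\<close> do not depend on \<open>u\<close> and are collected in
      \<open>C\<close>.\<close>
    have 2: "chi (inv_mod u + (x - x0)) = chi (inv_mod u) * (chi (x - x0) * chi (u + y x))"
      if x: "x \<in> X - {x0}" for x
    proof -
      have xx: "\<not> int p dvd x - x0" using inc x by auto
      have "[inv_mod u * ((x - x0) * (u + y x)) = 1 * (x - x0) + inv_mod u * 1] (mod int p)"
      proof -
        have "inv_mod u * ((x - x0) * (u + y x)) = (u * inv_mod u) * (x - x0) + inv_mod u * ((x - x0) * inv_mod (x - x0))"
          using x by (simp add: y_def algebra_simps)
        then show ?thesis
          using cong_add[OF cong_mult[OF inv_mod[OF u0] cong_refl[of "x - x0"]]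
            cong_mult[OF cong_refl[of "inv_mod u"] inv_mod[OF xx]]] by (simp only:)
      qed
      then have "chi (inv_mod u * ((x - x0) * (u + y x))) = chi (inv_mod u + (x - x0))"
        by (intro chi_cong) (simp add: add.commute)
      then show ?thesis by (simp add: chi_mult)
    qed
    have "F ((inv_mod u - x0) mod int p) =
      chi (inv_mod u) ^ (e * g x0) * (\<Prod>x\<in>X - {x0}. chi (inv_mod u + (x - x0)) ^ (e * g x))"
      unfolding F_def 1 using X x0 by (subst prod.remove[of _ x0]) auto
    also have "(\<Prod>x\<in>X - {x0}. chi (inv_mod u + (x - x0)) ^ (e * g x)) =
      (\<Prod>x\<in>X - {x0}. chi (inv_mod u) ^ (e * g x) * (chi (x - x0) ^ (e * g x) * chi (u + y x) ^ (e * g' x)))"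
      by (intro prod.cong refl) (simp add: 2 power_mult_distrib g'_def)
    also have "\<dots> = chi (inv_mod u) ^ (e * (\<Sum>x\<in>X - {x0}. g x)) * (C * (\<Prod>x\<in>X - {x0}. chi (u + y x) ^ (e * g' x)))"
      by (simp add: prod.distrib C_def power_sum sum_distrib_left)
    finally have 3: "F ((inv_mod u - x0) mod int p) =
      chi (inv_mod u) ^ (e * (\<Sum>x\<in>X. g x)) * (C * (\<Prod>x\<in>X - {x0}. chi (u + y x) ^ (e * g' x)))"
      unfolding sum_g by (simp add: algebra_simps power_add)
    have "chi (inv_mod u) ^ (e * (\<Sum>x\<in>X. g x)) = chi u ^ (e * h)"
    proof -
      have "4 dvd e * (h + (\<Sum>x\<in>X. g x))" using h(3) de by (metis mult.commute mult_dvd_mono dvd_refl)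
      then obtain q where q: "e * h + e * (\<Sum>x\<in>X. g x) = 4 * q" by (metis distrib_left dvdE)
      have "chi u ^ (e * h + e * (\<Sum>x\<in>X. g x)) = 1"
        unfolding q power_mult using chi_pow_4[OF u0] by simp
      moreover have "chi u ^ (e * (\<Sum>x\<in>X. g x)) * chi (inv_mod u) ^ (e * (\<Sum>x\<in>X. g x)) = 1"
        using cu by (simp flip: power_mult_distrib)
      ultimately show ?thesis by (metis (no_types, opaque_lifting) mult.assoc mult.right_neutral mult_1 power_add)
    qed
    moreover have "F' u = chi u ^ (e * h) * (\<Prod>x\<in>X - {x0}. chi (u + y x) ^ (e * g' x))"
      unfolding F'_def using X x0 by (subst prod.remove[of _ x0]) (auto simp: y_def g'_def)
    ultimately show ?thesis using 3 by (simp add: mult_ac)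
  qed
  have "(\<Sum>a\<in>residues. F a) = (\<Sum>a\<in>{a \<in> residues. \<not> int p dvd a + x0}. F a)"
  proof (rule sum.mono_neutral_right)
    show "\<forall>a\<in>residues - {a \<in> residues. \<not> int p dvd a + x0}. F a = 0"
    proof
      fix a assume "a \<in> residues - {a \<in> residues. \<not> int p dvd a + x0}"
      then have "chi (a + x0) = 0" by (simp add: chi_eq_0_iff)
      moreover have "e * g x0 \<noteq> 0" using e0 g(1) by (metis even_zero mult_is_0)
      ultimately show "F a = 0" unfolding F_def using X x0
        by (auto intro!: bexI[of _ x0] simp: zero_power)
    qed
  qed auto
  also have "\<dots> = (\<Sum>u\<in>residues - {0}. F ((inv_mod u - x0) mod int p))"
  proof (rule sum.reindex_bij_witness[symmetric, where i = "\<lambda>a. inv_mod (a + x0) mod int p" and j = "\<lambda>u. (inv_mod u - x0) mod int p"])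
    fix u assume u: "u \<in> residues - {0}"
    have u0: "\<not> int p dvd u" using u dvd_residue_iff by auto
    have c: "[(inv_mod u - x0) mod int p + x0 = inv_mod u] (mod int p)"
      by (simp add: cong_def mod_simps)
    have "[((inv_mod u - x0) mod int p + x0) * u = 1] (mod int p)"
      using cong_mult[OF c cong_refl[of u]] inv_mod[OF u0] by (metis cong_trans mult.commute)
    then have "[inv_mod ((inv_mod u - x0) mod int p + x0) = u] (mod int p)" by (rule cong_inv_modI)
    then show "inv_mod ((inv_mod u - x0) mod int p + x0) mod int p = u" using u by (simp add: cong_def)
    show "(inv_mod u - x0) mod int p \<in> {a \<in> residues. \<not> int p dvd a + x0}"
      using not_dvd_inv_mod[OF u0] cong_dvd_iff[OF c] p_gt_1 by auto
  next
    fix a assume a: "a \<in> {a \<in> residues. \<not> int p dvd a + x0}"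
    then have a0: "\<not> int p dvd a + x0" by simp
    have "[inv_mod (a + x0) mod int p * (a + x0) = 1] (mod int p)"
      using inv_mod[OF a0] by (simp add: cong_def mod_simps mult.commute)
    then have "[inv_mod (inv_mod (a + x0) mod int p) = a + x0] (mod int p)" by (rule cong_inv_modI)
    then have "[inv_mod (inv_mod (a + x0) mod int p) - x0 = a] (mod int p)"
      by (metis add_diff_cancel_right' cong_diff cong_refl)
    then show "(inv_mod (inv_mod (a + x0) mod int p) - x0) mod int p = a" using a by (simp add: cong_def)
    show "inv_mod (a + x0) mod int p \<in> residues - {0}"
      using not_dvd_inv_mod[OF a0] p_gt_1 by (auto simp: mod_eq_0_iff_dvd)
  qed simp
  also have "\<dots> = (\<Sum>u\<in>residues - {0}. C * F' u)" by (intro sum.cong refl key)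
  also have "\<dots> = (\<Sum>u\<in>residues. C * F' u)"
  proof (rule sum.mono_neutral_left)
    have "F' 0 = 0"
    proof -
      have "chi (0 + y x0) ^ (e * g' x0) = 0" using h(1) e0 by (simp add: y_def g'_def chi_eq_0_iff zero_power)
      then show ?thesis unfolding F'_def using X x0 by (metis prod_zero)
    qed
    then show "\<forall>i\<in>residues - (residues - {0}). C * F' i = 0" by auto
  qed auto
  finally have eq: "(\<Sum>a\<in>residues. F a) = C * (\<Sum>u\<in>residues. F' u)" by (simp add: sum_distrib_left)
  have "norm C \<le> 1"
    unfolding C_def prod_norm[symmetric] by (intro prod_le_1) (auto simp: norm_power norm_chi_le power_le_one)
  moreover have "norm (\<Sum>u\<in>residues. F' u) \<le> 4000 * sqrt (real p)"
    unfolding F'_def by (rule linear_factors_character_sum_bound[OF X(1) de d(1) co le])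
  ultimately have "norm C * norm (\<Sum>u\<in>residues. F' u) \<le> 1 * (4000 * sqrt (real p))"
    by (intro mult_mono) auto
  then show ?thesis using eq unfolding F_def by (simp add: norm_mult)
qed

text \<open>An odd exponent allows the previous bound with the full character, \<open>d = 4\<close>.
  If all exponents are even, the sum involves only the quadratic character \<open>chi ^ 2\<close>;
  then \<open>d = 2\<close>, the exponents are halved, and the nonzero exponent at
  \<open>x1\<close>, which must be 2, becomes 1.\<close>

theorem character_sum_bound:
  assumes X: "finite X" "card X \<le> 4" and x1: "x1 \<in> X" "k x1 \<noteq> 0"
    and inc: "\<And>x x'. x \<in> X \<Longrightarrow> x' \<in> X \<Longrightarrow> x \<noteq> x' \<Longrightarrow> \<not> int p dvd x - x'"
    and k: "\<And>x. x \<in> X \<Longrightarrow> k x \<le> 3"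
  shows "norm (\<Sum>a\<in>residues. \<Prod>x\<in>X. chi (a + x) ^ k x) \<le> 4000 * sqrt (real p)"
proof (cases "\<exists>x0\<in>X. odd (k x0)")
  case True
  then obtain x0 where "x0 \<in> X" "odd (k x0)" by blast
  then show ?thesis
    using character_sum_bound_of_odd_exponent[OF X, of x0 4 1 k] inc k by simp
next
  case False
  then have ev: "2 * (k x div 2) = k x" if "x \<in> X" for x using that by simp
  have "k x1 = 2" using x1 k[of x1] False by (auto simp: le_Suc_eq numeral_3_eq_3)
  then have "odd (k x1 div 2)" by simp
  moreover have "k x div 2 \<le> 3" if "x \<in> X" for x using k[OF that] by simp
  ultimately have "norm (\<Sum>a\<in>residues. \<Prod>x\<in>X. chi (a + x) ^ (2 * (k x div 2))) \<le> 4000 * sqrt (real p)"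
    using x1 inc by (intro character_sum_bound_of_odd_exponent[OF X, of x1 2]) auto
  then show ?thesis using ev by (simp cong: prod.cong)
qed

end

section \<open>Gauss and Jacobi sums\<close>

definition add_char :: "nat \<Rightarrow> int \<Rightarrow> complex" where
  "add_char n x = cis (2 * pi * real_of_int x / real n)"

lemma add_char_add: "add_char n (x + y) = add_char n x * add_char n y"
  by (simp add: add_char_def cis_mult add_divide_distrib algebra_simps)

lemma add_char_0 [simp]: "add_char n 0 = 1"
  by (simp add: add_char_def)

lemma norm_add_char [simp]: "norm (add_char n x) = 1"
  by (simp add: add_char_def)

lemma cnj_add_char: "cnj (add_char n x) = add_char n (- x)"
  by (simp add: add_char_def cis_cnj)

lemma add_char_diff: "add_char n (x - y) = add_char n x * cnj (add_char n y)"
  using add_char_add[of n x "- y"] by (simp add: cnj_add_char)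

lemma add_char_mult_nat: "add_char n (int j * x) = add_char n x ^ j"
  by (induction j) (simp_all add: add_char_add algebra_simps)

lemma add_char_eq_1_iff:
  assumes "n > 0" shows "add_char n x = 1 \<longleftrightarrow> int n dvd x"
proof
  assume "add_char n x = 1"
  then have "cos (2 * pi * real_of_int x / real n) = 1" by (simp add: add_char_def complex_eq_iff)
  then obtain m :: int where m: "2 * pi * real_of_int x / real n = of_int m * 2 * pi"
    by (auto simp: cos_one_2pi_int)
  then have "real_of_int x = of_int m * real n" using assms by (simp add: field_simps)
  then have "x = m * int n" by (metis of_int_eq_iff of_int_mult of_int_of_nat_eq)
  then show "int n dvd x" by simp
next
  assume "int n dvd x"
  then obtain m where "x = int n * m" by auto
  then have "2 * pi * real_of_int x / real n = 2 * pi * of_int m" using assms by simp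
  then show "add_char n x = 1" unfolding add_char_def by (simp add: cis_multiple_2pi)
qed

lemma add_char_cong:
  assumes "n > 0" "[x = y] (mod int n)" shows "add_char n x = add_char n y"
proof -
  have "int n dvd x - y" using assms(2) by (simp add: cong_iff_dvd_diff)
  then have "add_char n (x - y) = 1" using assms(1) by (simp add: add_char_eq_1_iff)
  then show ?thesis using add_char_add[of n "x - y" y] by simp
qed

lemma sum_int_atLeastLessThan: "(\<Sum>a\<in>{0..<int n}. f a) = (\<Sum>j<n. f (int j))"
  by (rule sum.reindex_bij_witness[where i = int and j = nat]) auto

lemma sum_add_char:
  assumes "n > 0"
  shows "(\<Sum>a\<in>{0..<int n}. add_char n (a * k)) = (if int n dvd k then of_nat n else 0)"
proof -
  have "(\<Sum>a\<in>{0..<int n}. add_char n (a * k)) = (\<Sum>j<n. add_char n k ^ j)"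
    by (simp add: sum_int_atLeastLessThan add_char_mult_nat)
  also have "\<dots> = (if int n dvd k then of_nat n else 0)"
  proof (cases "int n dvd k")
    case True
    then show ?thesis using assms by (simp add: add_char_eq_1_iff[THEN iffD2])
  next
    case False
    then have "add_char n k \<noteq> 1" using assms by (simp add: add_char_eq_1_iff)
    moreover have "add_char n k ^ n = 1"
      using add_char_mult_nat[of n n k] assms add_char_eq_1_iff[of n "int n * k"] by simp
    ultimately show ?thesis using False by (simp add: geometric_sum)
  qed
  finally show ?thesis .
qed

lemma sum_residues_shift:
  fixes f :: "int \<Rightarrow> 'a :: comm_monoid_add"
  assumes n: "n > 0" and f: "\<And>x y. [x = y] (mod int n) \<Longrightarrow> f x = f y"
  shows "(\<Sum>a\<in>{0..<int n}. f (a + b)) = (\<Sum>a\<in>{0..<int n}. f a)"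
proof (rule sum.reindex_bij_witness[where i = "\<lambda>a. (a - b) mod int n" and j = "\<lambda>a. (a + b) mod int n"])
  fix a assume a: "a \<in> {0..<int n}"
  then have "a mod int n = a" by simp
  then show "((a + b) mod int n - b) mod int n = a" "((a - b) mod int n + b) mod int n = a"
    by (simp_all add: mod_simps)
  show "f ((a + b) mod int n) = f (a + b)" by (rule f) (simp add: cong_def)
qed (use n in simp_all)

lemma sum_residues_scale:
  fixes f :: "int \<Rightarrow> 'a :: comm_monoid_add"
  assumes n: "n > 0" and f: "\<And>x y. [x = y] (mod int n) \<Longrightarrow> f x = f y" and z: "coprime z (int n)"
  shows "(\<Sum>a\<in>{0..<int n}. f (z * a)) = (\<Sum>a\<in>{0..<int n}. f a)"
proof -
  obtain w where w: "[z * w = 1] (mod int n)" using cong_solve_coprime_int z by blast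
  have zw: "[z * (w * a) = a] (mod int n)" "[w * (z * a) = a] (mod int n)" for a
    using cong_mult[OF w cong_refl[of a]] by (simp_all add: mult_ac)
  have red: "x mod int n \<in> {0..<int n}" for x using n by simp
  have eq: "x mod int n = a" if "[x = a] (mod int n)" "a \<in> {0..<int n}" for x a
    using that by (simp add: cong_def)
  have step: "[u * (x mod int n) = u * x] (mod int n)" for u x
    by (intro cong_mult cong_refl) (simp add: cong_def)
  show ?thesis
  proof (rule sum.reindex_bij_witness[where i = "\<lambda>a. (w * a) mod int n" and j = "\<lambda>a. (z * a) mod int n"])
    fix a assume a: "a \<in> {0..<int n}"
    show "(w * ((z * a) mod int n)) mod int n = a" "(z * ((w * a) mod int n)) mod int n = a"
      using a by (auto intro!: eq intro: cong_trans[OF step] zw)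
    show "f ((z * a) mod int n) = f (z * a)" by (rule f) (simp add: cong_def)
  qed (rule red)+
qed

lemma sum_residues_norm_fourier:
  fixes f :: "int \<Rightarrow> complex"
  assumes n: "n > 0"
  shows "(\<Sum>k\<in>{0..<int n}. (norm (\<Sum>a\<in>{0..<int n}. f a * add_char n (a * k)))\<^sup>2)
    = real n * (\<Sum>a\<in>{0..<int n}. (norm (f a))\<^sup>2)"
proof -
  let ?R = "{0..<int n}"
  have "complex_of_real (\<Sum>k\<in>?R. (norm (\<Sum>a\<in>?R. f a * add_char n (a * k)))\<^sup>2)
    = (\<Sum>k\<in>?R. (\<Sum>a\<in>?R. f a * add_char n (a * k)) * cnj (\<Sum>b\<in>?R. f b * add_char n (b * k)))"
    by (simp add: complex_norm_square del: of_real_power cnj_sum)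
  also have "\<dots> = (\<Sum>k\<in>?R. \<Sum>a\<in>?R. \<Sum>b\<in>?R. f a * cnj (f b) * add_char n (k * (a - b)))"
    unfolding cnj_sum sum_product
    by (intro sum.cong refl) (simp add: right_diff_distrib add_char_diff mult_ac)
  also have "\<dots> = (\<Sum>a\<in>?R. \<Sum>k\<in>?R. \<Sum>b\<in>?R. f a * cnj (f b) * add_char n (k * (a - b)))"
    by (rule sum.swap)
  also have "\<dots> = (\<Sum>a\<in>?R. \<Sum>b\<in>?R. \<Sum>k\<in>?R. f a * cnj (f b) * add_char n (k * (a - b)))"
    by (intro sum.cong refl sum.swap)
  also have "\<dots> = (\<Sum>a\<in>?R. \<Sum>b\<in>?R. if b = a then f a * cnj (f a) * of_nat n else 0)"
  proof (intro sum.cong refl)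
    fix a b assume ab: "a \<in> ?R" "b \<in> ?R"
    have "int n dvd a - b \<longleftrightarrow> b = a"
      using ab by (metis atLeastLessThan_iff cong_iff_dvd_diff cong_less_imp_eq_int cong_refl)
    then show "(\<Sum>k\<in>?R. f a * cnj (f b) * add_char n (k * (a - b))) = (if b = a then f a * cnj (f a) * of_nat n else 0)"
      unfolding sum_distrib_left[symmetric] sum_add_char[OF n] by simp
  qed
  also have "\<dots> = (\<Sum>a\<in>?R. f a * cnj (f a) * of_nat n)"
    by (intro sum.cong refl) (simp add: sum.delta)
  also have "\<dots> = complex_of_real (real n * (\<Sum>a\<in>?R. (norm (f a))\<^sup>2))"
    by (simp add: complex_norm_square sum_distrib_left mult_ac del: of_real_power)
  finally show ?thesis by (simp only: of_real_eq_iff)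
qed

context quartic_character begin

lemma p_pos: "p > 0" using p_gt_1 by simp

lemma coprime_of_not_dvd: "\<not> int p dvd z \<Longrightarrow> coprime z (int p)"
  using prime_int_p prime_imp_coprime_int coprime_commute by blast

lemma chi_omega: "chi \<omega> = \<i>"
  using chi_eq_power[of \<omega> 1] by simp

lemma chi_mult_cnj: "\<not> int p dvd x \<Longrightarrow> chi x * cnj (chi x) = 1"
  using norm_chi[of x] by (simp add: complex_norm_square[symmetric] flip: of_real_power)

lemma chi_pow_3: "chi x ^ 3 = cnj (chi x)"
proof (cases "int p dvd x")
  case False
  have "chi x ^ 3 = (chi x * cnj (chi x)) * chi x ^ 3" using chi_mult_cnj[OF False] by simp
  also have "\<dots> = chi x ^ 4 * cnj (chi x)" by (simp add: power_eq_if mult_ac)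
  finally show ?thesis using chi_pow_4[OF False] by simp
qed (simp add: chi_eq_0_iff[THEN iffD2])

lemma cnj_chi_square: "cnj (chi x) ^ 2 = chi x ^ 2"
proof (cases "int p dvd x")
  case False
  have "cnj (chi x) ^ 2 = chi x ^ 4 * chi x ^ 2" unfolding chi_pow_3[symmetric] by (simp flip: power_mult power_add)
  then show ?thesis using chi_pow_4[OF False] by simp
qed (simp add: chi_eq_0_iff[THEN iffD2])

text \<open>Replacing \<open>a\<close> by \<open>\<omega> * a\<close> permutes the residues and
  multiplies the sum by \<open>\<i> ^ e\<close>, which differs from 1 for these exponents.\<close>

lemma sum_chi_power:
  assumes "e \<in> {1, 2, 3}" shows "(\<Sum>a\<in>residues. chi a ^ e) = 0"
proof -
  have "(\<Sum>a\<in>residues. chi a ^ e) = (\<Sum>a\<in>residues. chi (\<omega> * a) ^ e)"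
    by (rule sum_residues_scale[symmetric]) (use p_pos chi_cong coprime_of_not_dvd not_dvd_omega in auto)
  also have "\<dots> = \<i> ^ e * (\<Sum>a\<in>residues. chi a ^ e)"
    by (simp add: chi_mult chi_omega power_mult_distrib sum_distrib_left)
  finally have "(1 - \<i> ^ e) * (\<Sum>a\<in>residues. chi a ^ e) = 0" by (simp add: algebra_simps)
  moreover have "\<i> ^ e \<noteq> 1" using ii_power_eq_iff[of e 0] assms by auto
  ultimately show ?thesis by simp
qed

definition gauss :: "nat \<Rightarrow> complex" where
  "gauss e = (\<Sum>a\<in>residues. chi a ^ e * add_char p a)"

lemma gauss_twist:
  assumes e: "e \<in> {1, 2, 3}"
  shows "(\<Sum>a\<in>residues. chi a ^ e * add_char p (a * k)) = cnj (chi k) ^ e * gauss e"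
proof (cases "int p dvd k")
  case True
  then have "add_char p (a * k) = 1" for a using p_pos by (simp add: add_char_eq_1_iff)
  then show ?thesis using True sum_chi_power[OF e] e by (auto simp: chi_eq_0_iff[THEN iffD2])
next
  case False
  have "gauss e = (\<Sum>a\<in>residues. chi (k * a) ^ e * add_char p (k * a))"
    unfolding gauss_def
    by (rule sum_residues_scale[symmetric, where f = "\<lambda>a. chi a ^ e * add_char p a"])
       (use p_pos chi_cong add_char_cong coprime_of_not_dvd False in \<open>auto intro!: arg_cong2[of _ _ _ _ "(*)"]\<close>)
  also have "\<dots> = chi k ^ e * (\<Sum>a\<in>residues. chi a ^ e * add_char p (a * k))"
    by (simp add: chi_mult power_mult_distrib sum_distrib_left mult_ac)
  finally have "cnj (chi k) ^ e * gauss e = (chi k * cnj (chi k)) ^ e * (\<Sum>a\<in>residues. chi a ^ e * add_char p (a * k))"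
    by (simp add: power_mult_distrib mult_ac)
  then show ?thesis using chi_mult_cnj[OF False] by simp
qed

text \<open>Parseval's identity for \<open>chi ^ e\<close>: by \<open>gauss_twist\<close> the
  Fourier coefficient at 0 vanishes, and the other \<open>p - 1\<close> all have the modulus of
  \<open>gauss e\<close>.\<close>

lemma norm_gauss:
  assumes e: "e \<in> {1, 2, 3}" shows "(norm (gauss e))\<^sup>2 = real p"
proof -
  have 1: "(\<Sum>a\<in>residues. (norm (chi a ^ e))\<^sup>2) = real p - 1"
  proof -
    have "(\<Sum>a\<in>residues. (norm (chi a ^ e))\<^sup>2) = (\<Sum>a\<in>residues. if a = 0 then 0 else 1)"
      using e by (intro sum.cong refl) (auto simp: norm_power norm_chi dvd_residue_iff)
    also have "\<dots> = (\<Sum>a\<in>residues. 1 - (if a = 0 then 1 else 0))" by (intro sum.cong) auto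
    finally show ?thesis using p_pos by (simp add: sum_subtractf)
  qed
  have "(\<Sum>k\<in>residues. (norm (cnj (chi k) ^ e * gauss e))\<^sup>2) = real p * (real p - 1)"
    using sum_residues_norm_fourier[OF p_pos, of "\<lambda>a. chi a ^ e"] unfolding gauss_twist[OF e] 1 .
  moreover have "(\<Sum>k\<in>residues. (norm (cnj (chi k) ^ e * gauss e))\<^sup>2) = (norm (gauss e))\<^sup>2 * (\<Sum>a\<in>residues. (norm (chi a ^ e))\<^sup>2)"
    by (simp add: norm_mult norm_power power_mult_distrib sum_distrib_left mult_ac)
  ultimately have "(norm (gauss e))\<^sup>2 * (real p - 1) = real p * (real p - 1)" unfolding 1 by simp
  then show ?thesis using p_gt_1 by simp
qed

text \<open>In the genuinely quartic case this sign becomes the \<sigma> that tells whether the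
  normalised transform is real or purely imaginary.\<close>

definition sg :: complex where "sg = chi (- 1)"

lemma sg_cases: "sg = 1 \<or> sg = - 1"
proof -
  have "sg ^ 2 = 1" using chi_power[of "- 1" 2] by (simp add: sg_def chi_1)
  then show ?thesis by (simp add: power2_eq_1_iff)
qed

lemma sg_simps [simp]: "cnj sg = sg" "sg * sg = 1" "norm sg = 1" "sg \<noteq> 0"
  using sg_cases by auto

lemma gauss_3: "gauss 3 = sg * cnj (gauss 1)"
proof -
  have "cnj (gauss 1) = (\<Sum>a\<in>residues. chi a ^ 3 * add_char p (a * - 1))"
    by (simp add: gauss_def chi_pow_3 cnj_add_char)
  also have "\<dots> = cnj (chi (- 1)) ^ 3 * gauss 3" by (rule gauss_twist) simp
  also have "cnj (chi (- 1)) ^ 3 = sg" using sg_cases by (auto simp: sg_def)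
  finally show ?thesis by (simp flip: mult.assoc)
qed

lemma gauss_2_real: "cnj (gauss 2) = gauss 2"
proof -
  have "cnj (gauss 2) = (\<Sum>a\<in>residues. chi a ^ 2 * add_char p (a * - 1))"
    by (simp add: gauss_def cnj_chi_square cnj_add_char)
  also have "\<dots> = cnj (chi (- 1)) ^ 2 * gauss 2" by (rule gauss_twist) simp
  also have "cnj (chi (- 1)) ^ 2 = 1" using sg_cases by (auto simp: sg_def)
  finally show ?thesis by simp
qed

lemma gauss_2_square: "gauss 2 ^ 2 = of_nat p"
proof -
  have "gauss 2 ^ 2 = gauss 2 * cnj (gauss 2)" by (simp add: gauss_2_real power2_eq_square)
  also have "\<dots> = of_real ((norm (gauss 2))\<^sup>2)" by (simp only: complex_norm_square)
  finally show ?thesis using norm_gauss[of 2] by simp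
qed

section \<open>The quartic Jacobi sum and the representation of \<open>p\<close> by two
  squares\<close>

definition jacobi :: complex where "jacobi = (\<Sum>a\<in>residues. chi a * chi (1 - a))"

text \<open>In the double sum the pairs with \<open>a + b = n\<close> contribute
  \<open>chi n ^ 2 * jacobi\<close>: by scaling if \<open>n\<close> is nonzero modulo
  \<open>p\<close>, and because \<open>chi ^ 2\<close> sums to 0 otherwise.\<close>

lemma gauss_1_square: "gauss 1 ^ 2 = jacobi * gauss 2"
proof -
  have inner: "(\<Sum>a\<in>residues. chi a * chi (n - a)) = chi n ^ 2 * jacobi" for n
  proof (cases "int p dvd n")
    case True
    have "chi (n - a) = sg * chi a" for a
    proof -
      have "chi (n - a) = chi (- 1 * a)" by (rule chi_cong) (use True in \<open>simp add: cong_iff_dvd_diff\<close>)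
      then show ?thesis by (simp only: chi_mult sg_def)
    qed
    then have "(\<Sum>a\<in>residues. chi a * chi (n - a)) = sg * (\<Sum>a\<in>residues. chi a ^ 2)"
      by (simp add: sum_distrib_left power2_eq_square mult_ac)
    then show ?thesis using True sum_chi_power[of 2] by (simp add: chi_eq_0_iff[THEN iffD2])
  next
    case False
    have "(\<Sum>a\<in>residues. chi a * chi (n - a)) = (\<Sum>a\<in>residues. chi (n * a) * chi (n - n * a))"
      by (rule sum_residues_scale[symmetric, where f = "\<lambda>a. chi a * chi (n - a)"])
         (use p_pos coprime_of_not_dvd False in \<open>auto intro!: arg_cong2[of _ _ _ _ "(*)"] chi_cong cong_diff\<close>)
    also have "\<dots> = (\<Sum>a\<in>residues. chi n ^ 2 * (chi a * chi (1 - a)))"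
    proof (intro sum.cong refl)
      fix a
      have "n - n * a = n * (1 - a)" by (simp add: algebra_simps)
      then show "chi (n * a) * chi (n - n * a) = chi n ^ 2 * (chi a * chi (1 - a))"
        by (simp only: chi_mult power2_eq_square mult_ac)
    qed
    finally show ?thesis by (simp add: jacobi_def sum_distrib_left)
  qed
  have "gauss 1 ^ 2 = (\<Sum>a\<in>residues. \<Sum>b\<in>residues. chi a * chi b * add_char p (a + b))"
    unfolding gauss_def power2_eq_square sum_product
    by (intro sum.cong refl) (simp add: add_char_add mult_ac)
  also have "\<dots> = (\<Sum>a\<in>residues. \<Sum>n\<in>residues. chi a * chi (n - a) * add_char p n)"
  proof (rule sum.cong[OF refl])
    fix a
    have "(\<Sum>b\<in>residues. chi a * chi b * add_char p (a + b)) =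
      (\<Sum>b\<in>residues. chi a * chi (b + - a) * add_char p (a + (b + - a)))"
      by (rule sum_residues_shift[symmetric, where f = "\<lambda>b. chi a * chi b * add_char p (a + b)"])
         (use p_pos in \<open>auto intro!: arg_cong2[of _ _ _ _ "(*)"] chi_cong add_char_cong cong_add\<close>)
    then show "(\<Sum>b\<in>residues. chi a * chi b * add_char p (a + b)) = (\<Sum>n\<in>residues. chi a * chi (n - a) * add_char p n)"
      by simp
  qed
  also have "\<dots> = (\<Sum>n\<in>residues. \<Sum>a\<in>residues. chi a * chi (n - a) * add_char p n)"
    by (rule sum.swap)
  also have "\<dots> = (\<Sum>n\<in>residues. chi n ^ 2 * jacobi * add_char p n)"
    by (simp add: inner flip: sum_distrib_right)
  also have "\<dots> = jacobi * gauss 2" by (simp add: gauss_def sum_distrib_left mult_ac)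
  finally show ?thesis .
qed

lemma norm_jacobi: "(norm jacobi)\<^sup>2 = real p"
proof -
  have "(norm (gauss 1 ^ 2))\<^sup>2 = (norm jacobi)\<^sup>2 * (norm (gauss 2))\<^sup>2"
    unfolding gauss_1_square by (simp add: norm_mult power_mult_distrib)
  moreover have "(norm (gauss 1 ^ 2))\<^sup>2 = ((norm (gauss 1))\<^sup>2)\<^sup>2" by (simp add: norm_power)
  ultimately have eq: "((norm (gauss 1))\<^sup>2)\<^sup>2 = (norm jacobi)\<^sup>2 * (norm (gauss 2))\<^sup>2" by (simp only:)
  have "(norm (gauss 1))\<^sup>2 = real p" "(norm (gauss 2))\<^sup>2 = real p" by (rule norm_gauss, simp)+
  with eq have "(real p)\<^sup>2 = (norm jacobi)\<^sup>2 * real p" by (simp only:)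
  then show ?thesis using p_pos by (simp add: power2_eq_square[of "real p"])
qed

lemma chi_Re_Im_Ints: "Re (chi x) \<in> \<int>" "Im (chi x) \<in> \<int>"
proof -
  have "Re (chi x) \<in> \<int> \<and> Im (chi x) \<in> \<int>"
  proof (cases "int p dvd x")
    case False
    then obtain n where n: "chi x = \<i> ^ n" using chi_cases by blast
    show ?thesis unfolding n by (induction n) auto
  qed (simp add: chi_eq_0_iff[THEN iffD2])
  then show "Re (chi x) \<in> \<int>" "Im (chi x) \<in> \<int>" by auto
qed

lemma Re_jacobi_Ints: "Re jacobi \<in> \<int>"
  unfolding jacobi_def by (auto intro!: Ints_sum Ints_diff Ints_mult chi_Re_Im_Ints)

text \<open>The symmetry \<open>a \<mapsto> 1 - a\<close> of the summand has a single fixed point, at which the summand is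
  the real number \<open>chi(1/2)\<^sup>2\<close>.\<close>

lemma Im_jacobi_even: "\<exists>n :: int. Im jacobi = 2 * of_int n"
proof -
  define h where "h = (int p + 1) div 2"
  have h: "2 * h = int p + 1" unfolding h_def using p_mod_4 by presburger
  define t where "t a = Im (chi a * chi (1 - a))" for a
  have t_int: "t a \<in> \<int>" for a by (auto simp: t_def intro!: Ints_add Ints_mult chi_Re_Im_Ints)
  have t_sym: "t (int p + 1 - a) = t a" for a
  proof -
    have "chi (int p + 1 - a) = chi (1 - a)" "chi (1 - (int p + 1 - a)) = chi a"
      by (rule chi_cong, simp add: cong_iff_dvd_diff)+
    then show ?thesis unfolding t_def by (simp only: mult.commute)
  qed
  have t0: "t 0 = 0" "t 1 = 0" by (simp_all add: t_def chi_eq_0_iff[THEN iffD2])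
  have th: "t h = 0"
  proof -
    have "chi (1 - h) = chi h" by (rule chi_cong) (use h in \<open>simp add: cong_iff_dvd_diff\<close>)
    then have "t h = Im (chi h ^ 2)" by (simp add: t_def power2_eq_square)
    moreover have "cnj (chi h ^ 2) = chi h ^ 2" using cnj_chi_square by simp
    ultimately show ?thesis by (metis complex_cnj_zero_iff Im_complex_of_real Reals_cnj_iff complex_is_Real_iff)
  qed
  have p3: "int p \<ge> 5" using p_ge_5 by simp
  have "residues = {0, 1} \<union> {2..<h} \<union> {h} \<union> {h + 1..<int p}" using h p3 by auto
  then have "Im jacobi = (\<Sum>a\<in>{0, 1} \<union> {2..<h} \<union> {h} \<union> {h + 1..<int p}. t a)"
    by (simp add: jacobi_def t_def del: times_complex.simps)
  also have "\<dots> = (\<Sum>a\<in>{2..<h}. t a) + (\<Sum>a\<in>{h + 1..<int p}. t a)"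
    using h p3 by (subst sum.union_disjoint, simp, simp, force)+ (simp add: t0 th)
  also have "(\<Sum>a\<in>{h + 1..<int p}. t a) = (\<Sum>a\<in>{2..<h}. t a)"
    by (rule sum.reindex_bij_witness[where i = "\<lambda>a. int p + 1 - a" and j = "\<lambda>a. int p + 1 - a"])
       (use h in \<open>auto simp: t_sym\<close>)
  finally have "Im jacobi = 2 * (\<Sum>a\<in>{2..<h}. t a)" by simp
  moreover have "(\<Sum>a\<in>{2..<h}. t a) \<in> \<int>" using t_int by (rule Ints_sum)
  ultimately show ?thesis by (auto elim: Ints_cases)
qed

text \<open>Uniqueness of the representation as a sum of two squares. For a suitable sign
  \<open>e\<close>, \<open>p\<close> divides \<open>A * Y - e * B * x\<close>, and the product
  identity for sums of two squares leaves only the quotients \<open>q = 0\<close> and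
  \<open>q = 1\<close>, \<open>q = -1\<close>. The first gives \<open>B^2 = Y^2\<close>; the others
  would give \<open>p = B^2 + Y^2\<close>, a sum of two even squares.\<close>

lemma even_square_of_two_squares_unique:
  fixes A B x y :: int
  assumes AB: "int p = A\<^sup>2 + B\<^sup>2" "even B" and xy: "int p = x\<^sup>2 + 4 * y\<^sup>2"
  shows "B\<^sup>2 = 4 * y\<^sup>2"
proof -
  define Y where "Y = 2 * y"
  have p: "int p = x\<^sup>2 + Y\<^sup>2" using xy by (simp add: Y_def power_mult_distrib)
  have Ax: "A\<^sup>2 = int p - B\<^sup>2" "x\<^sup>2 = int p - Y\<^sup>2" using AB p by simp_all
  have "(A * Y - B * x) * (A * Y + B * x) = int p * (Y\<^sup>2 - B\<^sup>2)"
  proof -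
    have "(A * Y - B * x) * (A * Y + B * x) = A\<^sup>2 * Y\<^sup>2 - B\<^sup>2 * x\<^sup>2" by (simp add: algebra_simps power2_eq_square)
    also have "\<dots> = (int p - B\<^sup>2) * Y\<^sup>2 - B\<^sup>2 * (int p - Y\<^sup>2)" by (simp only: Ax)
    finally show ?thesis by (simp add: algebra_simps)
  qed
  then have "int p dvd (A * Y - B * x) * (A * Y + B * x)" by simp
  then have "int p dvd A * Y - B * x \<or> int p dvd A * Y + B * x"
    using prime_int_p prime_dvd_mult_iff by blast
  then obtain e :: int where e: "e = 1 \<or> e = - 1" "int p dvd A * Y - e * B * x"
    by (metis minus_mult_minus mult_1 mult_minus1 diff_minus_eq_add mult_minus_left)
  have ee: "e * e = 1" using e by auto
  have id: "(A * Y - e * B * x)\<^sup>2 + (A * x + e * B * Y)\<^sup>2 = (int p)\<^sup>2"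
  proof -
    have "(A * Y - e * B * x)\<^sup>2 + (A * x + e * B * Y)\<^sup>2 = (A\<^sup>2 + (e * e) * B\<^sup>2) * (x\<^sup>2 + Y\<^sup>2)"
      by (simp add: algebra_simps power2_eq_square)
    then show ?thesis using AB p ee by (simp add: power2_eq_square)
  qed
  obtain q where q: "A * Y - e * B * x = int p * q" using e by auto
  have "(int p)\<^sup>2 * q\<^sup>2 \<le> (int p)\<^sup>2" using id unfolding q by (simp add: power_mult_distrib) (smt (verit) zero_le_power2)
  then have q2: "q\<^sup>2 \<le> 1" using p_pos by (simp add: mult_le_cancel_left2)
  have BY: "B\<^sup>2 = Y\<^sup>2"
  proof (cases "q = 0")
    case True
    then have "A * Y = e * B * x" using q by simp
    then have "A\<^sup>2 * Y\<^sup>2 = (e * e) * (B\<^sup>2 * x\<^sup>2)" by (metis (no_types, opaque_lifting) mult.assoc mult.left_commute power2_eq_square)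
    then have "(int p - B\<^sup>2) * Y\<^sup>2 = B\<^sup>2 * (int p - Y\<^sup>2)" by (simp only: Ax ee mult_1)
    then have "int p * Y\<^sup>2 = int p * B\<^sup>2" by (simp add: algebra_simps)
    then show ?thesis using p_pos by simp
  next
    case False
    then have "q\<^sup>2 = 1" using q2 by (smt (verit) zero_less_power2)
    then have "A * x + e * B * Y = 0" using id unfolding q by (simp add: power_mult_distrib)
    then have "A * x = - (e * B * Y)" by simp
    then have "A\<^sup>2 * x\<^sup>2 = (e * e) * (B\<^sup>2 * Y\<^sup>2)"
      by (metis (no_types, opaque_lifting) mult.assoc mult.left_commute power2_eq_square minus_mult_minus)
    then have "(int p - B\<^sup>2) * (int p - Y\<^sup>2) = B\<^sup>2 * Y\<^sup>2" by (simp only: Ax ee mult_1)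
    then have "int p * (int p - B\<^sup>2 - Y\<^sup>2) = 0" by (simp add: algebra_simps)
    then have "int p = B\<^sup>2 + Y\<^sup>2" using p_pos by simp
    moreover have "even (B\<^sup>2 + Y\<^sup>2)" using AB by (simp add: Y_def)
    ultimately have "even (int p)" by (simp only:)
    moreover have "odd p" using p_mod_4 by presburger
    ultimately show ?thesis by simp
  qed
  then show ?thesis by (simp add: Y_def power_mult_distrib)
qed

text \<open>Here \<open>y\<close> enters. \<open>gauss 2\<close> is a real square root of
  \<open>p\<close>, and \<open>jacobi\<close> has integer real part, even imaginary part and squared
  modulus \<open>p\<close>; by uniqueness its imaginary part is \<open>2 * y\<close> up to
  sign.\<close>

lemma Im_gauss_1_square:
  assumes xy: "int p = x\<^sup>2 + 4 * y\<^sup>2"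
  shows "(Im (gauss 1 ^ 2))\<^sup>2 = real p * (4 * (real_of_int y)\<^sup>2)"
proof -
  obtain A B where AB: "Re jacobi = real_of_int A" "Im jacobi = 2 * real_of_int B"
    using Re_jacobi_Ints Im_jacobi_even by (metis Ints_cases)
  have "real p = (real_of_int A)\<^sup>2 + (2 * real_of_int B)\<^sup>2"
    using norm_jacobi AB by (simp add: cmod_power2)
  also have "\<dots> = real_of_int (A\<^sup>2 + (2 * B)\<^sup>2)" by simp
  finally have "int p = A\<^sup>2 + (2 * B)\<^sup>2" by (metis of_int_eq_iff of_int_of_nat_eq)
  then have "(2 * B)\<^sup>2 = 4 * y\<^sup>2" using even_square_of_two_squares_unique[OF _ _ xy, of A "2 * B"] by simp
  then have "real_of_int ((2 * B)\<^sup>2) = real_of_int (4 * y\<^sup>2)" by (simp only:)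
  then have B: "(2 * real_of_int B)\<^sup>2 = 4 * (real_of_int y)\<^sup>2" by simp
  have Im2: "Im (gauss 2) = 0" using gauss_2_real by (simp add: complex_eq_iff)
  then have "(Re (gauss 2))\<^sup>2 = real p" using norm_gauss[of 2] by (simp add: cmod_power2)
  moreover have "Im (gauss 1 ^ 2) = Im jacobi * Re (gauss 2)" unfolding gauss_1_square using Im2 by simp
  ultimately show ?thesis using AB B by (simp add: power_mult_distrib)
qed

end

section \<open>Correlations of flat sequences\<close>

context quartic_character begin

lemma residues_incongruent:
  "x \<in> residues \<Longrightarrow> x' \<in> residues \<Longrightarrow> x \<noteq> x' \<Longrightarrow> \<not> int p dvd x - x'"
  by (metis atLeastLessThan_iff cong_iff_dvd_diff cong_less_imp_eq_int)

text \<open>Expanding the product gives at most \<open>4^4 = 256\<close> monomials. Those with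
  exponent 0 at \<open>x1\<close> drop out because \<open>c x1 0 = 0\<close>; in all others the
  character at \<open>x1\<close> is nontrivial, so that each is at most
  \<open>2^4 * 4000 * sqrt p\<close>.\<close>

lemma character_polynomial_sum_bound:
  assumes X: "X \<subseteq> residues" "card X \<le> 4" and x1: "x1 \<in> X" "c x1 0 = 0"
    and c: "\<And>x e. x \<in> X \<Longrightarrow> norm (c x e :: complex) \<le> 2"
  shows "norm (\<Sum>k\<in>residues. \<Prod>x\<in>X. \<Sum>e\<in>{0..3::nat}. c x e * chi (k + x) ^ e) \<le> 16384000 * sqrt (real p)"
proof -
  have fin: "finite X" using X finite_subset by blast
  define G where "G = PiE X (\<lambda>_. {0..3::nat})"
  have G: "finite G" "card G \<le> 256"
  proof -
    show "finite G" unfolding G_def using fin by (intro finite_PiE) auto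
    have "card G = 4 ^ card X" by (simp add: G_def card_PiE fin)
    also have "\<dots> \<le> 4 ^ 4" using X by (intro power_increasing) auto
    finally show "card G \<le> 256" by simp
  qed
  have "(\<Sum>k\<in>residues. \<Prod>x\<in>X. \<Sum>e\<in>{0..3::nat}. c x e * chi (k + x) ^ e) =
    (\<Sum>k\<in>residues. \<Sum>g\<in>G. \<Prod>x\<in>X. c x (g x) * chi (k + x) ^ g x)"
    unfolding G_def by (intro sum.cong refl prod_sum_PiE) (use fin in auto)
  also have "\<dots> = (\<Sum>g\<in>G. \<Sum>k\<in>residues. \<Prod>x\<in>X. c x (g x) * chi (k + x) ^ g x)"
    by (rule sum.swap)
  also have "\<dots> = (\<Sum>g\<in>G. (\<Prod>x\<in>X. c x (g x)) * (\<Sum>k\<in>residues. \<Prod>x\<in>X. chi (k + x) ^ g x))"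
    by (simp add: prod.distrib sum_distrib_left)
  also have "norm \<dots> \<le> (\<Sum>g\<in>G. 2 ^ 4 * (4000 * sqrt (real p)))"
  proof (rule sum_norm_le)
    fix g assume g: "g \<in> G"
    show "norm ((\<Prod>x\<in>X. c x (g x)) * (\<Sum>k\<in>residues. \<Prod>x\<in>X. chi (k + x) ^ g x)) \<le> 2 ^ 4 * (4000 * sqrt (real p))"
    proof (cases "g x1 = 0")
      case True
      then have "(\<Prod>x\<in>X. c x (g x)) = 0" using x1 fin by (intro prod_zero bexI[of _ x1]) auto
      then show ?thesis by simp
    next
      case False
      have "norm (\<Prod>x\<in>X. c x (g x)) \<le> (\<Prod>x\<in>X. 2)"
        unfolding prod_norm[symmetric] by (intro prod_mono) (auto intro: c)
      also have "\<dots> \<le> 2 ^ 4" using X power_increasing[of "card X" 4 "2 :: real"] by simp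
      finally have "norm (\<Prod>x\<in>X. c x (g x)) \<le> 2 ^ 4" .
      moreover have "norm (\<Sum>k\<in>residues. \<Prod>x\<in>X. chi (k + x) ^ g x) \<le> 4000 * sqrt (real p)"
      proof (rule character_sum_bound[where ?x1.0 = x1])
        show "g x \<le> 3" if "x \<in> X" for x using PiE_mem[OF g[unfolded G_def] that] by simp
        show "\<not> int p dvd x - x'" if "x \<in> X" "x' \<in> X" "x \<noteq> x'" for x x'
          using that X residues_incongruent by blast
      qed (use fin X x1 False in auto)
      ultimately show ?thesis unfolding norm_mult by (intro mult_mono) auto
    qed
  qed
  also have "\<dots> = real (card G) * (2 ^ 4 * (4000 * sqrt (real p)))" by simp
  also have "\<dots> \<le> 256 * (2 ^ 4 * (4000 * sqrt (real p)))" using G by (intro mult_right_mono) auto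
  finally show ?thesis by simp
qed

end

lemma norm_prod4_diff_le:
  fixes a b c d a' b' c' d' :: complex
  assumes M: "norm a \<le> M" "norm b \<le> M" "norm c \<le> M" "norm d \<le> M"
    "norm a' \<le> M" "norm b' \<le> M" "norm c' \<le> M" "norm d' \<le> M"
    and diff: "norm (a - a') \<le> 1" "norm (b - b') \<le> 1" "norm (c - c') \<le> 1" "norm (d - d') \<le> 1"
  shows "norm (a * b * c * d - a' * b' * c' * d') \<le> 4 * M ^ 3"
proof -
  have M0: "M \<ge> 0" using M(1) norm_ge_zero order_trans by blast
  have eq: "a * b * c * d - a' * b' * c' * d' =
    (a - a') * (b * c * d) + (b - b') * (a' * c * d) + (c - c') * (a' * b' * d) + (d - d') * (a' * b' * c')"
    by (simp add: algebra_simps)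
  have t: "norm (x * (u * v * w)) \<le> M ^ 3" if "norm x \<le> 1" "norm u \<le> M" "norm v \<le> M" "norm w \<le> M" for x u v w :: complex
  proof -
    have "norm (x * (u * v * w)) = norm x * (norm u * norm v * norm w)" by (simp add: norm_mult)
    also have "\<dots> \<le> 1 * (M * M * M)" using that M0 by (intro mult_mono) auto
    finally show ?thesis by (simp add: power3_eq_cube)
  qed
  have "norm (a * b * c * d - a' * b' * c' * d') \<le> M ^ 3 + M ^ 3 + M ^ 3 + M ^ 3"
    unfolding eq by (intro norm_triangle_mono t assms)
  then show ?thesis by simp
qed

text \<open>\<open>H\<close> is the normalised Fourier transform of \<open>s\<close>; the summand \<open>- 1\<close> in \<open>fourier_s\<close> is due to
  \<open>s 0 = - 1\<close>.  The condition \<open>cnj_H\<close> says that \<open>H\<close> is real or purely imaginary.\<close>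

locale flat_sequence = quartic_character +
  fixes s H :: "int \<Rightarrow> complex" and \<alpha> :: "nat \<Rightarrow> complex" and \<sigma> :: complex and \<delta> :: real
  assumes s_cong: "\<And>x y. [x = y] (mod int p) \<Longrightarrow> s x = s y"
    and s_cases: "\<And>x. s x = 1 \<or> s x = - 1"
    and fourier_s: "\<And>k. (\<Sum>j\<in>{0..<int p}. s j * add_char p (j * k)) = - 1 + of_real (sqrt (real p)) * H k"
    and H_eq: "\<And>k. H k = (\<Sum>e\<in>{1..3}. \<alpha> e * chi k ^ e)"
    and norm_alpha: "\<And>e. norm (\<alpha> e) \<le> 1"
    and sigma_cases: "\<sigma> = 1 \<or> \<sigma> = - 1"
    and cnj_H: "\<And>k. cnj (H k) = \<sigma> * H k"
    and H_square: "\<And>k. \<not> int p dvd k \<Longrightarrow> H k ^ 2 = \<sigma> * (1 + of_real \<delta> * chi k ^ 2)"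
    and delta_le: "\<bar>\<delta>\<bar> \<le> 1"
begin

lemma sigma_square: "\<sigma> * \<sigma> = 1" using sigma_cases by auto

lemma norm_sigma: "norm \<sigma> = 1" using sigma_cases by auto

lemma H_cong: "[x = y] (mod int p) \<Longrightarrow> H x = H y"
  unfolding H_eq by (simp add: chi_cong)

lemma H_eq_0: "int p dvd k \<Longrightarrow> H k = 0"
  by (simp add: H_eq chi_eq_0_iff[THEN iffD2])

lemma norm_H_le: "norm (H k) \<le> 3"
proof -
  have "norm (H k) \<le> (\<Sum>e\<in>{1..3::nat}. 1)"
    unfolding H_eq by (intro sum_norm_le) (auto simp: norm_mult norm_power norm_alpha norm_chi_le intro!: mult_le_one power_le_one)
  then show ?thesis by simp
qed

lemma norm_H_mult_le:
  "norm (H k * H k') \<le> 9" "norm (H k * H k' * H k'') \<le> 27"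
proof -
  show 2: "norm (H k * H k') \<le> 9"
    using mult_mono[OF norm_H_le[of k] norm_H_le[of k']] by (simp add: norm_mult)
  show "norm (H k * H k' * H k'') \<le> 27"
    using mult_mono[OF 2 norm_H_le[of k'']] by (simp add: norm_mult)
qed

text \<open>\<open>H\<close>, \<open>H\<^sup>2\<close> and \<open>H\<^sup>3\<close> agree outside the multiples of \<open>p\<close> with the combinations of powers of
  \<open>chi\<close> whose coefficients are given here.\<close>

definition alpha1 :: "nat \<Rightarrow> complex" where
  "alpha1 e = (if e = 0 then 0 else \<alpha> e)"

definition alpha2 :: "nat \<Rightarrow> complex" where
  "alpha2 e = (if e = 0 then \<sigma> else if e = 2 then \<sigma> * of_real \<delta> else 0)"

definition alpha3 :: "nat \<Rightarrow> complex" where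
  "alpha3 e = \<sigma> * (if e = 0 then of_real \<delta> * \<alpha> 2 else if e = 1 then \<alpha> 1 + of_real \<delta> * \<alpha> 3
     else if e = 2 then \<alpha> 2 else \<alpha> 3 + of_real \<delta> * \<alpha> 1)"

lemma upt3: "{0..3::nat} = {0, 1, 2, 3}" "{1..3::nat} = {1, 2, 3}" by auto

lemma H_alpha1: "(\<Sum>e\<in>{0..3}. alpha1 e * chi k ^ e) = H k"
  unfolding H_eq upt3 by (simp add: alpha1_def)

lemma H_alpha2: "\<not> int p dvd k \<Longrightarrow> (\<Sum>e\<in>{0..3}. alpha2 e * chi k ^ e) = H k ^ 2"
  unfolding upt3 by (simp add: H_square alpha2_def algebra_simps)

text \<open>\<open>H^3\<close> is \<open>H^2 * H\<close>, and multiplication by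
  \<open>chi ^ 2\<close> shifts exponents by 2 modulo 4: it exchanges 1 with 3 and moves 2 to
  0.\<close>

lemma H_alpha3:
  assumes k: "\<not> int p dvd k" shows "(\<Sum>e\<in>{0..3}. alpha3 e * chi k ^ e) = H k ^ 3"
proof -
  have c5: "chi k ^ 5 = chi k" using chi_pow_4[OF k] by (simp add: power_eq_if)
  have "H k ^ 3 = \<sigma> * (1 + of_real \<delta> * chi k ^ 2) * H k"
    using H_square[OF k] by (simp add: power_eq_if mult_ac)
  also have "\<dots> = \<sigma> * (\<alpha> 1 * chi k + \<alpha> 2 * chi k ^ 2 + \<alpha> 3 * chi k ^ 3
    + of_real \<delta> * (\<alpha> 1 * chi k ^ 3 + \<alpha> 2 * chi k ^ 4 + \<alpha> 3 * chi k ^ 5))"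
    unfolding H_eq upt3 by (simp add: algebra_simps power_eq_if)
  also have "\<dots> = (\<Sum>e\<in>{0..3}. alpha3 e * chi k ^ e)"
    unfolding upt3 c5 chi_pow_4[OF k] by (simp add: alpha3_def algebra_simps)
  finally show ?thesis by simp
qed

lemma norm_alpha123: "norm (alpha1 e) \<le> 2" "norm (alpha2 e) \<le> 2" "norm (alpha3 e) \<le> 2"
proof -
  have da: "norm (of_real \<delta> * \<alpha> i) \<le> 1" for i
    using mult_le_one[OF delta_le norm_ge_zero norm_alpha[of i]] by (simp add: norm_mult)
  have sum: "norm (\<alpha> i + of_real \<delta> * \<alpha> j) \<le> 2" for i j
    using norm_triangle_ineq[of "\<alpha> i" "of_real \<delta> * \<alpha> j"] norm_alpha[of i] da[of j] by linarith
  show "norm (alpha1 e) \<le> 2" using norm_alpha[of e] by (auto simp: alpha1_def)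
  show "norm (alpha2 e) \<le> 2" using delta_le by (auto simp: alpha2_def norm_mult norm_sigma)
  have le2: "norm (of_real \<delta> * \<alpha> 2) \<le> 2" "norm (\<alpha> 2) \<le> 2"
    using da[of 2] norm_alpha[of 2] by linarith+
  show "norm (alpha3 e) \<le> 2" unfolding alpha3_def norm_mult[of \<sigma>] norm_sigma using sum le2 by simp
qed

text \<open>Conjugates are omitted because \<open>cnj_H\<close> turns two of them into the factor
  \<open>\<sigma> * \<sigma> = 1\<close>. The correlation is thereby symmetric in all four
  points.\<close>

definition quad_corr :: "int \<Rightarrow> int \<Rightarrow> int \<Rightarrow> int \<Rightarrow> complex" where
  "quad_corr w x y z = (\<Sum>k\<in>residues. H (k + w) * H (k + x) * H (k + y) * H (k + z))"

lemma residue_zero_unique: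
  assumes "w \<in> residues" shows "card {k \<in> residues. int p dvd k + w} \<le> 1"
proof (rule card_le_Suc0_iff_eq[THEN iffD2, folded One_nat_def])
  show "finite {k \<in> residues. int p dvd k + w}" by (rule finite_subset[of _ residues]) auto
  show "\<forall>a1\<in>{k \<in> residues. int p dvd k + w}. \<forall>a2\<in>{k \<in> residues. int p dvd k + w}. a1 = a2"
  proof (intro ballI)
    fix a b assume ab: "a \<in> {k \<in> residues. int p dvd k + w}" "b \<in> {k \<in> residues. int p dvd k + w}"
    then have "int p dvd (a + w) - (b + w)" by (intro dvd_diff) auto
    then have "int p dvd a - b" by simp
    then show "a = b" using ab residues_incongruent by blast
  qed
qed

text \<open>The character expansions of \<open>H^2\<close> and \<open>H^3\<close> fail at multiples
  of \<open>p\<close>. Each point of \<open>W\<close> spoils at most one \<open>k\<close>, so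
  replacing the powers by their expansions costs a bounded amount.\<close>

lemma norm_sum_residues_diff_le:
  fixes f g :: "int \<Rightarrow> complex"
  assumes W: "W \<subseteq> residues" "card W \<le> 2"
    and eq: "\<And>k. k \<in> residues \<Longrightarrow> \<forall>w\<in>W. \<not> int p dvd k + w \<Longrightarrow> f k = g k"
    and le: "\<And>k. norm (f k - g k) \<le> M" and M: "M \<ge> 0"
  shows "norm (\<Sum>k\<in>residues. f k) \<le> norm (\<Sum>k\<in>residues. g k) + 2 * M"
    and "norm ((\<Sum>k\<in>residues. f k) - (\<Sum>k\<in>residues. g k)) \<le> 2 * M"
proof -
  define Z where "Z = (\<Union>w\<in>W. {k \<in> residues. int p dvd k + w})"
  have finW: "finite W" using W finite_subset by blast
  have "card Z \<le> (\<Sum>w\<in>W. card {k \<in> residues. int p dvd k + w})"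
    unfolding Z_def by (rule card_UN_le[OF finW])
  also have "\<dots> \<le> (\<Sum>w\<in>W. 1)" using W by (intro sum_mono residue_zero_unique) auto
  finally have Z: "card Z \<le> 2" using W by simp
  have "(\<Sum>k\<in>residues. f k - g k) = (\<Sum>k\<in>Z. f k - g k)"
    by (rule sum.mono_neutral_right) (auto simp: Z_def eq)
  also have "norm \<dots> \<le> of_nat (card Z) * M" by (rule sum_norm_bound) (rule le)
  also have "\<dots> \<le> 2 * M" using Z M by (intro mult_right_mono) auto
  finally show le2: "norm ((\<Sum>k\<in>residues. f k) - (\<Sum>k\<in>residues. g k)) \<le> 2 * M"
    by (simp add: sum_subtractf)
  show "norm (\<Sum>k\<in>residues. f k) \<le> norm (\<Sum>k\<in>residues. g k) + 2 * M"
    using le2 norm_triangle_ineq2[of "\<Sum>k\<in>residues. f k" "\<Sum>k\<in>residues. g k"] by linarith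
qed

lemma norm_alpha_sum_le:
  assumes "\<And>e. norm (c e) \<le> (2 :: real)"
  shows "norm (\<Sum>e\<in>{0..3::nat}. c e * chi k ^ e) \<le> 8"
proof -
  have "norm (\<Sum>e\<in>{0..3::nat}. c e * chi k ^ e) \<le> (\<Sum>e\<in>{0..3::nat}. 2)"
  proof (rule sum_norm_le)
    fix e
    have "norm (c e) * norm (chi k) ^ e \<le> 2 * 1"
      using assms by (intro mult_mono power_le_one) (auto simp: norm_chi_le)
    then show "norm (c e * chi k ^ e) \<le> 2" by (simp add: norm_mult norm_power)
  qed
  then show ?thesis by simp
qed

text \<open>The point \<open>w\<close> may carry any combination of powers of \<open>chi\<close>,
  but the points of the nonempty set \<open>X\<close> carry a plain \<open>H\<close>, which has no
  constant term. Every monomial is therefore nontrivial at a point of \<open>X\<close>, and no main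
  term arises.\<close>

lemma correlation_bound_of_simple_points:
  assumes X: "X \<subseteq> residues" "card X \<le> 3" "X \<noteq> {}" and w: "w \<in> residues" "w \<notin> X"
    and c: "\<And>e. norm (c e) \<le> 2" and G: "\<And>k. norm (G k) \<le> 27"
    and eq: "\<And>k. \<not> int p dvd k \<Longrightarrow> (\<Sum>e\<in>{0..3}. c e * chi k ^ e) = G k"
  shows "norm (\<Sum>k\<in>residues. G (k + w) * (\<Prod>v\<in>X. H (k + v))) \<le> 16390000 * sqrt (real p)"
proof -
  have fin: "finite X" using X finite_subset by blast
  define c' where "c' v = (if v = w then c else alpha1)" for v
  define u where "u k = (\<Sum>e\<in>{0..3}. c e * chi k ^ e)" for k
  have g: "(\<Prod>v\<in>insert w X. \<Sum>e\<in>{0..3}. c' v e * chi (k + v) ^ e) = u (k + w) * (\<Prod>v\<in>X. H (k + v))" for k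
  proof -
    have "(\<Prod>v\<in>X. \<Sum>e\<in>{0..3}. c' v e * chi (k + v) ^ e) = (\<Prod>v\<in>X. H (k + v))"
      using w by (intro prod.cong refl) (auto simp: c'_def H_alpha1)
    then show ?thesis using fin w by (simp add: c'_def u_def)
  qed
  have "norm (\<Sum>k\<in>residues. G (k + w) * (\<Prod>v\<in>X. H (k + v))) \<le>
    norm (\<Sum>k\<in>residues. u (k + w) * (\<Prod>v\<in>X. H (k + v))) + 2 * (35 * 27)"
  proof (rule norm_sum_residues_diff_le(1)[where W = "{w}"])
    show "G (k + w) * (\<Prod>v\<in>X. H (k + v)) = u (k + w) * (\<Prod>v\<in>X. H (k + v))"
      if "\<forall>v\<in>{w}. \<not> int p dvd k + v" for k
      using that by (simp add: u_def eq)
    show "norm (G (k + w) * (\<Prod>v\<in>X. H (k + v)) - u (k + w) * (\<Prod>v\<in>X. H (k + v))) \<le> 35 * 27" for k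
    proof -
      \<comment> \<open>\<open>35 = 27 + 8\<close>, from the bound on \<open>G\<close> and four
        coefficients of modulus at most 2.\<close>
      have "norm (G (k + w) - u (k + w)) \<le> 35"
        using norm_triangle_ineq4[of "G (k + w)" "u (k + w)"] G[of "k + w"]
          norm_alpha_sum_le[of c "k + w", OF c] unfolding u_def by linarith
      moreover have "norm (\<Prod>v\<in>X. H (k + v)) \<le> (\<Prod>v\<in>X. 3)"
        unfolding prod_norm[symmetric] by (intro prod_mono) (auto intro: norm_H_le)
      then have "norm (\<Prod>v\<in>X. H (k + v)) \<le> 27"
        using power_increasing[of "card X" 3 "3 :: real"] X by simp
      ultimately have "norm (G (k + w) - u (k + w)) * norm (\<Prod>v\<in>X. H (k + v)) \<le> 35 * 27"
        by (intro mult_mono) auto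
      then show ?thesis by (simp add: left_diff_distrib flip: norm_mult)
    qed
  qed (use w in auto)
  also have "norm (\<Sum>k\<in>residues. u (k + w) * (\<Prod>v\<in>X. H (k + v))) \<le> 16384000 * sqrt (real p)"
  proof -
    obtain v where v: "v \<in> X" using X by blast
    have "norm (\<Sum>k\<in>residues. \<Prod>v\<in>insert w X. \<Sum>e\<in>{0..3}. c' v e * chi (k + v) ^ e) \<le> 16384000 * sqrt (real p)"
      by (rule character_polynomial_sum_bound[where ?x1.0 = v])
         (use X w v fin norm_alpha123 c in \<open>auto simp: c'_def alpha1_def\<close>)
    then show ?thesis unfolding g .
  qed
  also have "2 * (35 * 27) \<le> 6000 * sqrt (real p)" using p_gt_1 by (simp add: order_trans[of _ 6000])
  finally show ?thesis by simp
qed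

lemma quad_corr_distinct:
  assumes "w \<in> residues" "x \<in> residues" "y \<in> residues" "z \<in> residues"
    and "w \<noteq> x" "w \<noteq> y" "w \<noteq> z" "x \<noteq> y" "x \<noteq> z" "y \<noteq> z"
  shows "norm (quad_corr w x y z) \<le> 16390000 * sqrt (real p)"
  using correlation_bound_of_simple_points[of "{x, y, z}" w alpha1 H] assms
    order_trans[OF norm_H_le, of 27] norm_alpha123 H_alpha1
  by (simp add: quad_corr_def mult_ac)

lemma quad_corr_211:
  assumes "w \<in> residues" "y \<in> residues" "z \<in> residues" and "w \<noteq> y" "w \<noteq> z" "y \<noteq> z"
  shows "norm (quad_corr w w y z) \<le> 16390000 * sqrt (real p)"
  using correlation_bound_of_simple_points[of "{y, z}" w alpha2 "\<lambda>k. H k ^ 2"] assms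
    order_trans[OF norm_H_mult_le(1), of 27] norm_alpha123 H_alpha2
  by (simp add: quad_corr_def mult_ac power2_eq_square)

lemma quad_corr_31:
  assumes "w \<in> residues" "z \<in> residues" and "w \<noteq> z"
  shows "norm (quad_corr w w w z) \<le> 16390000 * sqrt (real p)"
  using correlation_bound_of_simple_points[of "{z}" w alpha3 "\<lambda>k. H k ^ 3"] assms
    norm_H_mult_le(2) norm_alpha123 H_alpha3
  by (simp add: quad_corr_def mult_ac power3_eq_cube)

lemma sum_chi_power_shift: "e \<in> {1, 2, 3} \<Longrightarrow> (\<Sum>a\<in>residues. chi (a + b) ^ e) = 0"
proof -
  assume e: "e \<in> {1, 2, 3}"
  have "(\<Sum>a\<in>residues. chi (a + b) ^ e) = (\<Sum>a\<in>residues. chi a ^ e)"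
    by (rule sum_residues_shift[OF p_pos, where f = "\<lambda>a. chi a ^ e"]) (simp add: chi_cong)
  then show ?thesis using sum_chi_power[OF e] by simp
qed

text \<open>Off the multiples of \<open>p\<close> the summand is a product of two factors
  \<open>1 + \<delta> * chi ^ 2\<close> at different points. The constant gives \<open>p\<close>,
  the terms linear in \<delta> sum to 0, and the quadratic term is a character sum of order
  \<open>sqrt p\<close>.\<close>

lemma quad_corr_22:
  assumes "w \<in> residues" "y \<in> residues" and "w \<noteq> y"
  shows "norm (quad_corr w w y y - of_nat p) \<le> 16390000 * sqrt (real p)"
proof -
  define u where "u v k = 1 + of_real \<delta> * chi (k + v) ^ 2" for v k
  have u: "norm (u v k) \<le> 2" for v k
  proof -
    have "\<bar>\<delta>\<bar> * norm (chi (k + v)) ^ 2 \<le> 1 * 1"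
      using delta_le by (intro mult_mono power_le_one) (auto simp: norm_chi_le)
    then show ?thesis unfolding u_def
      by (intro order_trans[OF norm_triangle_ineq]) (simp add: norm_mult norm_power)
  qed
  have "norm ((\<Sum>k\<in>residues. H (k + w) * H (k + w) * H (k + y) * H (k + y)) - (\<Sum>k\<in>residues. u w k * u y k)) \<le> 2 * 100"
  proof (rule norm_sum_residues_diff_le(2)[where W = "{w, y}"])
    show "H (k + w) * H (k + w) * H (k + y) * H (k + y) = u w k * u y k"
      if "\<forall>v\<in>{w, y}. \<not> int p dvd k + v" for k
    proof -
      have "H (k + w) * H (k + w) * H (k + y) * H (k + y) = H (k + w) ^ 2 * H (k + y) ^ 2"
        by (simp add: power2_eq_square)
      also have "\<dots> = (\<sigma> * \<sigma>) * (u w k * u y k)" using that by (simp add: H_square u_def)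
      finally show ?thesis by (simp add: sigma_square)
    qed
    show "norm (H (k + w) * H (k + w) * H (k + y) * H (k + y) - u w k * u y k) \<le> 100" for k
    proof -
      have "norm ((H (k + w) * H (k + w)) * (H (k + y) * H (k + y)) - u w k * u y k) \<le> 9 * 9 + 2 * 2"
        using norm_triangle_ineq4[of "(H (k + w) * H (k + w)) * (H (k + y) * H (k + y))" "u w k * u y k"]
          mult_mono[OF norm_H_mult_le(1)[of "k + w" "k + w"] norm_H_mult_le(1)[of "k + y" "k + y"]]
          mult_mono[OF u[of w k] u[of y k]] by (simp add: norm_mult)
      then show ?thesis by (simp add: mult.assoc)
    qed
  qed (use assms in auto)
  moreover have "(\<Sum>k\<in>residues. u w k * u y k) = of_nat p + (of_real \<delta>)\<^sup>2 * (\<Sum>k\<in>residues. chi (k + w) ^ 2 * chi (k + y) ^ 2)"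
  proof -
    have "(\<Sum>k\<in>residues. u w k * u y k) = (\<Sum>k\<in>residues. 1 + of_real \<delta> * chi (k + w) ^ 2 + of_real \<delta> * chi (k + y) ^ 2
      + (of_real \<delta>)\<^sup>2 * (chi (k + w) ^ 2 * chi (k + y) ^ 2))"
      by (intro sum.cong refl) (simp add: u_def algebra_simps power2_eq_square)
    also have "\<dots> = of_nat p + of_real \<delta> * (\<Sum>k\<in>residues. chi (k + w) ^ 2) + of_real \<delta> * (\<Sum>k\<in>residues. chi (k + y) ^ 2)
      + (of_real \<delta>)\<^sup>2 * (\<Sum>k\<in>residues. chi (k + w) ^ 2 * chi (k + y) ^ 2)"
      by (simp add: sum.distrib sum_distrib_left)
    finally show ?thesis by (simp add: sum_chi_power_shift)
  qed
  moreover have "norm ((of_real \<delta>)\<^sup>2 * (\<Sum>k\<in>residues. chi (k + w) ^ 2 * chi (k + y) ^ 2)) \<le> 4000 * sqrt (real p)"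
  proof -
    have "norm (\<Sum>k\<in>residues. \<Prod>v\<in>{w, y}. chi (k + v) ^ 2) \<le> 4000 * sqrt (real p)"
      by (rule character_sum_bound[where ?x1.0 = w]) (use assms residues_incongruent in auto)
    then have "norm (\<Sum>k\<in>residues. chi (k + w) ^ 2 * chi (k + y) ^ 2) \<le> 4000 * sqrt (real p)"
      using assms by simp
    moreover have "norm ((of_real \<delta>)\<^sup>2 :: complex) \<le> 1" using delta_le by (simp add: norm_power abs_square_le_1)
    ultimately show ?thesis unfolding norm_mult
      using mult_mono[of "norm ((of_real \<delta>)\<^sup>2 :: complex)" 1] by fastforce
  qed
  moreover have "sqrt (real p) \<ge> 1" using p_gt_1 by simp
  ultimately show ?thesis unfolding quad_corr_def
    by (smt (verit) add_diff_cancel_left' diff_add_cancel norm_triangle_ineq add.commute diff_diff_eq2 norm_minus_commute)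
qed

text \<open>The sum can be evaluated as \<open>(1 + \<delta>^2) * (p - 1)\<close>, since
  \<open>chi ^ 4 = 1\<close> away from the multiples of \<open>p\<close>. Unlike for two distinct
  points, the quadratic term in \<delta> does not oscillate; this is where \<delta> has to be
  small.\<close>

lemma quad_corr_4:
  assumes "w \<in> residues"
  shows "norm (quad_corr w w w w - of_nat p) \<le> 16390000 * sqrt (real p) + \<delta>\<^sup>2 * real p"
proof -
  have "quad_corr w w w w = (\<Sum>k\<in>residues. H (k + w) ^ 4)"
    by (simp add: quad_corr_def power_eq_if mult_ac)
  also have "\<dots> = (\<Sum>k\<in>residues. H k ^ 4)"
    by (rule sum_residues_shift[OF p_pos, where f = "\<lambda>k. H k ^ 4"]) (metis H_cong)
  also have "\<dots> = (\<Sum>k\<in>residues. (1 + (of_real \<delta>)\<^sup>2) * (if k = 0 then 0 else 1) + 2 * of_real \<delta> * chi k ^ 2)"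
  proof (intro sum.cong refl)
    fix k assume k: "k \<in> residues"
    show "H k ^ 4 = (1 + (of_real \<delta>)\<^sup>2) * (if k = 0 then 0 else 1) + 2 * of_real \<delta> * chi k ^ 2"
    proof (cases "k = 0")
      case False
      then have nk: "\<not> int p dvd k" using k dvd_residue_iff by blast
      have "H k ^ 4 = (H k ^ 2) ^ 2" by (simp flip: power_mult)
      also have "\<dots> = (\<sigma> * \<sigma>) * (1 + 2 * of_real \<delta> * chi k ^ 2 + (of_real \<delta>)\<^sup>2 * chi k ^ 4)"
        unfolding H_square[OF nk] by (simp add: power2_eq_square algebra_simps power_eq_if)
      finally show ?thesis using False by (simp add: sigma_square chi_pow_4[OF nk])
    qed (simp add: H_eq_0 chi_eq_0_iff[THEN iffD2])
  qed
  also have "\<dots> = (1 + (of_real \<delta>)\<^sup>2) * (\<Sum>k\<in>residues. if k = 0 then 0 else 1)"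
    using sum_chi_power[of 2] by (simp add: sum.distrib flip: sum_distrib_left)
  also have "(\<Sum>k\<in>residues. if k = 0 then 0 else 1 :: complex) = (\<Sum>k\<in>residues. 1 - (if k = 0 then 1 else 0))"
    by (intro sum.cong) auto
  also have "\<dots> = of_nat p - 1" using p_pos by (simp add: sum_subtractf)
  finally have eq: "quad_corr w w w w - of_nat p = of_real (\<delta>\<^sup>2 * (real p - 1) - 1)"
    by (simp add: algebra_simps)
  have "\<bar>\<delta>\<^sup>2 * (real p - 1) - 1\<bar> \<le> \<delta>\<^sup>2 * real p + 1"
  proof -
    have "0 \<le> \<delta>\<^sup>2 * (real p - 1)" "\<delta>\<^sup>2 * (real p - 1) \<le> \<delta>\<^sup>2 * real p"
      using p_gt_1 by (auto intro!: mult_nonneg_nonneg mult_left_mono)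
    then show ?thesis by linarith
  qed
  moreover have "sqrt (real p) \<ge> 1" using p_gt_1 by simp
  ultimately show ?thesis unfolding eq norm_of_real by linarith
qed

text \<open>By symmetry every coincidence pattern of the four points reduces to one of 1+1+1+1,
  2+1+1, 3+1, 2+2 and 4; only the last two carry the main term \<open>p\<close>.\<close>

lemma quad_corr_bound:
  assumes r: "w \<in> residues" "x \<in> residues" "y \<in> residues" "z \<in> residues"
  shows "norm (quad_corr w x y z - of_nat p * of_bool (w = x \<and> y = z \<or> w = y \<and> x = z \<or> w = z \<and> x = y))
    \<le> 16390000 * sqrt (real p) + (if w = x \<and> x = y \<and> y = z then \<delta>\<^sup>2 * real p else 0)"
proof -
  have perms: "quad_corr w x w z = quad_corr w w x z" "quad_corr w x y w = quad_corr w w x y"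
    "quad_corr w x x z = quad_corr x x w z" "quad_corr w x y x = quad_corr x x w y"
    "quad_corr w x y y = quad_corr y y w x"
    "quad_corr w x x x = quad_corr x x x w" "quad_corr w x w w = quad_corr w w w x"
    "quad_corr w w y w = quad_corr w w w y" for w x y z
    by (simp_all add: quad_corr_def mult_ac)
  show ?thesis
  proof (cases "w = x")
    case wx: True
    show ?thesis
    proof (cases "y = z")
      case True
      then show ?thesis using wx r quad_corr_4[of w] quad_corr_22[of w y] by (cases "w = y") auto
    next
      case False
      then show ?thesis
        using wx r quad_corr_31[of w z] quad_corr_31[of w y] quad_corr_211[of w y z] perms(8)[of w y]
        by (cases "w = y"; cases "w = z") auto
    qed
  next
    case wx: False
    show ?thesis
    proof (cases "w = y")
      case wy: True
      then show ?thesis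
        using wx r quad_corr_22[of w x] quad_corr_31[of w x] quad_corr_211[of w x z]
          perms(1)[of w x x] perms(7)[of w x] perms(1)[of w x z]
        by (cases "x = z"; cases "w = z") auto
    next
      case wy: False
      show ?thesis
      proof (cases "w = z")
        case True
        then show ?thesis
          using wx wy r quad_corr_22[of w x] quad_corr_211[of w x y] perms(2)[of w x x] perms(2)[of w x y]
          by (cases "x = y") auto
      next
        case wz: False
        show ?thesis
        proof (cases "x = y")
          case True
          then show ?thesis
            using wx wz r quad_corr_31[of x w] quad_corr_211[of x w z] perms(6)[of w x] perms(3)[of w x z]
            by (cases "x = z") auto
        next
          case xy: False
          show ?thesis
          proof (cases "x = z")
            case True
            then show ?thesis using wx wy xy r quad_corr_211[of x w y] perms(4)[of w x y] by auto
          next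
            case False
            then show ?thesis
              using wx wy wz xy r quad_corr_211[of y w x] quad_corr_distinct[of w x y z]
                perms(5)[of w x y]
              by (cases "y = z") auto
          qed
        qed
      qed
    qed
  qed
qed

end

section \<open>Additive quadruples\<close>

definition quads :: "nat \<Rightarrow> (nat \<times> nat \<times> nat \<times> nat) set" where
  "quads t = {(i, j, k, l). i < t \<and> j < t \<and> k < t \<and> l < t \<and> i + j = k + l}"

lemma quads_altdef:
  "quads t = {x \<in> {..<t} \<times> {..<t} \<times> {..<t} \<times> {..<t}. fst x + fst (snd x) = fst (snd (snd x)) + snd (snd (snd x))}"
  by (auto simp: quads_def)

lemma finite_quads [simp]: "finite (quads t)"
  by (simp add: quads_altdef)

lemma card_quads_le: "card (quads t) \<le> t ^ 3"
proof -
  have "inj_on (\<lambda>(i, j, k, l). (i, j, k)) (quads t)" by (auto simp: inj_on_def quads_def)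
  moreover have "(\<lambda>(i, j, k, l). (i, j, k)) ` quads t \<subseteq> {..<t} \<times> {..<t} \<times> {..<t}"
    by (auto simp: quads_def)
  ultimately have "card (quads t) \<le> card ({..<t} \<times> {..<t} \<times> {..<t})"
    by (intro card_inj_on_le) auto
  then show ?thesis by (simp add: card_cartesian_product power3_eq_cube)
qed

lemma prod4_sum:
  fixes f1 f2 f3 f4 :: "nat \<Rightarrow> complex"
  shows "(\<Sum>i<t. f1 i) * (\<Sum>j<t. f2 j) * (\<Sum>k<t. f3 k) * (\<Sum>l<t. f4 l) =
    (\<Sum>(i, j, k, l)\<in>{..<t} \<times> {..<t} \<times> {..<t} \<times> {..<t}. f1 i * f2 j * f3 k * f4 l)"
proof -
  have "(\<Sum>i<t. f1 i) * (\<Sum>j<t. f2 j) * (\<Sum>k<t. f3 k) * (\<Sum>l<t. f4 l) =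
    (\<Sum>i<t. \<Sum>j<t. f1 i * (\<Sum>k<t. f2 j * (\<Sum>l<t. f3 k * f4 l)))"
    unfolding mult.assoc unfolding sum_product ..
  also have "\<dots> = (\<Sum>i<t. \<Sum>j<t. \<Sum>k<t. \<Sum>l<t. f1 i * f2 j * f3 k * f4 l)"
    by (simp only: sum_distrib_left mult.assoc)
  finally show ?thesis by (simp add: sum.cartesian_product case_prod_beta)
qed

section \<open>Dirichlet kernels and the l1 norm of the weights\<close>

definition dirichlet_sum :: "nat \<Rightarrow> nat \<Rightarrow> int \<Rightarrow> complex" where
  "dirichlet_sum n t y = (\<Sum>j<t. add_char n (int j * y))"

lemma cnj_dirichlet_sum: "cnj (dirichlet_sum n t y) = dirichlet_sum n t (- y)"
  by (simp add: dirichlet_sum_def cnj_add_char)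

lemma dirichlet_sum_cong: "n > 0 \<Longrightarrow> [x = y] (mod int n) \<Longrightarrow> dirichlet_sum n t x = dirichlet_sum n t y"
  unfolding dirichlet_sum_def by (intro sum.cong refl add_char_cong cong_mult cong_refl)

text \<open>A crude form of Jordan's inequality from the Taylor remainder \<open>x^3 / 6\<close> and
  \<open>x <= 2\<close>. The factor 1/3 is later absorbed by \<open>pi > 3\<close>.\<close>

lemma sin_ge_third:
  fixes x :: real assumes "0 \<le> x" "x \<le> pi / 2" shows "sin x \<ge> x / 3"
proof -
  have x: "x \<le> 2" using assms(2) pi_half_le_two by linarith
  have sum: "(\<Sum>m<3. sin_coeff m * x ^ m) = x" by (simp add: numeral_3_eq_3 sin_coeff_def)
  have "\<bar>sin x - x\<bar> \<le> inverse (fact 3) * \<bar>x\<bar> ^ 3"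
    using Maclaurin_sin_bound[of x 3] unfolding sum .
  also have "\<dots> = x * (x * x) / 6"
    using assms by (simp add: fact_numeral power3_eq_cube)
  also have "\<dots> \<le> x * (2 * 2) / 6" using x assms by (intro divide_right_mono mult_left_mono mult_mono) auto
  finally show ?thesis by linarith
qed

lemma norm_add_char_minus_1:
  assumes n: "n > 0" and y: "0 \<le> y" "2 * y \<le> int n"
  shows "norm (add_char n y - 1) \<ge> 2 * real_of_int y / real n"
proof -
  have "norm (add_char n y - 1) = 2 * \<bar>sin (2 * pi * real_of_int y / real n / 2)\<bar>"
    unfolding add_char_def cis_conv_exp by (rule dist_exp_i_1)
  also have "2 * pi * real_of_int y / real n / 2 = pi * (real_of_int y / real n)" by simp
  finally have eq: "norm (add_char n y - 1) = 2 * \<bar>sin (pi * (real_of_int y / real n))\<bar>" .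
  have "2 * real_of_int y \<le> real n" using y(2) by linarith
  then have u: "0 \<le> real_of_int y / real n" "real_of_int y / real n \<le> 1 / 2"
    using n y by (auto simp: field_simps)
  then have "0 \<le> pi * (real_of_int y / real n)" "pi * (real_of_int y / real n) \<le> pi * (1 / 2)"
    by (intro mult_nonneg_nonneg mult_left_mono; simp)+
  then have "sin (pi * (real_of_int y / real n)) \<ge> pi * (real_of_int y / real n) / 3"
    by (intro sin_ge_third) simp_all
  moreover have "3 * (real_of_int y / real n) \<le> pi * (real_of_int y / real n)"
    using u pi_gt3 by (intro mult_right_mono) auto
  ultimately show ?thesis unfolding eq by simp
qed

lemma norm_dirichlet_sum_le:
  assumes n: "n > 0" and y: "0 < y" "2 * y \<le> int n"
  shows "norm (dirichlet_sum n t y) \<le> real n / real_of_int y"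
proof -
  have ge: "norm (add_char n y - 1) \<ge> 2 * real_of_int y / real n"
    using norm_add_char_minus_1[OF n] y by simp
  have pos: "2 * real_of_int y / real n > 0" using n y by simp
  have ne: "add_char n y \<noteq> 1" using ge pos by auto
  have "dirichlet_sum n t y = (add_char n y ^ t - 1) / (add_char n y - 1)"
    unfolding dirichlet_sum_def add_char_mult_nat using ne by (rule geometric_sum)
  then have "norm (dirichlet_sum n t y) = norm (add_char n y ^ t - 1) / norm (add_char n y - 1)"
    by (simp add: norm_divide)
  also have "\<dots> \<le> 2 / (2 * real_of_int y / real n)"
  proof (rule frac_le)
    show "norm (add_char n y ^ t - 1) \<le> 2"
      using norm_triangle_ineq4[of "add_char n y ^ t" 1] by (simp add: norm_power)
  qed (use ge pos in auto)
  finally show ?thesis by simp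
qed

text \<open>A nonzero \<open>y\<close> is at distance \<open>min y (n - y)\<close> from 0 modulo
  \<open>n\<close>, and the geometric sum is at most \<open>n\<close> divided by this distance,
  hence by the sum of both quotients. The harmonic sums yield the logarithm; the term
  \<open>y = 0\<close> contributes \<open>t <= n\<close>.\<close>

lemma sum_norm_dirichlet_sum_le:
  assumes n: "n > 0" and t: "t \<le> n"
  shows "(\<Sum>y\<in>{0..<int n}. norm (dirichlet_sum n t y)) \<le> real n * (3 + 2 * ln (real n))"
proof -
  have bd: "norm (dirichlet_sum n t (int y)) \<le> real n / real y + real n / real (n - y)" if y: "y \<in> {1..<n}" for y
  proof (cases "2 * y \<le> n")
    case True
    then have "norm (dirichlet_sum n t (int y)) \<le> real n / real y"
      using norm_dirichlet_sum_le[OF n, of "int y" t] y by simp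
    then show ?thesis by (rule add_increasing2[rotated]) simp
  next
    case False
    have "norm (dirichlet_sum n t (int y)) = norm (cnj (dirichlet_sum n t (int y)))" by simp
    also have "cnj (dirichlet_sum n t (int y)) = dirichlet_sum n t (int (n - y))"
      unfolding cnj_dirichlet_sum using y by (intro dirichlet_sum_cong n) (simp add: cong_iff_dvd_diff of_nat_diff)
    also have "norm \<dots> \<le> real n / real (n - y)"
      using norm_dirichlet_sum_le[OF n, of "int (n - y)" t] y False by auto
    finally show ?thesis by (rule add_increasing[rotated]) simp
  qed
  have "harm n - ln (real n) \<le> (1 :: real)"
    using decseqD[OF decseq_harm_diff_ln, of 0 "n - 1"] n by (simp add: harm_def)
  then have harm: "(\<Sum>y\<in>{1..<n}. 1 / real y) \<le> 1 + ln (real n)"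
  proof -
    have "(\<Sum>y\<in>{1..<n}. 1 / real y) \<le> harm n"
      unfolding harm_def by (simp add: inverse_eq_divide) (intro sum_mono2, auto)
    then show ?thesis using \<open>harm n - ln (real n) \<le> 1\<close> by linarith
  qed
  have refl: "(\<Sum>y\<in>{1..<n}. 1 / real (n - y)) = (\<Sum>y\<in>{1..<n}. 1 / real y)"
    by (rule sum.reindex_bij_witness[where i = "\<lambda>y. n - y" and j = "\<lambda>y. n - y"]) auto
  have "(\<Sum>y\<in>{0..<int n}. norm (dirichlet_sum n t y)) = (\<Sum>y<n. norm (dirichlet_sum n t (int y)))"
    by (rule sum_int_atLeastLessThan)
  also have "\<dots> = norm (dirichlet_sum n t 0) + (\<Sum>y\<in>{1..<n}. norm (dirichlet_sum n t (int y)))"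
    using n by (simp add: lessThan_atLeast0 sum.atLeast_Suc_lessThan)
  also have "\<dots> \<le> real n + (\<Sum>y\<in>{1..<n}. real n / real y + real n / real (n - y))"
    using t by (intro add_mono sum_mono bd) (auto simp: dirichlet_sum_def)
  also have "\<dots> = real n + real n * (2 * (\<Sum>y\<in>{1..<n}. 1 / real y))"
  proof -
    have "(\<Sum>y\<in>{1..<n}. real n / real y + real n / real (n - y)) =
      real n * (\<Sum>y\<in>{1..<n}. 1 / real y) + real n * (\<Sum>y\<in>{1..<n}. 1 / real (n - y))"
      by (simp add: sum.distrib sum_distrib_left)
    then show ?thesis unfolding refl by simp
  qed
  also have "\<dots> \<le> real n + real n * (2 * (1 + ln (real n)))"
    using harm by (intro add_mono mult_left_mono) auto
  finally show ?thesis by (simp add: algebra_simps)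
qed

text \<open>The coefficient of the correlation with shifts \<open>a\<close>, \<open>b\<close>,
  \<open>c\<close> after the signs at \<open>r + i\<close>, \<open>r + j\<close>,
  \<open>r + k\<close>, \<open>r + l\<close> are expanded in characters. The relation
  \<open>i + j = k + l\<close> has eliminated \<open>i\<close> together with the common base
  frequency.\<close>

definition quad_weight :: "nat \<Rightarrow> nat \<Rightarrow> int \<Rightarrow> int \<Rightarrow> int \<Rightarrow> int \<Rightarrow> complex" where
  "quad_weight p t r a b c =
     (\<Sum>(i, j, k, l)\<in>quads t. add_char p ((r + int k) * b + (r + int l) * c - (r + int j) * a))"

lemma norm_quad_weight_le_card: "norm (quad_weight p t r a b c) \<le> real t ^ 3"
proof -
  have "norm (quad_weight p t r a b c) \<le> (\<Sum>q\<in>quads t. 1)"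
    unfolding quad_weight_def by (rule sum_norm_le) (auto simp: case_prod_beta)
  also have "\<dots> \<le> real (t ^ 3)" using card_quads_le by (simp del: of_nat_power)
  finally show ?thesis by simp
qed

lemma add_char_mult_modulus: "M > 0 \<Longrightarrow> add_char p x = add_char (p * M) (int M * x)"
proof -
  assume M: "M > 0"
  have "2 * pi * real_of_int (int M * x) / real (p * M) = (2 * pi * real_of_int x * real M) / (real p * real M)"
    by (simp add: mult_ac)
  also have "\<dots> = 2 * pi * real_of_int x / real p" using M by simp
  finally show ?thesis by (simp add: add_char_def)
qed

text \<open>The condition \<open>i + j = k + l\<close> is detected by the characters modulo \<open>p * M \<ge> 2 * t\<close>; this
  turns the weight into an average of products of four geometric sums.\<close>

lemma quad_weight_eq:
  assumes p: "p > 0" and M: "M > 0" and t: "2 * t \<le> p * M"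
  shows "of_nat (p * M) * quad_weight p t r a b c = add_char p (r * (b + c - a)) *
    (\<Sum>z\<in>{0..<int (p * M)}. dirichlet_sum (p * M) t z * dirichlet_sum (p * M) t (z - int M * a)
       * cnj (dirichlet_sum (p * M) t (z - int M * b)) * cnj (dirichlet_sum (p * M) t (z - int M * c)))"
proof -
  define N where "N = p * M"
  have N: "N > 0" using p M by (simp add: N_def)
  have tN: "2 * t \<le> N" using t by (simp add: N_def)
  let ?S = "{..<t} \<times> {..<t} \<times> {..<t} \<times> {..<t}"
  let ?D = "dirichlet_sum N t"
  define ph where "ph i j k l = add_char p (int k * b + int l * c - int j * a)" for i j k l :: nat
  have inner: "?D z * ?D (z - int M * a) * cnj (?D (z - int M * b)) * cnj (?D (z - int M * c)) =
    (\<Sum>(i, j, k, l)\<in>?S. ph i j k l * add_char N (z * (int i + int j - int k - int l)))" for z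
  proof -
    have "?D z * ?D (z - int M * a) * cnj (?D (z - int M * b)) * cnj (?D (z - int M * c)) =
      (\<Sum>(i, j, k, l)\<in>?S. add_char N (int i * z) * add_char N (int j * (z - int M * a))
        * add_char N (int k * - (z - int M * b)) * add_char N (int l * - (z - int M * c)))"
      unfolding cnj_dirichlet_sum unfolding dirichlet_sum_def by (rule prod4_sum)
    also have "\<dots> = (\<Sum>(i, j, k, l)\<in>?S. ph i j k l * add_char N (z * (int i + int j - int k - int l)))"
    proof (intro sum.cong refl, clarify)
      fix i j k l :: nat
      have "add_char N (int i * z) * add_char N (int j * (z - int M * a))
        * add_char N (int k * - (z - int M * b)) * add_char N (int l * - (z - int M * c)) =
        add_char N (int i * z + int j * (z - int M * a) + int k * - (z - int M * b) + int l * - (z - int M * c))"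
        by (simp only: add_char_add)
      also have "int i * z + int j * (z - int M * a) + int k * - (z - int M * b) + int l * - (z - int M * c)
        = int M * (int k * b + int l * c - int j * a) + z * (int i + int j - int k - int l)"
        by (simp add: algebra_simps)
      also have "add_char N \<dots> = ph i j k l * add_char N (z * (int i + int j - int k - int l))"
        unfolding ph_def N_def add_char_mult_modulus[OF M, of p "int k * b + int l * c - int j * a"]
        by (rule add_char_add)
      finally show "add_char N (int i * z) * add_char N (int j * (z - int M * a))
        * add_char N (int k * - (z - int M * b)) * add_char N (int l * - (z - int M * c)) =
        ph i j k l * add_char N (z * (int i + int j - int k - int l))" .
    qed
    finally show ?thesis .
  qed
  have "(\<Sum>z\<in>{0..<int N}. ?D z * ?D (z - int M * a) * cnj (?D (z - int M * b)) * cnj (?D (z - int M * c))) =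
    (\<Sum>q\<in>?S. \<Sum>z\<in>{0..<int N}. case q of (i, j, k, l) \<Rightarrow> ph i j k l * add_char N (z * (int i + int j - int k - int l)))"
    unfolding inner by (rule sum.swap)
  also have "\<dots> = (\<Sum>q\<in>?S. if fst q + fst (snd q) = fst (snd (snd q)) + snd (snd (snd q))
      then of_nat N * (case q of (i, j, k, l) \<Rightarrow> ph i j k l) else 0)"
  proof (intro sum.cong refl)
    fix q assume q: "q \<in> ?S"
    obtain i j k l where ijkl: "q = (i, j, k, l)" by (cases q)
    have le: "i < t" "j < t" "k < t" "l < t" using q ijkl by auto
    have "int N dvd int i + int j - int k - int l \<longleftrightarrow> i + j = k + l"
    proof
      assume d: "int N dvd int i + int j - int k - int l"
      have "\<bar>int i + int j - int k - int l\<bar> < int N" using le tN by linarith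
      then have "int i + int j - int k - int l = 0"
        using d dvd_imp_le_int[of "int i + int j - int k - int l" "int N"] by linarith
      then show "i + j = k + l" by linarith
    next
      assume "i + j = k + l"
      then have "int i + int j - int k - int l = 0" by linarith
      then show "int N dvd int i + int j - int k - int l" by simp
    qed
    then show "(\<Sum>z\<in>{0..<int N}. case q of (i, j, k, l) \<Rightarrow> ph i j k l * add_char N (z * (int i + int j - int k - int l))) =
      (if fst q + fst (snd q) = fst (snd (snd q)) + snd (snd (snd q))
        then of_nat N * (case q of (i, j, k, l) \<Rightarrow> ph i j k l) else 0)"
      unfolding ijkl prod.case sum_distrib_left[symmetric] sum_add_char[OF N] fst_conv snd_conv by simp
  qed
  also have "\<dots> = (\<Sum>q\<in>quads t. of_nat N * (case q of (i, j, k, l) \<Rightarrow> ph i j k l))"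
    unfolding quads_altdef by (rule sum.inter_filter[symmetric]) simp
  also have "\<dots> = of_nat N * (\<Sum>(i, j, k, l)\<in>quads t. ph i j k l)"
    by (simp add: sum_distrib_left case_prod_beta)
  finally have eq: "(\<Sum>z\<in>{0..<int N}. ?D z * ?D (z - int M * a) * cnj (?D (z - int M * b)) * cnj (?D (z - int M * c)))
    = of_nat N * (\<Sum>(i, j, k, l)\<in>quads t. ph i j k l)" .
  have "quad_weight p t r a b c = add_char p (r * (b + c - a)) * (\<Sum>(i, j, k, l)\<in>quads t. ph i j k l)"
    unfolding quad_weight_def sum_distrib_left
  proof (intro sum.cong refl, clarify)
    fix i j k l
    have "(r + int k) * b + (r + int l) * c - (r + int j) * a = r * (b + c - a) + (int k * b + int l * c - int j * a)"
      by (simp add: algebra_simps)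
    then show "add_char p ((r + int k) * b + (r + int l) * c - (r + int j) * a) = add_char p (r * (b + c - a)) * ph i j k l"
      unfolding ph_def by (simp only: add_char_add)
  qed
  then show ?thesis using eq by (simp add: N_def mult_ac)
qed

text \<open>For fixed \<open>z\<close> the points \<open>z - M * a\<close> with \<open>a\<close> in
  \<open>{0..<p}\<close> are distinct modulo \<open>N = p * M\<close>. So each of the sums over
  \<open>a\<close>, \<open>b\<close> and \<open>c\<close> is at most the l1 norm of one kernel
  modulo \<open>N\<close>, and the sum over \<open>z\<close> is a fourth such norm; finally one
  factor \<open>N\<close> is divided out.\<close>

lemma sum_norm_quad_weight_le:
  assumes p: "p > 0" and M: "M > 0" and t: "2 * t \<le> p * M"
  shows "(\<Sum>a\<in>{0..<int p}. \<Sum>b\<in>{0..<int p}. \<Sum>c\<in>{0..<int p}. norm (quad_weight p t r a b c))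
    \<le> real (p * M) ^ 3 * (3 + 2 * ln (real (p * M))) ^ 4"
proof -
  define N where "N = p * M"
  have N: "N > 0" using p M by (simp add: N_def)
  let ?R = "{0..<int p}" and ?D = "\<lambda>z. norm (dirichlet_sum N t z)"
  define \<Delta> where "\<Delta> = (\<Sum>y\<in>{0..<int N}. ?D y)"
  have \<Delta>0: "\<Delta> \<ge> 0" by (simp add: \<Delta>_def sum_nonneg)
  have part: "(\<Sum>a\<in>?R. ?D (z - int M * a)) \<le> \<Delta>" for z
  proof -
    have "(\<Sum>a\<in>?R. ?D (z - int M * a)) = (\<Sum>a\<in>?R. ?D ((z - int M * a) mod int N))"
      by (intro sum.cong refl arg_cong[of _ _ norm] dirichlet_sum_cong N) (simp add: cong_def)
    also have "\<dots> = (\<Sum>y\<in>(\<lambda>a. (z - int M * a) mod int N) ` ?R. ?D y)"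
    proof (rule sum.reindex[symmetric, unfolded o_def])
      show "inj_on (\<lambda>a. (z - int M * a) mod int N) ?R"
      proof (rule inj_onI)
        fix a b assume ab: "a \<in> ?R" "b \<in> ?R" "(z - int M * a) mod int N = (z - int M * b) mod int N"
        then have "int N dvd (z - int M * a) - (z - int M * b)" by (simp add: mod_eq_dvd_iff)
        then have "int M * int p dvd int M * (b - a)" by (simp add: N_def algebra_simps)
        then have "int p dvd b - a" using M by simp
        then show "a = b" using ab(1,2)
          by (metis atLeastLessThan_iff cong_iff_dvd_diff cong_less_imp_eq_int)
      qed
    qed
    also have "\<dots> \<le> \<Delta>" unfolding \<Delta>_def using N by (intro sum_mono2) auto
    finally show ?thesis .
  qed
  have "real N * (\<Sum>a\<in>?R. \<Sum>b\<in>?R. \<Sum>c\<in>?R. norm (quad_weight p t r a b c))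
    = (\<Sum>a\<in>?R. \<Sum>b\<in>?R. \<Sum>c\<in>?R. norm (of_nat N * quad_weight p t r a b c))"
    by (simp add: sum_distrib_left norm_mult)
  also have "\<dots> \<le> (\<Sum>a\<in>?R. \<Sum>b\<in>?R. \<Sum>c\<in>?R. \<Sum>z\<in>{0..<int N}.
      ?D z * ?D (z - int M * a) * ?D (z - int M * b) * ?D (z - int M * c))"
  proof (rule sum_mono, rule sum_mono, rule sum_mono)
    fix a b c
    have "norm (of_nat N * quad_weight p t r a b c) = norm (\<Sum>z\<in>{0..<int N}. dirichlet_sum N t z *
      dirichlet_sum N t (z - int M * a) * cnj (dirichlet_sum N t (z - int M * b)) * cnj (dirichlet_sum N t (z - int M * c)))"
      unfolding N_def quad_weight_eq[OF p M t] norm_mult norm_add_char by simp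
    also have "\<dots> \<le> (\<Sum>z\<in>{0..<int N}. norm (dirichlet_sum N t z *
      dirichlet_sum N t (z - int M * a) * cnj (dirichlet_sum N t (z - int M * b)) * cnj (dirichlet_sum N t (z - int M * c))))"
      by (rule norm_sum)
    finally show "norm (of_nat N * quad_weight p t r a b c) \<le> (\<Sum>z\<in>{0..<int N}.
      ?D z * ?D (z - int M * a) * ?D (z - int M * b) * ?D (z - int M * c))"
      by (simp only: norm_mult complex_mod_cnj)
  qed
  also have "\<dots> = (\<Sum>z\<in>{0..<int N}. ?D z * (\<Sum>a\<in>?R. ?D (z - int M * a)) * (\<Sum>b\<in>?R. ?D (z - int M * b)) * (\<Sum>c\<in>?R. ?D (z - int M * c)))"
  proof -
    have "(\<Sum>a\<in>?R. \<Sum>b\<in>?R. \<Sum>c\<in>?R. \<Sum>z\<in>{0..<int N}. ?D z * ?D (z - int M * a) * ?D (z - int M * b) * ?D (z - int M * c))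
      = (\<Sum>a\<in>?R. \<Sum>b\<in>?R. \<Sum>z\<in>{0..<int N}. \<Sum>c\<in>?R. ?D z * ?D (z - int M * a) * ?D (z - int M * b) * ?D (z - int M * c))"
      by (rule sum.cong[OF refl], rule sum.cong[OF refl], rule sum.swap)
    also have "\<dots> = (\<Sum>a\<in>?R. \<Sum>z\<in>{0..<int N}. \<Sum>b\<in>?R. \<Sum>c\<in>?R. ?D z * ?D (z - int M * a) * ?D (z - int M * b) * ?D (z - int M * c))"
      by (rule sum.cong[OF refl], rule sum.swap)
    also have "\<dots> = (\<Sum>z\<in>{0..<int N}. \<Sum>a\<in>?R. \<Sum>b\<in>?R. \<Sum>c\<in>?R. ?D z * ?D (z - int M * a) * ?D (z - int M * b) * ?D (z - int M * c))"
      by (rule sum.swap)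
    also have "\<dots> = (\<Sum>z\<in>{0..<int N}. ?D z * (\<Sum>a\<in>?R. \<Sum>b\<in>?R. ?D (z - int M * a) * (\<Sum>c\<in>?R. ?D (z - int M * b) * ?D (z - int M * c))))"
      by (simp only: sum_distrib_left mult.assoc)
    finally show ?thesis unfolding mult.assoc unfolding sum_product .
  qed
  also have "\<dots> \<le> (\<Sum>z\<in>{0..<int N}. ?D z * \<Delta> * \<Delta> * \<Delta>)"
    using \<Delta>0 by (intro sum_mono mult_mono part order_refl mult_nonneg_nonneg sum_nonneg norm_ge_zero)
  also have "\<dots> = \<Delta> ^ 4" by (simp add: \<Delta>_def power_eq_if flip: sum_distrib_right)
  also have "\<dots> \<le> (real N * (3 + 2 * ln (real N))) ^ 4"
  proof (rule power_mono[OF _ \<Delta>0])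
    show "\<Delta> \<le> real N * (3 + 2 * ln (real N))"
      unfolding \<Delta>_def using t by (intro sum_norm_dirichlet_sum_le N) (simp add: N_def)
  qed
  also have "\<dots> = real N * (real N ^ 3 * (3 + 2 * ln (real N)) ^ 4)"
    by (simp add: power_mult_distrib power_eq_if)
  finally show ?thesis using N by (simp add: N_def)
qed

section \<open>The fourth moment of a flat sequence\<close>

text \<open>The indicator of \<open>0, a, b, c\<close> coinciding in pairs. The three pairings
  overlap only at the origin, which is counted three times, hence the correction by 2.\<close>

definition pairing_indicator :: "int \<Rightarrow> int \<Rightarrow> int \<Rightarrow> complex" where
  "pairing_indicator a b c =
     of_bool (b = 0 \<and> a = c) + of_bool (c = 0 \<and> a = b) + of_bool (a = 0 \<and> b = c)
       - 2 * of_bool (a = 0 \<and> b = 0 \<and> c = 0)"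

definition quad_count :: "nat \<Rightarrow> nat \<Rightarrow> int \<Rightarrow> nat" where
  "quad_count p t r =
     card {(i, j, k, l) \<in> quads t. int p dvd int l - int j} +
     card {(i, j, k, l) \<in> quads t. int p dvd int k - int j} +
     card {(i, j, k, l) \<in> quads t. int p dvd 2 * r + int k + int l}"

lemma sum_triple_delta:
  fixes f :: "int \<Rightarrow> int \<Rightarrow> int \<Rightarrow> 'a :: comm_ring_1"
  assumes "p > 0"
  defines "R \<equiv> {0..<int p}"
  shows "(\<Sum>a\<in>R. \<Sum>b\<in>R. \<Sum>c\<in>R. f a b c * of_bool (b = 0 \<and> a = c)) = (\<Sum>a\<in>R. f a 0 a)"
    and "(\<Sum>a\<in>R. \<Sum>b\<in>R. \<Sum>c\<in>R. f a b c * of_bool (c = 0 \<and> a = b)) = (\<Sum>a\<in>R. f a a 0)"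
    and "(\<Sum>a\<in>R. \<Sum>b\<in>R. \<Sum>c\<in>R. f a b c * of_bool (a = 0 \<and> b = c)) = (\<Sum>b\<in>R. f 0 b b)"
    and "(\<Sum>a\<in>R. \<Sum>b\<in>R. \<Sum>c\<in>R. f a b c * of_bool (a = 0 \<and> b = 0 \<and> c = 0)) = f 0 0 0"
proof -
  have R: "finite R" "0 \<in> R" using assms by auto
  have d: "(\<Sum>x\<in>R. g x * of_bool (x = y)) = g y" if "y \<in> R" for g :: "int \<Rightarrow> 'a" and y
    using R that by (simp add: of_bool_def if_distrib cong: if_cong)
  have d': "(\<Sum>x\<in>R. g x * of_bool (y = x)) = g y" if "y \<in> R" for g :: "int \<Rightarrow> 'a" and y
    using d[OF that] by (simp add: eq_commute)
  have pull: "(\<Sum>x\<in>R. g x * of_bool (P \<and> Q x)) = (\<Sum>x\<in>R. g x * of_bool (Q x)) * of_bool P"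
    for g :: "int \<Rightarrow> 'a" and P Q by (cases P) simp_all
  have "(\<Sum>a\<in>R. \<Sum>b\<in>R. \<Sum>c\<in>R. f a b c * of_bool (b = 0 \<and> a = c)) = (\<Sum>a\<in>R. \<Sum>b\<in>R. f a b a * of_bool (b = 0))"
    by (intro sum.cong refl) (simp only: pull d')
  then show "(\<Sum>a\<in>R. \<Sum>b\<in>R. \<Sum>c\<in>R. f a b c * of_bool (b = 0 \<and> a = c)) = (\<Sum>a\<in>R. f a 0 a)"
    by (simp only: d R)
  have "(\<Sum>a\<in>R. \<Sum>b\<in>R. \<Sum>c\<in>R. f a b c * of_bool (c = 0 \<and> a = b)) = (\<Sum>a\<in>R. \<Sum>b\<in>R. f a b 0 * of_bool (a = b))"
    by (subst conj_commute, intro sum.cong refl) (simp only: pull d R)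
  also have "\<dots> = (\<Sum>a\<in>R. f a a 0)" by (intro sum.cong refl) (simp only: d')
  finally show "(\<Sum>a\<in>R. \<Sum>b\<in>R. \<Sum>c\<in>R. f a b c * of_bool (c = 0 \<and> a = b)) = (\<Sum>a\<in>R. f a a 0)" .
  have "(\<Sum>a\<in>R. \<Sum>b\<in>R. \<Sum>c\<in>R. f a b c * of_bool (a = 0 \<and> b = c)) = (\<Sum>a\<in>R. \<Sum>b\<in>R. f a b b * of_bool (a = 0))"
    by (intro sum.cong refl) (simp only: pull d')
  also have "\<dots> = (\<Sum>a\<in>R. (\<Sum>b\<in>R. f a b b) * of_bool (a = 0))" by (simp only: sum_distrib_right)
  finally show "(\<Sum>a\<in>R. \<Sum>b\<in>R. \<Sum>c\<in>R. f a b c * of_bool (a = 0 \<and> b = c)) = (\<Sum>b\<in>R. f 0 b b)"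
    by (simp only: d R)
  have pull2: "(\<Sum>x\<in>R. g x * of_bool (x = 0) * z) = g 0 * z" for g :: "int \<Rightarrow> 'a" and z
    by (simp only: sum_distrib_right[symmetric] d R)
  show "(\<Sum>a\<in>R. \<Sum>b\<in>R. \<Sum>c\<in>R. f a b c * of_bool (a = 0 \<and> b = 0 \<and> c = 0)) = f 0 0 0"
    by (simp only: pull pull2 d R)
qed

text \<open>Each pairing leaves one free residue, and orthogonality turns the sum over it into a
  congruence modulo \<open>p\<close>. The overlap at the origin has no free residue and contributes
  no factor \<open>p\<close>.\<close>

lemma sum_quad_weight_pairing:
  assumes p: "p > 0"
  shows "(\<Sum>a\<in>{0..<int p}. \<Sum>b\<in>{0..<int p}. \<Sum>c\<in>{0..<int p}. quad_weight p t r a b c * pairing_indicator a b c)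
    = of_nat p * of_nat (quad_count p t r) - 2 * of_nat (card (quads t))"
proof -
  let ?R = "{0..<int p}"
  have detect: "(\<Sum>a\<in>?R. \<Sum>(i, j, k, l)\<in>quads t. add_char p (a * g i j k l)) =
    of_nat p * of_nat (card {(i, j, k, l) \<in> quads t. int p dvd g i j k l})" for g
  proof -
    have "(\<Sum>a\<in>?R. \<Sum>(i, j, k, l)\<in>quads t. add_char p (a * g i j k l)) =
      (\<Sum>q\<in>quads t. \<Sum>a\<in>?R. case q of (i, j, k, l) \<Rightarrow> add_char p (a * g i j k l))" by (rule sum.swap)
    also have "\<dots> = (\<Sum>q\<in>quads t. if (case q of (i, j, k, l) \<Rightarrow> int p dvd g i j k l) then of_nat p else 0)"
      by (intro sum.cong refl) (auto simp: sum_add_char[OF p] split: prod.split)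
    also have "\<dots> = (\<Sum>q\<in>{q \<in> quads t. case q of (i, j, k, l) \<Rightarrow> int p dvd g i j k l}. of_nat p)"
      by (rule sum.inter_filter[symmetric]) simp
    also have "{q \<in> quads t. case q of (i, j, k, l) \<Rightarrow> int p dvd g i j k l} =
      {(i, j, k, l) \<in> quads t. int p dvd g i j k l}" by auto
    finally show ?thesis by simp
  qed
  have w1: "(\<Sum>a\<in>?R. quad_weight p t r a 0 a) = (\<Sum>a\<in>?R. \<Sum>(i, j, k, l)\<in>quads t. add_char p (a * (int l - int j)))"
    unfolding quad_weight_def by (intro sum.cong refl) (auto intro!: arg_cong[of _ _ "add_char p"] simp: algebra_simps)
  have w2: "(\<Sum>a\<in>?R. quad_weight p t r a a 0) = (\<Sum>a\<in>?R. \<Sum>(i, j, k, l)\<in>quads t. add_char p (a * (int k - int j)))"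
    unfolding quad_weight_def by (intro sum.cong refl) (auto intro!: arg_cong[of _ _ "add_char p"] simp: algebra_simps)
  have w3: "(\<Sum>a\<in>?R. quad_weight p t r 0 a a) = (\<Sum>a\<in>?R. \<Sum>(i, j, k, l)\<in>quads t. add_char p (a * (2 * r + int k + int l)))"
    unfolding quad_weight_def by (intro sum.cong refl) (auto intro!: arg_cong[of _ _ "add_char p"] simp: algebra_simps)
  have w4: "quad_weight p t r 0 0 0 = of_nat (card (quads t))"
    by (simp add: quad_weight_def case_prod_beta)
  let ?W = "quad_weight p t r"
  have "(\<Sum>a\<in>?R. \<Sum>b\<in>?R. \<Sum>c\<in>?R. ?W a b c * pairing_indicator a b c) =
    (\<Sum>a\<in>?R. \<Sum>b\<in>?R. \<Sum>c\<in>?R. ?W a b c * of_bool (b = 0 \<and> a = c)) +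
    (\<Sum>a\<in>?R. \<Sum>b\<in>?R. \<Sum>c\<in>?R. ?W a b c * of_bool (c = 0 \<and> a = b)) +
    (\<Sum>a\<in>?R. \<Sum>b\<in>?R. \<Sum>c\<in>?R. ?W a b c * of_bool (a = 0 \<and> b = c)) -
    2 * (\<Sum>a\<in>?R. \<Sum>b\<in>?R. \<Sum>c\<in>?R. ?W a b c * of_bool (a = 0 \<and> b = 0 \<and> c = 0))"
    unfolding pairing_indicator_def sum_distrib_left sum.distrib[symmetric] sum_subtractf[symmetric]
    by (intro sum.cong refl) (simp only: algebra_simps)
  then show ?thesis
    unfolding sum_triple_delta[OF p] w1 w2 w3 w4 detect quad_count_def by (simp add: algebra_simps)
qed

section \<open>Expansion of the quadruple sum in additive characters\<close>

context flat_sequence begin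

definition shat :: "int \<Rightarrow> complex" where "shat k = - 1 + of_real (sqrt (real p)) * H k"

definition shat_corr :: "int \<Rightarrow> int \<Rightarrow> int \<Rightarrow> complex" where
  "shat_corr a b c = (\<Sum>k\<in>residues. shat k * shat (k + a) * cnj (shat (k + b)) * cnj (shat (k + c)))"

lemma shat_cong: "[x = y] (mod int p) \<Longrightarrow> shat x = shat y"
  by (simp add: shat_def H_cong)

lemma sqrt_p_ge_1: "sqrt (real p) \<ge> 1" using p_gt_1 by simp

lemma norm_shat_le: "norm (shat k) \<le> 4 * sqrt (real p)"
proof -
  have "norm (shat k) \<le> 1 + sqrt (real p) * norm (H k)"
    unfolding shat_def by (rule order_trans[OF norm_triangle_ineq]) (simp add: norm_mult)
  also have "sqrt (real p) * norm (H k) \<le> sqrt (real p) * 3"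
    by (intro mult_left_mono norm_H_le) simp
  finally show ?thesis using sqrt_p_ge_1 by linarith
qed

text \<open>Dropping the summand \<open>- 1\<close> of the transform changes each factor by at most
  1 while all factors are at most \<open>4 * sqrt p\<close>; over \<open>p\<close> frequencies this
  costs \<open>256 * p^2 * sqrt p\<close>. What remains is
  \<open>p^2 * quad_corr 0 a b c\<close>.\<close>

lemma shat_corr_bound:
  assumes abc: "a \<in> residues" "b \<in> residues" "c \<in> residues"
  shows "norm (shat_corr a b c - of_nat p ^ 3 * pairing_indicator a b c)
    \<le> 20000000 * (real p)\<^sup>2 * sqrt (real p) + (if a = 0 \<and> b = 0 \<and> c = 0 then \<delta>\<^sup>2 * real p ^ 3 else 0)"
proof -
  define q where "q = complex_of_real (sqrt (real p))"
  have q: "q * q = of_nat p" "cnj q = q" by (simp_all add: q_def flip: of_real_mult)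
  define G where "G k = q * H k" for k
  have sp: "sqrt (real p) * sqrt (real p) = real p" by simp
  have nG: "norm (G k) \<le> 4 * sqrt (real p)" for k
  proof -
    have "sqrt (real p) * norm (H k) \<le> sqrt (real p) * 4"
      using norm_H_le[of k] by (intro mult_left_mono) auto
    then show ?thesis by (simp add: G_def q_def norm_mult)
  qed
  have dG: "norm (shat k - G k) \<le> 1" for k by (simp add: shat_def G_def q_def)
  have dG': "norm (cnj (shat k) - cnj (G k)) \<le> 1" for k
    using dG[of k] by (metis complex_cnj_diff complex_mod_cnj)
  have step1: "norm (shat_corr a b c - (\<Sum>k\<in>residues. G k * G (k + a) * cnj (G (k + b)) * cnj (G (k + c))))
    \<le> real p * (4 * (4 * sqrt (real p)) ^ 3)"
  proof -
    have "norm (shat_corr a b c - (\<Sum>k\<in>residues. G k * G (k + a) * cnj (G (k + b)) * cnj (G (k + c))))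
      \<le> (\<Sum>k\<in>residues. 4 * (4 * sqrt (real p)) ^ 3)"
      unfolding shat_corr_def sum_subtractf[symmetric]
      by (intro sum_norm_le norm_prod4_diff_le) (simp_all only: complex_mod_cnj norm_shat_le nG dG dG')
    then show ?thesis by simp
  qed
  have "(\<Sum>k\<in>residues. G k * G (k + a) * cnj (G (k + b)) * cnj (G (k + c))) = of_nat p ^ 2 * quad_corr 0 a b c"
    unfolding quad_corr_def sum_distrib_left
  proof (intro sum.cong refl)
    fix k
    have "G k * G (k + a) * cnj (G (k + b)) * cnj (G (k + c)) =
      (q * q) * (q * q) * (\<sigma> * \<sigma>) * (H k * H (k + a) * H (k + b) * H (k + c))"
      by (simp add: G_def cnj_H q(2) mult_ac)
    then show "G k * G (k + a) * cnj (G (k + b)) * cnj (G (k + c)) =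
      of_nat p ^ 2 * (H (k + 0) * H (k + a) * H (k + b) * H (k + c))"
      unfolding q(1) sigma_square by (simp add: power2_eq_square)
  qed
  then have step2: "norm ((\<Sum>k\<in>residues. G k * G (k + a) * cnj (G (k + b)) * cnj (G (k + c))) - of_nat p ^ 3 * pairing_indicator a b c)
    \<le> (real p)\<^sup>2 * (16390000 * sqrt (real p) + (if a = 0 \<and> b = 0 \<and> c = 0 then \<delta>\<^sup>2 * real p else 0))"
  proof -
    have "pairing_indicator a b c = of_bool (0 = a \<and> b = c \<or> 0 = b \<and> a = c \<or> 0 = c \<and> a = b)"
      by (auto simp: pairing_indicator_def)
    then have "of_nat p ^ 2 * quad_corr 0 a b c - of_nat p ^ 3 * pairing_indicator a b c =
      of_nat p ^ 2 * (quad_corr 0 a b c - of_nat p * of_bool (0 = a \<and> b = c \<or> 0 = b \<and> a = c \<or> 0 = c \<and> a = b))"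
      by (simp add: algebra_simps power_eq_if)
    moreover have "norm (quad_corr 0 a b c - of_nat p * of_bool (0 = a \<and> b = c \<or> 0 = b \<and> a = c \<or> 0 = c \<and> a = b))
      \<le> 16390000 * sqrt (real p) + (if a = 0 \<and> b = 0 \<and> c = 0 then \<delta>\<^sup>2 * real p else 0)"
      using quad_corr_bound[of 0 a b c] abc p_pos by (auto split: if_splits)
    ultimately show ?thesis
      unfolding \<open>(\<Sum>k\<in>residues. G k * G (k + a) * cnj (G (k + b)) * cnj (G (k + c))) = of_nat p ^ 2 * quad_corr 0 a b c\<close>
      by (simp only: norm_mult norm_power norm_of_nat) (intro mult_left_mono; simp)
  qed
  have "norm (shat_corr a b c - of_nat p ^ 3 * pairing_indicator a b c)
    \<le> real p * (4 * (4 * sqrt (real p)) ^ 3) +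
       (real p)\<^sup>2 * (16390000 * sqrt (real p) + (if a = 0 \<and> b = 0 \<and> c = 0 then \<delta>\<^sup>2 * real p else 0))"
    using norm_triangle_mono[OF step1 step2] by simp
  also have "real p * (4 * (4 * sqrt (real p)) ^ 3) = 256 * ((real p)\<^sup>2 * sqrt (real p))"
  proof -
    have "(4 * sqrt (real p)) ^ 3 = 64 * ((sqrt (real p) * sqrt (real p)) * sqrt (real p))"
      by (simp only: power3_eq_cube mult_ac)
    then show ?thesis unfolding sp by (simp add: power2_eq_square)
  qed
  also have "256 * ((real p)\<^sup>2 * sqrt (real p)) +
       (real p)\<^sup>2 * (16390000 * sqrt (real p) + (if a = 0 \<and> b = 0 \<and> c = 0 then \<delta>\<^sup>2 * real p else 0))
    = 16390256 * ((real p)\<^sup>2 * sqrt (real p)) + (if a = 0 \<and> b = 0 \<and> c = 0 then \<delta>\<^sup>2 * real p ^ 3 else 0)"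
    by (simp add: algebra_simps power_eq_if)
  also have "16390256 * ((real p)\<^sup>2 * sqrt (real p)) \<le> 20000000 * (real p)\<^sup>2 * sqrt (real p)"
    by (simp add: mult.assoc)
  finally show ?thesis by simp
qed

lemma cnj_s: "cnj (s x) = s x"
  using s_cases[of x] by auto

lemma fourier_inversion: "of_nat p * s n = (\<Sum>k\<in>residues. shat k * add_char p (- (n * k)))"
proof -
  have "(\<Sum>k\<in>residues. shat k * add_char p (- (n * k))) =
    (\<Sum>k\<in>residues. \<Sum>j\<in>residues. s j * add_char p (k * (j - n)))"
  proof (intro sum.cong refl)
    fix k
    have "shat k * add_char p (- (n * k)) = (\<Sum>j\<in>residues. s j * add_char p (j * k) * add_char p (- (n * k)))"
      unfolding shat_def fourier_s[symmetric] by (simp add: sum_distrib_right)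
    also have "\<dots> = (\<Sum>j\<in>residues. s j * add_char p (k * (j - n)))"
    proof (intro sum.cong refl)
      fix j
      have "k * (j - n) = j * k + - (n * k)" by (simp add: algebra_simps)
      then show "s j * add_char p (j * k) * add_char p (- (n * k)) = s j * add_char p (k * (j - n))"
        by (simp only: add_char_add mult.assoc)
    qed
    finally show "shat k * add_char p (- (n * k)) = (\<Sum>j\<in>residues. s j * add_char p (k * (j - n)))" .
  qed
  also have "\<dots> = (\<Sum>j\<in>residues. \<Sum>k\<in>residues. s j * add_char p (k * (j - n)))" by (rule sum.swap)
  also have "\<dots> = (\<Sum>j\<in>residues. if j = n mod int p then of_nat p * s j else 0)"
  proof (intro sum.cong refl)
    fix j assume j: "j \<in> residues"
    have "int p dvd j - n \<longleftrightarrow> j = n mod int p"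
      using j by (simp add: mod_eq_dvd_iff[symmetric])
    then show "(\<Sum>k\<in>residues. s j * add_char p (k * (j - n))) = (if j = n mod int p then of_nat p * s j else 0)"
      unfolding sum_distrib_left[symmetric] sum_add_char[OF p_pos] by simp
  qed
  also have "\<dots> = of_nat p * s (n mod int p)"
    using p_pos by (subst sum.delta) auto
  also have "s (n mod int p) = s n" by (rule s_cong) simp
  finally show ?thesis by simp
qed

text \<open>The translation by \<open>k\<close> relates all frequencies to a common base frequency.
  The conjugate form, available since \<open>s\<close> is real, serves the two signs on the
  right-hand side of \<open>i + j = k + l\<close>.\<close>

lemma fourier_inversion_shift:
  "of_nat p * s n = (\<Sum>a\<in>residues. shat (k + a) * add_char p (- (n * (k + a))))"
  "of_nat p * s n = (\<Sum>a\<in>residues. cnj (shat (k + a)) * add_char p (n * (k + a)))"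
proof -
  have "(\<Sum>a\<in>residues. shat (a + k) * add_char p (- (n * (a + k)))) = (\<Sum>a\<in>residues. shat a * add_char p (- (n * a)))"
    by (rule sum_residues_shift[OF p_pos, where f = "\<lambda>a. shat a * add_char p (- (n * a))"])
       (intro arg_cong2[of _ _ _ _ "(*)"] shat_cong add_char_cong p_pos;
        simp add: cong_minus_minus_iff cong_mult)
  then show 1: "of_nat p * s n = (\<Sum>a\<in>residues. shat (k + a) * add_char p (- (n * (k + a))))"
    by (simp add: fourier_inversion add.commute)
  have "of_nat p * s n = cnj (of_nat p * s n)" by (simp add: cnj_s)
  also have "\<dots> = (\<Sum>a\<in>residues. cnj (shat (k + a)) * add_char p (n * (k + a)))"
    unfolding 1 cnj_sum by (simp add: cnj_add_char)
  finally show "of_nat p * s n = (\<Sum>a\<in>residues. cnj (shat (k + a)) * add_char p (n * (k + a)))" .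
qed

lemma product_expansion:
  assumes n: "n1 + n2 = n3 + (n4 :: int)"
  shows "of_nat p ^ 4 * (s n1 * s n2 * s n3 * s n4) =
    (\<Sum>a\<in>residues. \<Sum>b\<in>residues. \<Sum>c\<in>residues. add_char p (n3 * b + n4 * c - n2 * a) * shat_corr a b c)"
proof -
  define u where "u k a b c = shat k * shat (k + a) * cnj (shat (k + b)) * cnj (shat (k + c))" for k a b c
  have "of_nat p ^ 4 * (s n1 * s n2 * s n3 * s n4) =
    (of_nat p * s n1) * ((of_nat p * s n2) * ((of_nat p * s n3) * (of_nat p * s n4)))"
    by (simp add: power_eq_if)
  also have "\<dots> = (\<Sum>k\<in>residues. shat k * add_char p (- (n1 * k)) * ((of_nat p * s n2) * ((of_nat p * s n3) * (of_nat p * s n4))))"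
    unfolding fourier_inversion[of n1] by (rule sum_distrib_right)
  also have "\<dots> = (\<Sum>k\<in>residues. \<Sum>a\<in>residues. \<Sum>b\<in>residues. \<Sum>c\<in>residues. add_char p (n3 * b + n4 * c - n2 * a) * u k a b c)"
  proof (rule sum.cong[OF refl])
    fix k
    have "shat k * add_char p (- (n1 * k)) * ((of_nat p * s n2) * ((of_nat p * s n3) * (of_nat p * s n4))) =
      shat k * add_char p (- (n1 * k)) * ((\<Sum>a\<in>residues. shat (k + a) * add_char p (- (n2 * (k + a)))) *
        ((\<Sum>b\<in>residues. cnj (shat (k + b)) * add_char p (n3 * (k + b))) *
         (\<Sum>c\<in>residues. cnj (shat (k + c)) * add_char p (n4 * (k + c)))))"
      using fourier_inversion_shift[where k = k] by metis
    also have "\<dots> = (\<Sum>a\<in>residues. \<Sum>b\<in>residues. \<Sum>c\<in>residues. shat k * add_char p (- (n1 * k)) *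
      (shat (k + a) * add_char p (- (n2 * (k + a))) *
        ((cnj (shat (k + b)) * add_char p (n3 * (k + b))) * (cnj (shat (k + c)) * add_char p (n4 * (k + c))))))"
      unfolding sum_product unfolding sum_distrib_left ..
    also have "\<dots> = (\<Sum>a\<in>residues. \<Sum>b\<in>residues. \<Sum>c\<in>residues. add_char p (n3 * b + n4 * c - n2 * a) * u k a b c)"
    proof (intro sum.cong refl)
      fix a b c
      \<comment> \<open>The additive relation makes the phases depending on the base frequency
        \<open>k\<close> cancel, so that the sum over \<open>k\<close> becomes a pure
        correlation.\<close>
      have "(n1 + n2) * k = (n3 + n4) * k" using n by simp
      then have "n3 * b + n4 * c - n2 * a = - (n1 * k) + - (n2 * (k + a)) + n3 * (k + b) + n4 * (k + c)"
        by (simp add: algebra_simps)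
      then have "add_char p (n3 * b + n4 * c - n2 * a) = add_char p (- (n1 * k)) * add_char p (- (n2 * (k + a)))
        * add_char p (n3 * (k + b)) * add_char p (n4 * (k + c))" by (simp only: add_char_add)
      then show "shat k * add_char p (- (n1 * k)) * (shat (k + a) * add_char p (- (n2 * (k + a))) *
        ((cnj (shat (k + b)) * add_char p (n3 * (k + b))) * (cnj (shat (k + c)) * add_char p (n4 * (k + c)))))
        = add_char p (n3 * b + n4 * c - n2 * a) * u k a b c"
        unfolding u_def by (simp only: mult_ac)
    qed
    finally show "shat k * add_char p (- (n1 * k)) * ((of_nat p * s n2) * ((of_nat p * s n3) * (of_nat p * s n4))) =
      (\<Sum>a\<in>residues. \<Sum>b\<in>residues. \<Sum>c\<in>residues. add_char p (n3 * b + n4 * c - n2 * a) * u k a b c)" .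
  qed
  also have "\<dots> = (\<Sum>a\<in>residues. \<Sum>k\<in>residues. \<Sum>b\<in>residues. \<Sum>c\<in>residues. add_char p (n3 * b + n4 * c - n2 * a) * u k a b c)"
    by (rule sum.swap)
  also have "\<dots> = (\<Sum>a\<in>residues. \<Sum>b\<in>residues. \<Sum>k\<in>residues. \<Sum>c\<in>residues. add_char p (n3 * b + n4 * c - n2 * a) * u k a b c)"
    by (rule sum.cong[OF refl], rule sum.swap)
  also have "\<dots> = (\<Sum>a\<in>residues. \<Sum>b\<in>residues. \<Sum>c\<in>residues. \<Sum>k\<in>residues. add_char p (n3 * b + n4 * c - n2 * a) * u k a b c)"
    by (rule sum.cong[OF refl], rule sum.cong[OF refl], rule sum.swap)
  finally show ?thesis by (simp only: shat_corr_def u_def sum_distrib_left)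
qed

definition quad_sum :: "int \<Rightarrow> nat \<Rightarrow> complex" where
  "quad_sum r t = (\<Sum>(i, j, k, l)\<in>quads t. s (r + int i) * s (r + int j) * s (r + int k) * s (r + int l))"

lemma quad_sum_expansion:
  "of_nat p ^ 4 * quad_sum r t =
    (\<Sum>a\<in>residues. \<Sum>b\<in>residues. \<Sum>c\<in>residues. quad_weight p t r a b c * shat_corr a b c)"
proof -
  let ?f = "\<lambda>q a b c. (case q of (i, j, k, l) \<Rightarrow> add_char p ((r + int k) * b + (r + int l) * c - (r + int j) * a)) * shat_corr a b c"
  have "of_nat p ^ 4 * quad_sum r t = (\<Sum>q\<in>quads t. \<Sum>a\<in>residues. \<Sum>b\<in>residues. \<Sum>c\<in>residues. ?f q a b c)"
    unfolding quad_sum_def sum_distrib_left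
  proof (rule sum.cong[OF refl])
    fix q assume q: "q \<in> quads t"
    obtain i j k l where ijkl: "q = (i, j, k, l)" by (cases q)
    have "(r + int i) + (r + int j) = (r + int k) + (r + int l)" using q ijkl by (simp add: quads_def)
    from product_expansion[OF this]
    show "of_nat p ^ 4 * (case q of (i, j, k, l) \<Rightarrow> s (r + int i) * s (r + int j) * s (r + int k) * s (r + int l)) =
      (\<Sum>a\<in>residues. \<Sum>b\<in>residues. \<Sum>c\<in>residues. ?f q a b c)"
      unfolding ijkl prod.case .
  qed
  also have "\<dots> = (\<Sum>a\<in>residues. \<Sum>q\<in>quads t. \<Sum>b\<in>residues. \<Sum>c\<in>residues. ?f q a b c)"
    by (rule sum.swap)
  also have "\<dots> = (\<Sum>a\<in>residues. \<Sum>b\<in>residues. \<Sum>q\<in>quads t. \<Sum>c\<in>residues. ?f q a b c)"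
    by (rule sum.cong[OF refl], rule sum.swap)
  also have "\<dots> = (\<Sum>a\<in>residues. \<Sum>b\<in>residues. \<Sum>c\<in>residues. \<Sum>q\<in>quads t. ?f q a b c)"
    by (rule sum.cong[OF refl], rule sum.cong[OF refl], rule sum.swap)
  finally show ?thesis unfolding quad_weight_def sum_distrib_right .
qed

text \<open>Replacing each correlation by its main term leaves the l1 norm of the weights times a
  uniform error. The extra error involving \<delta> occurs only at \<open>a = b = c = 0\<close>,
  where the weight is at most \<open>t^3\<close>.\<close>

theorem quad_sum_asymptotic:
  assumes M: "M > 0" and t: "2 * t \<le> p * M"
  shows "norm (quad_sum r t - of_real (real (quad_count p t r) - 2 * real (card (quads t)) / real p))
    \<le> 20000000 * real M ^ 3 * real p * sqrt (real p) * (3 + 2 * ln (real (p * M))) ^ 4 + \<delta>\<^sup>2 * real t ^ 3 / real p"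
proof -
  let ?W = "quad_weight p t r" and ?e = "\<lambda>a b c. shat_corr a b c - of_nat p ^ 3 * pairing_indicator a b c"
  define K where "K = 20000000 * (real p)\<^sup>2 * sqrt (real p)"
  define S where "S = (\<Sum>a\<in>residues. \<Sum>b\<in>residues. \<Sum>c\<in>residues. norm (?W a b c))"
  have K0: "K \<ge> 0" by (simp add: K_def)
  have 1: "of_nat p ^ 4 * (quad_sum r t - of_real (real (quad_count p t r) - 2 * real (card (quads t)) / real p)) =
    (\<Sum>a\<in>residues. \<Sum>b\<in>residues. \<Sum>c\<in>residues. ?W a b c * ?e a b c)"
  proof -
    have "(\<Sum>a\<in>residues. \<Sum>b\<in>residues. \<Sum>c\<in>residues. ?W a b c * ?e a b c) =
      (\<Sum>a\<in>residues. \<Sum>b\<in>residues. \<Sum>c\<in>residues. ?W a b c * shat_corr a b c) -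
      of_nat p ^ 3 * (\<Sum>a\<in>residues. \<Sum>b\<in>residues. \<Sum>c\<in>residues. ?W a b c * pairing_indicator a b c)"
      unfolding sum_distrib_left sum_subtractf[symmetric] by (intro sum.cong refl) (simp only: algebra_simps)
    also have "\<dots> = of_nat p ^ 4 * quad_sum r t - of_nat p ^ 3 * (of_nat p * of_nat (quad_count p t r) - 2 * of_nat (card (quads t)))"
      unfolding sum_quad_weight_pairing[OF p_pos] quad_sum_expansion[symmetric] ..
    finally have "(\<Sum>a\<in>residues. \<Sum>b\<in>residues. \<Sum>c\<in>residues. ?W a b c * ?e a b c) =
      of_nat p ^ 4 * quad_sum r t - of_nat p ^ 3 * (of_nat p * of_nat (quad_count p t r) - 2 * of_nat (card (quads t)))" .
    moreover have "of_nat p ^ 4 * (x - (A - 2 * B / of_nat p)) = of_nat p ^ 4 * x - of_nat p ^ 3 * (of_nat p * A - 2 * B)"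
      for x A B :: complex
      using p_pos by (simp add: field_simps power_eq_if)
    ultimately show ?thesis by simp
  qed
  have "norm (\<Sum>a\<in>residues. \<Sum>b\<in>residues. \<Sum>c\<in>residues. ?W a b c * ?e a b c) \<le>
    (\<Sum>a\<in>residues. \<Sum>b\<in>residues. \<Sum>c\<in>residues. norm (?W a b c) * K + (real t ^ 3 * (\<delta>\<^sup>2 * real p ^ 3)) * of_bool (a = 0 \<and> b = 0 \<and> c = 0))"
  proof (rule sum_norm_le, rule sum_norm_le, rule sum_norm_le)
    fix a b c assume abc: "a \<in> residues" "b \<in> residues" "c \<in> residues"
    have "norm (?W a b c * ?e a b c) \<le> norm (?W a b c) * (K + (\<delta>\<^sup>2 * real p ^ 3) * of_bool (a = 0 \<and> b = 0 \<and> c = 0))"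
      unfolding norm_mult K_def using shat_corr_bound[OF abc] by (intro mult_left_mono) (auto split: if_splits)
    also have "\<dots> = norm (?W a b c) * K + norm (?W a b c) * ((\<delta>\<^sup>2 * real p ^ 3) * of_bool (a = 0 \<and> b = 0 \<and> c = 0))"
      by (rule distrib_left)
    also have "norm (?W a b c) * ((\<delta>\<^sup>2 * real p ^ 3) * of_bool (a = 0 \<and> b = 0 \<and> c = 0)) \<le>
      real t ^ 3 * ((\<delta>\<^sup>2 * real p ^ 3) * of_bool (a = 0 \<and> b = 0 \<and> c = 0))"
      by (intro mult_right_mono norm_quad_weight_le_card) auto
    finally show "norm (?W a b c * ?e a b c) \<le> norm (?W a b c) * K + (real t ^ 3 * (\<delta>\<^sup>2 * real p ^ 3)) * of_bool (a = 0 \<and> b = 0 \<and> c = 0)"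
      by (simp only: mult.assoc)
  qed
  also have "\<dots> = S * K + (real t ^ 3 * (\<delta>\<^sup>2 * real p ^ 3))"
  proof -
    have "(\<Sum>a\<in>residues. \<Sum>b\<in>residues. \<Sum>c\<in>residues. (real t ^ 3 * (\<delta>\<^sup>2 * real p ^ 3)) * of_bool (a = 0 \<and> b = 0 \<and> c = 0))
      = real t ^ 3 * (\<delta>\<^sup>2 * real p ^ 3)"
      by (rule sum_triple_delta(4)[OF p_pos, of "\<lambda>_ _ _. real t ^ 3 * (\<delta>\<^sup>2 * real p ^ 3)"])
    then show ?thesis unfolding S_def sum_distrib_right sum.distrib by simp
  qed
  also have "S * K \<le> (real (p * M) ^ 3 * (3 + 2 * ln (real (p * M))) ^ 4) * K"
    unfolding S_def using sum_norm_quad_weight_le[OF p_pos M t, of r] K0 by (rule mult_right_mono)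
  finally have "real p ^ 4 * norm (quad_sum r t - of_real (real (quad_count p t r) - 2 * real (card (quads t)) / real p))
    \<le> (real (p * M) ^ 3 * (3 + 2 * ln (real (p * M))) ^ 4) * K + real t ^ 3 * (\<delta>\<^sup>2 * real p ^ 3)"
    unfolding 1[symmetric] by (simp add: norm_mult norm_power)
  also have "\<dots> = real p ^ 4 * (20000000 * real M ^ 3 * real p * sqrt (real p) * (3 + 2 * ln (real (p * M))) ^ 4 + \<delta>\<^sup>2 * real t ^ 3 / real p)"
    using p_pos unfolding K_def of_nat_mult power_mult_distrib by (simp add: field_simps power_eq_if)
  finally show ?thesis using p_pos by (simp add: mult_le_cancel_left_pos)
qed

end

section \<open>Counting quadruples\<close>

definition diff_pairs :: "nat \<Rightarrow> int \<Rightarrow> (nat \<times> nat) set" where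
  "diff_pairs t n = {(i, k). i < t \<and> k < t \<and> int i - int k = n}"

text \<open>Writing \<open>i + j = k + l\<close> as \<open>i - k = l - j\<close> decouples the
  quadruple into two pairs with the same difference. This serves both for the counts and for writing
  the fourth moment as a sum of squared autocorrelations.\<close>

lemma sum_quads_by_difference:
  fixes f :: "nat \<Rightarrow> nat \<Rightarrow> nat \<Rightarrow> nat \<Rightarrow> 'a :: comm_monoid_add"
  shows "(\<Sum>(i, j, k, l)\<in>quads t. f i j k l) =
    (\<Sum>n\<in>{- int t..int t}. \<Sum>(i, k)\<in>diff_pairs t n. \<Sum>(l, j)\<in>diff_pairs t n. f i j k l)"
proof -
  let ?g = "\<lambda>(i, j, k, l). int i - int k"
  have "(\<Sum>(i, j, k, l)\<in>quads t. f i j k l) =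
    (\<Sum>n\<in>{- int t..int t}. \<Sum>(i, j, k, l)\<in>{q \<in> quads t. ?g q = n}. f i j k l)"
    by (rule sum.group[OF finite_quads, symmetric]) (auto simp: quads_def)
  also have "\<dots> = (\<Sum>n\<in>{- int t..int t}. \<Sum>((i, k), (l, j))\<in>diff_pairs t n \<times> diff_pairs t n. f i j k l)"
  proof (rule sum.cong[OF refl])
    fix n
    show "(\<Sum>(i, j, k, l)\<in>{q \<in> quads t. ?g q = n}. f i j k l) =
      (\<Sum>((i, k), (l, j))\<in>diff_pairs t n \<times> diff_pairs t n. f i j k l)"
      by (rule sum.reindex_bij_witness[where i = "\<lambda>((i, k), (l, j)). (i, j, k, l)" and j = "\<lambda>(i, j, k, l). ((i, k), (l, j))"])
         (auto simp: quads_def diff_pairs_def)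
  qed
  also have "\<dots> = (\<Sum>n\<in>{- int t..int t}. \<Sum>(i, k)\<in>diff_pairs t n. \<Sum>(l, j)\<in>diff_pairs t n. f i j k l)"
    by (simp add: sum.cartesian_product case_prod_beta)
  finally show ?thesis .
qed

lemma card_diff_pairs: "card (diff_pairs t n) = nat (int t - \<bar>n\<bar>)"
proof (cases "n \<ge> 0")
  case True
  have "card (diff_pairs t n) = card {..<nat (int t - n)}"
    by (rule bij_betw_same_card[of snd], rule bij_betw_byWitness[where f' = "\<lambda>k. (k + nat n, k)"])
       (use True in \<open>auto simp: diff_pairs_def\<close>)
  then show ?thesis using True by simp
next
  case False
  have "card (diff_pairs t n) = card {..<nat (int t + n)}"
    by (rule bij_betw_same_card[of fst], rule bij_betw_byWitness[where f' = "\<lambda>i. (i, i + nat (- n))"])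
       (use False in \<open>auto simp: diff_pairs_def\<close>)
  then show ?thesis using False by simp
qed

definition tent :: "real \<Rightarrow> real" where
  "tent x = (max 0 (1 - \<bar>x\<bar>))\<^sup>2"

lemma real_card_square:
  assumes "t > 0"
  shows "(real (nat (int t - \<bar>n\<bar>)))\<^sup>2 = (real t)\<^sup>2 * tent (real_of_int n / real t)"
proof -
  have "real (nat (int t - \<bar>n\<bar>)) = max 0 (real t - \<bar>real_of_int n\<bar>)" by simp
  also have "\<dots> = real t * max 0 (1 - \<bar>real_of_int n / real t\<bar>)"
  proof -
    have "real t * max 0 (1 - \<bar>real_of_int n / real t\<bar>) = max (real t * 0) (real t * (1 - \<bar>real_of_int n / real t\<bar>))"
      using assms by (intro max_mult_distrib_left[THEN trans]) auto
    also have "real t * (1 - \<bar>real_of_int n / real t\<bar>) = real t - \<bar>real_of_int n\<bar>"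
      using assms by (simp add: right_diff_distrib abs_divide)
    finally show ?thesis by simp
  qed
  finally show ?thesis by (simp add: tent_def power_mult_distrib)
qed

lemma tent_eq_0: "\<bar>x\<bar> \<ge> 1 \<Longrightarrow> tent x = 0"
  by (simp add: tent_def)

lemma card_quads_filter:
  "card {(i, j, k, l) \<in> quads t. P i j k l} = (\<Sum>(i, j, k, l)\<in>quads t. of_bool (P i j k l))"
proof -
  have "(\<Sum>(i, j, k, l)\<in>quads t. of_bool (P i j k l)) = (\<Sum>q\<in>quads t. if (case q of (i, j, k, l) \<Rightarrow> P i j k l) then 1 else 0 :: nat)"
    by (intro sum.cong refl) (auto split: prod.split)
  also have "\<dots> = (\<Sum>q\<in>{q \<in> quads t. case q of (i, j, k, l) \<Rightarrow> P i j k l}. 1)"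
    by (rule sum.inter_filter[symmetric]) simp
  also have "{q \<in> quads t. case q of (i, j, k, l) \<Rightarrow> P i j k l} = {(i, j, k, l) \<in> quads t. P i j k l}" by auto
  finally show ?thesis by simp
qed

lemma card_quads_difference:
  assumes "t > 0"
  shows "real (card {(i, j, k, l) \<in> quads t. P (int l - int j)}) =
    (real t)\<^sup>2 * (\<Sum>n\<in>{n \<in> {- int t..int t}. P n}. tent (real_of_int n / real t))"
proof -
  have "real (card {(i, j, k, l) \<in> quads t. P (int l - int j)}) =
    (\<Sum>n\<in>{- int t..int t}. \<Sum>(i, k)\<in>diff_pairs t n. \<Sum>(l, j)\<in>diff_pairs t n. of_bool (P (int l - int j)))"
    unfolding card_quads_filter of_nat_sum case_prod_beta of_nat_of_bool
    using sum_quads_by_difference[of "\<lambda>i j k l. of_bool (P (int l - int j)) :: real" t]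
    by (simp add: case_prod_beta)
  also have "\<dots> = (\<Sum>n\<in>{- int t..int t}. if P n then (real t)\<^sup>2 * tent (real_of_int n / real t) else 0)"
  proof (rule sum.cong[OF refl])
    fix n
    have "(\<Sum>(l, j)\<in>diff_pairs t n. of_bool (P (int l - int j))) = (\<Sum>(l, j)\<in>diff_pairs t n. of_bool (P n) :: real)"
      by (intro sum.cong refl) (auto simp: diff_pairs_def)
    then have "(\<Sum>(i, k)\<in>diff_pairs t n. \<Sum>(l, j)\<in>diff_pairs t n. of_bool (P (int l - int j)) :: real) =
      of_bool (P n) * (real (card (diff_pairs t n)))\<^sup>2"
      by (simp add: case_prod_beta power2_eq_square)
    then show "(\<Sum>(i, k)\<in>diff_pairs t n. \<Sum>(l, j)\<in>diff_pairs t n. of_bool (P (int l - int j))) =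
      (if P n then (real t)\<^sup>2 * tent (real_of_int n / real t) else 0)"
      unfolding card_diff_pairs real_card_square[OF assms] by simp
  qed
  also have "\<dots> = (real t)\<^sup>2 * (\<Sum>n\<in>{n \<in> {- int t..int t}. P n}. tent (real_of_int n / real t))"
    by (subst sum.inter_filter) (simp_all add: sum_distrib_left if_distrib cong: if_cong)
  finally show ?thesis .
qed

text \<open>Reflecting two of the indices by \<open>t - 1\<close> preserves the additive relation
  and turns the sum \<open>k + l\<close> into a difference, at the price of the shift
  \<open>t - 1\<close>.\<close>

lemma card_quads_sum:
  "card {(i, j, k, l) \<in> quads t. P (int k + int l)} =
   card {(i, j, k, l) \<in> quads t. P (int l - int j + (int t - 1))}"
  by (rule bij_betw_same_card[of "\<lambda>(i, j, k, l). (i, t - 1 - l, t - 1 - j, k)"],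
      rule bij_betw_byWitness[where f' = "\<lambda>(i, j, k, l). (i, t - 1 - k, l, t - 1 - j)"])
     (auto simp: quads_def of_nat_diff algebra_simps)

lemma card_quads: "3 * card (quads t) = t * (2 * t ^ 2 + 1)"
proof -
  have "card (quads t) = (\<Sum>n\<in>{- int t..int t}. (nat (int t - \<bar>n\<bar>))\<^sup>2)"
    using sum_quads_by_difference[of "\<lambda>_ _ _ _. 1 :: nat" t]
    by (simp add: case_prod_beta card_diff_pairs power2_eq_square)
  also have "{- int t..int t} = {0} \<union> {1..int t} \<union> {- int t..-1}" by auto
  also have "(\<Sum>n\<in>\<dots>. (nat (int t - \<bar>n\<bar>))\<^sup>2) =
     t\<^sup>2 + (\<Sum>n\<in>{1..int t}. (nat (int t - n))\<^sup>2) + (\<Sum>n\<in>{- int t..-1}. (nat (int t + n))\<^sup>2)"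
    by (subst sum.union_disjoint; force?)+
  also have "(\<Sum>n\<in>{- int t..-1}. (nat (int t + n))\<^sup>2) = (\<Sum>n<t. n\<^sup>2)"
    by (rule sum.reindex_bij_witness[where i = "\<lambda>n. int n - int t" and j = "\<lambda>n. nat (int t + n)"]) auto
  also have "(\<Sum>n\<in>{1..int t}. (nat (int t - n))\<^sup>2) = (\<Sum>n<t. n\<^sup>2)"
    by (rule sum.reindex_bij_witness[where i = "\<lambda>n. int t - int n" and j = "\<lambda>n. nat (int t - n)"]) auto
  finally have "card (quads t) = t\<^sup>2 + 2 * (\<Sum>n<t. n\<^sup>2)" by simp
  moreover have "6 * (\<Sum>n<t. n\<^sup>2) + 3 * t\<^sup>2 = t * (2 * t\<^sup>2 + 1)"
    by (induction t) (simp_all add: algebra_simps power2_eq_square)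
  ultimately show ?thesis by simp
qed

text \<open>The multiples of \<open>p\<close> are parametrised by \<open>n + w = m * p\<close>. The
  summation range for \<open>m\<close> may be any large enough \<open>K\<close>; choosing it
  independently of \<open>p\<close> later permits a termwise limit.\<close>

lemma sum_tent_congruent:
  assumes p: "p > 0" and t: "t > 0" and K: "\<bar>real_of_int w\<bar> + real t \<le> real K * real p"
  shows "(\<Sum>n\<in>{n \<in> {- int t..int t}. int p dvd n + w}. tent (real_of_int n / real t)) =
    (\<Sum>m\<in>{- int K..int K}. tent ((real_of_int m * real p - real_of_int w) / real t))"
proof -
  have Kw: "\<bar>w\<bar> + int t \<le> int K * int p"
    using K by (metis (mono_tags, lifting) of_int_abs of_int_add of_int_le_iff of_int_mult of_int_of_nat_eq)
  have "(\<Sum>m\<in>{- int K..int K}. tent ((real_of_int m * real p - real_of_int w) / real t)) =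
    (\<Sum>m\<in>{m \<in> {- int K..int K}. \<bar>m * int p - w\<bar> \<le> int t}. tent ((real_of_int m * real p - real_of_int w) / real t))"
  proof (rule sum.mono_neutral_right)
    show "\<forall>m\<in>{- int K..int K} - {m \<in> {- int K..int K}. \<bar>m * int p - w\<bar> \<le> int t}.
      tent ((real_of_int m * real p - real_of_int w) / real t) = 0"
    proof
      fix m assume "m \<in> {- int K..int K} - {m \<in> {- int K..int K}. \<bar>m * int p - w\<bar> \<le> int t}"
      then have "int t \<le> \<bar>m * int p - w\<bar>" by auto
      then have "real_of_int (int t) \<le> real_of_int \<bar>m * int p - w\<bar>" by (simp only: of_int_le_iff)
      then have "real t \<le> \<bar>real_of_int m * real p - real_of_int w\<bar>" by simp
      then show "tent ((real_of_int m * real p - real_of_int w) / real t) = 0"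
        using t by (intro tent_eq_0) (simp add: abs_divide)
    qed
  qed auto
  also have "\<dots> = (\<Sum>n\<in>{n \<in> {- int t..int t}. int p dvd n + w}. tent (real_of_int n / real t))"
  proof (rule sum.reindex_bij_witness[where i = "\<lambda>n. (n + w) div int p" and j = "\<lambda>m. m * int p - w"])
    fix n assume n: "n \<in> {n \<in> {- int t..int t}. int p dvd n + w}"
    then have "int p dvd n + w" by simp
    then obtain m where m: "n + w = m * int p" by (metis dvdE mult.commute)
    have "\<bar>m\<bar> * int p = \<bar>n + w\<bar>" unfolding m by (simp add: abs_mult)
    also have "\<dots> \<le> int K * int p" using n Kw by auto
    finally have "\<bar>m\<bar> \<le> int K" using p by simp
    moreover have nm: "m * int p - w = n" using m by simp
    ultimately show "(n + w) div int p \<in> {m \<in> {- int K..int K}. \<bar>m * int p - w\<bar> \<le> int t}"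
      using n m p by auto
    show "(n + w) div int p * int p - w = n" unfolding m using nm p by simp
  qed (use p in auto)
  finally show ?thesis by simp
qed

section \<open>Limits of the normalised counts\<close>

lemma tendsto_tent [tendsto_intros]:
  "(f \<longlongrightarrow> l) F \<Longrightarrow> ((\<lambda>x. tent (f x)) \<longlongrightarrow> tent l) F"
  unfolding tent_def by (intro tendsto_intros)

lemma tent_minus [simp]: "tent (- x) = tent x"
  by (simp add: tent_def)

text \<open>Exchanging \<open>k\<close> and \<open>l\<close> identifies the first two pairings; the
  reflection of \<open>card_quads_sum\<close> brings the third to the same form with offset
  \<open>2 * r + t - 1\<close>.\<close>

lemma quad_count_eq:
  "real (quad_count p t r) = 2 * real (card {(i, j, k, l) \<in> quads t. int p dvd int l - int j + 0}) +
     real (card {(i, j, k, l) \<in> quads t. int p dvd int l - int j + (2 * r + int t - 1)})"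
proof -
  have "card {(i, j, k, l) \<in> quads t. int p dvd int k - int j} = card {(i, j, k, l) \<in> quads t. int p dvd int l - int j}"
    by (rule bij_betw_same_card[of "\<lambda>(i, j, k, l). (i, j, l, k)"],
        rule bij_betw_byWitness[where f' = "\<lambda>(i, j, k, l). (i, j, l, k)"])
       (auto simp: quads_def)
  then show ?thesis
    using card_quads_sum[of t "\<lambda>n. int p dvd 2 * r + n"] by (simp add: quad_count_def algebra_simps)
qed

text \<open>The limit of \<open>||f||_4^4 / ||f||_2^4\<close>, with the series truncated at a
  \<open>K\<close> beyond which all terms vanish.\<close>

definition tent_limit :: "nat \<Rightarrow> real \<Rightarrow> real \<Rightarrow> real" where
  "tent_limit K R T = 2 * (\<Sum>m\<in>{- int K..int K}. tent (real_of_int m / T)) +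
     (\<Sum>m\<in>{- int K..int K}. tent (1 + (2 * R - real_of_int m) / T)) - 4 * T / 3"

text \<open>After division by \<open>t^2\<close> the counts are finite sums of \<open>tent\<close>
  at points that converge. The summand \<open>- 4 * T / 3\<close> comes from the overlap of the
  pairings, as there are about \<open>2 * t^3 / 3\<close> additive quadruples.\<close>

lemma quad_count_tendsto:
  fixes F :: "nat filter"
  assumes F: "F \<le> at_top" and T: "T > 0"
    and r: "((\<lambda>p. real_of_int (r p) / real p) \<longlongrightarrow> R) F"
    and t: "((\<lambda>p. real (t p) / real p) \<longlongrightarrow> T) F"
    and K: "2 * \<bar>R\<bar> + 2 * T + 4 \<le> real K"
  shows "((\<lambda>p. (real (quad_count p (t p) (r p)) - 2 * real (card (quads (t p))) / real p) / (real (t p))\<^sup>2)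
    \<longlongrightarrow> tent_limit K R T) F"
proof -
  define g where "g p = 2 * (\<Sum>m\<in>{- int K..int K}. tent (real_of_int m / (real (t p) / real p))) +
     (\<Sum>m\<in>{- int K..int K}. tent ((real_of_int m - 2 * (real_of_int (r p) / real p) - real (t p) / real p + 1 / real p) / (real (t p) / real p)))
     - (2 / 3) * (2 * (real (t p) / real p) + (1 / real p) * (1 / real p) / (real (t p) / real p))" for p
  have inv: "((\<lambda>p. 1 / real p) \<longlongrightarrow> 0) F"
    using lim_1_over_n by (rule tendsto_mono[OF F])
  have "(g \<longlongrightarrow> 2 * (\<Sum>m\<in>{- int K..int K}. tent (real_of_int m / T)) +
     (\<Sum>m\<in>{- int K..int K}. tent ((real_of_int m - 2 * R - T + 0) / T))
     - (2 / 3) * (2 * T + 0 * 0 / T)) F"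
    unfolding g_def using T by (intro tendsto_intros r t inv) auto
  also have "2 * (\<Sum>m\<in>{- int K..int K}. tent (real_of_int m / T)) +
     (\<Sum>m\<in>{- int K..int K}. tent ((real_of_int m - 2 * R - T + 0) / T))
     - (2 / 3) * (2 * T + 0 * 0 / T) = tent_limit K R T"
  proof -
    have "tent ((real_of_int m - 2 * R - T + 0) / T) = tent (1 + (2 * R - real_of_int m) / T)" for m
    proof -
      have "(real_of_int m - 2 * R - T + 0) / T = - (1 + (2 * R - real_of_int m) / T)"
        using T by (simp add: field_simps)
      then show ?thesis by (simp only: tent_minus)
    qed
    then show ?thesis by (simp add: tent_limit_def)
  qed
  finally have lim: "(g \<longlongrightarrow> tent_limit K R T) F" .
  have ev_r: "eventually (\<lambda>p. \<bar>real_of_int (r p) / real p\<bar> < \<bar>R\<bar> + 1) F"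
    using tendsto_rabs[OF r] by (rule order_tendstoD(2)) simp
  have ev_t: "eventually (\<lambda>p. real (t p) / real p < T + 1) F" "eventually (\<lambda>p. real (t p) / real p > 0) F"
    using order_tendstoD[OF t] T by auto
  have ev: "eventually (\<lambda>p. g p = (real (quad_count p (t p) (r p)) - 2 * real (card (quads (t p))) / real p) / (real (t p))\<^sup>2) F"
    using ev_r ev_t
  proof eventually_elim
    case (elim p)
    have p: "p > 0" and tp: "t p > 0" using elim(3) by (auto simp: zero_less_divide_iff)
    have tT: "real (t p) \<le> (T + 1) * real p" using elim(2) p by (simp add: pos_divide_less_eq)
    have rR: "\<bar>real_of_int (r p)\<bar> \<le> (\<bar>R\<bar> + 1) * real p" using elim(1) p by (simp add: abs_divide pos_divide_less_eq)
    \<comment> \<open>The 4 in the condition on \<open>K\<close> is twice the slack 1 allowed in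
      each of the two limits \<open>R\<close> and \<open>T\<close>.\<close>
    have le: "2 * \<bar>real_of_int (r p)\<bar> + 2 * real (t p) \<le> real K * real p"
    proof -
      have "2 * \<bar>real_of_int (r p)\<bar> + 2 * real (t p) \<le> (2 * \<bar>R\<bar> + 2 * T + 4) * real p"
        using tT rR by (simp add: algebra_simps)
      also have "\<dots> \<le> real K * real p" using K by (intro mult_right_mono) auto
      finally show ?thesis .
    qed
    then have K1: "\<bar>real_of_int 0\<bar> + real (t p) \<le> real K * real p" by simp
    have "\<bar>real_of_int (2 * r p + int (t p) - 1)\<bar> \<le> 2 * \<bar>real_of_int (r p)\<bar> + real (t p)" using tp by simp
    then have K2: "\<bar>real_of_int (2 * r p + int (t p) - 1)\<bar> + real (t p) \<le> real K * real p" using le by linarith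
    have c: "real (card (quads (t p))) = real (t p) * (2 * (real (t p))\<^sup>2 + 1) / 3"
    proof -
      have "real (3 * card (quads (t p))) = real (t p * (2 * t p ^ 2 + 1))" by (simp only: card_quads)
      then have "3 * real (card (quads (t p))) = real (t p) * (2 * (real (t p))\<^sup>2 + 1)"
        by (simp only: of_nat_mult of_nat_add of_nat_power of_nat_numeral of_nat_1)
      then show ?thesis by linarith
    qed
    have "(real (quad_count p (t p) (r p)) - 2 * real (card (quads (t p))) / real p) / (real (t p))\<^sup>2 =
      2 * (\<Sum>m\<in>{- int K..int K}. tent ((real_of_int m * real p - real_of_int 0) / real (t p))) +
      (\<Sum>m\<in>{- int K..int K}. tent ((real_of_int m * real p - real_of_int (2 * r p + int (t p) - 1)) / real (t p)))
      - 2 * real (card (quads (t p))) / real p / (real (t p))\<^sup>2"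
      unfolding quad_count_eq card_quads_difference[OF tp, where P = "\<lambda>n. int p dvd n + 0"]
        card_quads_difference[OF tp, where P = "\<lambda>n. int p dvd n + (2 * r p + int (t p) - 1)"]
        sum_tent_congruent[OF p tp K1] sum_tent_congruent[OF p tp K2]
      using tp by (simp add: field_simps)
    also have "2 * real (card (quads (t p))) / real p / (real (t p))\<^sup>2 =
      (2 / 3) * (2 * (real (t p) / real p) + (1 / real p) * (1 / real p) / (real (t p) / real p))"
      unfolding c using p tp by (simp add: field_simps power2_eq_square)
    also have "(\<Sum>m\<in>{- int K..int K}. tent ((real_of_int m * real p - real_of_int 0) / real (t p))) =
      (\<Sum>m\<in>{- int K..int K}. tent (real_of_int m / (real (t p) / real p)))" by simp
    also have "(\<Sum>m\<in>{- int K..int K}. tent ((real_of_int m * real p - real_of_int (2 * r p + int (t p) - 1)) / real (t p))) =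
      (\<Sum>m\<in>{- int K..int K}. tent ((real_of_int m - 2 * (real_of_int (r p) / real p) - real (t p) / real p + 1 / real p) / (real (t p) / real p)))"
      using p tp by (intro sum.cong refl arg_cong[of _ _ tent]) (simp add: field_simps)
    finally show ?case by (simp add: g_def)
  qed
  show ?thesis using tendsto_cong[OF ev] lim by simp
qed

text \<open>The sum of \<open>tent (m / T)\<close> over all integers is 1 from \<open>m = 0\<close>
  plus twice the sum over positive \<open>m\<close>; doubled, it yields the 4 in \<phi> and a
  constant 2, of which one unit is subtracted again.\<close>

lemma phi_eq_tent_limit:
  assumes T: "T > 0" and K: "2 * \<bar>R\<bar> + 2 * T + 4 \<le> real K"
  shows "\<phi> 1 R T = 1 / (tent_limit K R T - 1)"
proof -
  have tent_m: "(max 0 (1 - real m / T))\<^sup>2 = tent (real m / T)" for m :: nat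
    using T by (simp add: tent_def)
  have "(\<Sum>\<^sub>\<infinity>m\<in>{1::nat..}. (max 0 (1 - real m / T))\<^sup>2) = (\<Sum>\<^sub>\<infinity>m\<in>{1..K}. tent (real m / T))"
    unfolding tent_m
  proof (rule infsum_cong_neutral)
    fix m assume "m \<in> {1::nat..} - {1..K}"
    then have "real m \<ge> T" using K T by auto
    then show "tent (real m / T) = 0" using T by (intro tent_eq_0) simp
  qed auto
  also have "\<dots> = (\<Sum>m\<in>{1..K}. tent (real m / T))" by simp
  finally have 1: "(\<Sum>\<^sub>\<infinity>m\<in>{1::nat..}. (max 0 (1 - real m / T))\<^sup>2) = (\<Sum>m\<in>{1..K}. tent (real m / T))" .
  have "(\<Sum>\<^sub>\<infinity>m\<in>(UNIV::int set). (max 0 (1 - \<bar>1 + (2 * R - of_int m) / T\<bar>))\<^sup>2) =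
    (\<Sum>\<^sub>\<infinity>m\<in>{- int K..int K}. tent (1 + (2 * R - of_int m) / T))"
    unfolding tent_def[symmetric]
  proof (rule infsum_cong_neutral)
    fix m assume "m \<in> UNIV - {- int K..int K}"
    then have m: "\<bar>real_of_int m\<bar> > real K" by auto
    have "T \<le> \<bar>T + (2 * R - real_of_int m)\<bar>" using m K T by linarith
    also have "T + (2 * R - real_of_int m) = T * (1 + (2 * R - real_of_int m) / T)" using T by (simp add: field_simps)
    finally have "T * 1 \<le> T * \<bar>1 + (2 * R - real_of_int m) / T\<bar>" using T by (simp add: abs_mult)
    then show "tent (1 + (2 * R - of_int m) / T) = 0" using T by (intro tent_eq_0) simp
  qed auto
  also have "\<dots> = (\<Sum>m\<in>{- int K..int K}. tent (1 + (2 * R - of_int m) / T))" by simp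
  finally have 2: "(\<Sum>\<^sub>\<infinity>m\<in>(UNIV::int set). (max 0 (1 - \<bar>1 + (2 * R - of_int m) / T\<bar>))\<^sup>2) =
    (\<Sum>m\<in>{- int K..int K}. tent (1 + (2 * R - of_int m) / T))" .
  have 3: "(\<Sum>m\<in>{- int K..int K}. tent (real_of_int m / T)) = 1 + 2 * (\<Sum>m\<in>{1..K}. tent (real m / T))"
  proof -
    have "{- int K..int K} = {0} \<union> {1..int K} \<union> {- int K..-1}" by auto
    then have "(\<Sum>m\<in>{- int K..int K}. tent (real_of_int m / T)) =
      tent 0 + (\<Sum>m\<in>{1..int K}. tent (real_of_int m / T)) + (\<Sum>m\<in>{- int K..-1}. tent (real_of_int m / T))"
      by (simp add: sum.union_disjoint)
    also have "(\<Sum>m\<in>{1..int K}. tent (real_of_int m / T)) = (\<Sum>m\<in>{1..K}. tent (real m / T))"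
      by (rule sum.reindex_bij_witness[where i = int and j = nat]) auto
    also have "(\<Sum>m\<in>{- int K..-1}. tent (real_of_int m / T)) = (\<Sum>m\<in>{1..K}. tent (real m / T))"
      by (rule sum.reindex_bij_witness[where i = "\<lambda>m. - int m" and j = "\<lambda>m. nat (- m)"]) auto
    finally show ?thesis by (simp add: tent_def)
  qed
  show ?thesis unfolding \<phi>_def 1 2 tent_limit_def 3 by (simp add: algebra_simps)
qed

text \<open>For \<open>T > 1\<close> the corresponding bound comes from the autocorrelations at shifts \<open>\<plusminus>p\<close>.\<close>

lemma tent_limit_gt_1:
  assumes T: "0 < T" "T \<le> 1" and K: "2 * \<bar>R\<bar> + 2 * T + 4 \<le> real K"
  shows "tent_limit K R T > 1"
proof -
  let ?h = "\<lambda>m :: int. tent (1 + (2 * R - real_of_int m) / T)"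
  \<comment> \<open>The second sum of \<open>tent_limit\<close> samples the tent of half-width
    \<open>T\<close> around \<open>c\<close> at the integers. The two integers next to
    \<open>c\<close> suffice for the bound.\<close>
  define c where "c = 2 * R + T"
  define n where "n = \<lfloor>c\<rfloor>"
  define x where "x = c - real_of_int n"
  have x: "0 \<le> x" "x < 1" unfolding x_def n_def by linarith+
  have h: "?h m = tent ((c - real_of_int m) / T)" for m
  proof -
    have "(c - real_of_int m) / T = 1 + (2 * R - real_of_int m) / T"
      using T by (simp add: c_def add_divide_distrib diff_divide_distrib)
    then show ?thesis by simp
  qed
  have n: "n \<in> {- int K..int K}" "n + 1 \<in> {- int K..int K}"
    using K T x unfolding x_def c_def by (auto simp: abs_le_iff)
  have "?h n + ?h (n + 1) = (\<Sum>m\<in>{n, n + 1}. ?h m)" by simp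
  also have "\<dots> \<le> (\<Sum>m\<in>{- int K..int K}. ?h m)"
    using n by (intro sum_mono2) (auto simp: tent_def)
  finally have B0: "?h n + ?h (n + 1) \<le> (\<Sum>m\<in>{- int K..int K}. ?h m)" .
  have B: "tent (x / T) + tent ((1 - x) / T) \<le> (\<Sum>m\<in>{- int K..int K}. ?h m)"
  proof -
    have "?h n = tent (x / T)" by (simp add: h x_def)
    moreover have "(c - real_of_int (n + 1)) / T = - (1 - x) / T"
      unfolding x_def by (rule arg_cong[of _ _ "\<lambda>u. u / T"]) simp
    then have "?h (n + 1) = tent (- ((1 - x) / T))" by (simp only: h minus_divide_left)
    ultimately show ?thesis using B0 by simp
  qed
  have A: "1 \<le> (\<Sum>m\<in>{- int K..int K}. tent (real_of_int m / T))"
  proof -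
    have "(\<Sum>m\<in>{0}. tent (real_of_int m / T)) \<le> (\<Sum>m\<in>{- int K..int K}. tent (real_of_int m / T))"
      by (intro sum_mono2) (auto simp: tent_def)
    then show ?thesis by (simp add: tent_def)
  qed
  have "tent (x / T) + tent ((1 - x) / T) > 4 * T / 3 - 1"
  \<comment> \<open>Below 3/4 the right-hand side is negative. From 3/4 on, \<open>2 - 1 / T\<close>
    is positive, so the inequality \<open>u + w >= 2 - 1 / T\<close> may be squared.\<close>
  proof (cases "T < 3 / 4")
    case True
    moreover have "tent (x / T) \<ge> 0" "tent ((1 - x) / T) \<ge> 0" by (simp_all add: tent_def)
    ultimately show ?thesis by linarith
  next
    case False
    define u w where "u = max 0 (1 - x / T)" and "w = max 0 (1 - (1 - x) / T)"
    have "x / T + (1 - x) / T = 1 / T" by (simp flip: add_divide_distrib)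
    moreover have "u \<ge> 1 - x / T" "w \<ge> 1 - (1 - x) / T" by (simp_all add: u_def w_def)
    ultimately have uw: "u + w \<ge> 2 - 1 / T" by linarith
    have T43: "1 / T \<le> 4 / 3" using T False by (simp add: field_simps)
    have "tent (x / T) + tent ((1 - x) / T) = u\<^sup>2 + w\<^sup>2"
      using x T by (simp add: tent_def u_def w_def)
    moreover have "u\<^sup>2 + w\<^sup>2 \<ge> (u + w)\<^sup>2 / 2"
      using zero_le_power2[of "u - w"] by (simp add: power2_eq_square algebra_simps)
    moreover have "(u + w)\<^sup>2 \<ge> (2 - 1 / T)\<^sup>2"
      using uw T43 by (intro power_mono) linarith+
    moreover have "(2 - 1 / T)\<^sup>2 / 2 > 4 * T / 3 - 1"
    proof -
      define z where "z = 1 / T"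
      have z: "1 \<le> z" "z \<le> 4 / 3" "T * z = 1" using T T43 by (auto simp: z_def)
      \<comment> \<open>A polynomial majorant of \<open>T = 1 / z\<close>: since
        \<open>z * (2 - z) + (z - 1)^2 = 1\<close> and \<open>T <= 1\<close>, one has
        \<open>T <= (2 - z) + (z - 1)^2\<close>. What remains is a quadratic inequality on
        \<open>1 <= z <= 4/3\<close>.\<close>
      have "4 * T / 3 \<le> 4 / 3 * (2 - z) + 4 / 3 * (z - 1)\<^sup>2"
      proof -
        have "T = T * (z * (2 - z)) + T * (z - 1)\<^sup>2" by (simp add: power2_eq_square algebra_simps)
        also have "T * (z * (2 - z)) = (T * z) * (2 - z)" by (simp only: mult.assoc)
        also have "T * (z - 1)\<^sup>2 \<le> 1 * (z - 1)\<^sup>2" using T by (intro mult_right_mono) auto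
        finally have le: "T \<le> (2 - z) + (z - 1)\<^sup>2" using z by simp
        have "4 * T / 3 = 4 / 3 * T" by simp
        also have "\<dots> \<le> 4 / 3 * ((2 - z) + (z - 1)\<^sup>2)" using le by (intro mult_left_mono) auto
        also have "\<dots> = 4 / 3 * (2 - z) + 4 / 3 * (z - 1)\<^sup>2" by (rule distrib_left)
        finally show ?thesis .
      qed
      moreover have "4 / 3 * (2 - z) + 4 / 3 * (z - 1)\<^sup>2 - 1 < (2 - z)\<^sup>2 / 2"
      proof -
        have "(z - 1) * (3 * z - 4) \<le> 0" using z by (intro mult_nonneg_nonpos) auto
        then have zz: "3 * (z * z) \<le> 7 * z - 4" by (simp add: algebra_simps)
        have "(2 - z)\<^sup>2 / 2 - (4 / 3 * (2 - z) + 4 / 3 * (z - 1)\<^sup>2 - 1) = 2 * z - 1 - 5 / 6 * (z * z)"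
          by (simp add: power2_eq_square algebra_simps) (simp add: field_simps)
        then show ?thesis using zz z by linarith
      qed
      ultimately have "4 * T / 3 - 1 < (2 - z)\<^sup>2 / 2" by linarith
      then show ?thesis unfolding z_def .
    qed
    ultimately show ?thesis by linarith
  qed
  then show ?thesis using A B unfolding tent_limit_def by linarith
qed

section \<open>Norms of polynomials with coefficients \<open>\<plusminus>1\<close>\<close>

lemma has_integral_exp_ii_int:
  "((\<lambda>\<theta>. exp (\<i> * of_int n * of_real \<theta>)) has_integral (if n = 0 then of_real (2 * pi) else 0)) {0..2 * pi}"
proof (cases "n = 0")
  case True
  then show ?thesis using has_integral_const_real[of "1 :: complex" 0 "2 * pi"] by (simp add: scaleR_conv_of_real)
next
  case False
  define G where "G z = exp (\<i> * of_int n * z) / (\<i> * of_int n)" for z :: complex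
  have "((\<lambda>\<theta>. exp (\<i> * of_int n * of_real \<theta>)) has_integral (G (of_real (2 * pi)) - G (of_real 0))) {0..2 * pi}"
  proof (rule fundamental_theorem_of_calculus)
    fix x :: real
    have "(G has_field_derivative exp (\<i> * of_int n * of_real x)) (at (of_real x))"
      unfolding G_def using False by (auto intro!: derivative_eq_intros)
    then show "((\<lambda>x. G (of_real x)) has_vector_derivative exp (\<i> * of_int n * of_real x)) (at x within {0..2 * pi})"
      by (rule has_vector_derivative_real_field)
  qed simp
  moreover have "exp (\<i> * of_int n * of_real (2 * pi)) = 1"
  proof -
    have "\<i> * of_int n * of_real (2 * pi) = \<i> * of_real (2 * pi * of_int n)" by simp
    then have "exp (\<i> * of_int n * of_real (2 * pi)) = cis (2 * pi * of_int n)" by (simp only: cis_conv_exp)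
    then show ?thesis by (simp add: cis_multiple_2pi)
  qed
  ultimately show ?thesis using False by (simp add: G_def)
qed

lemma of_real_norm_square: "(complex_of_real (norm z))\<^sup>2 = z * cnj z"
  by (simp only: of_real_power[symmetric] complex_norm_square)

definition sign_poly :: "nat \<Rightarrow> (nat \<Rightarrow> complex) \<Rightarrow> complex poly" where
  "sign_poly t c = (\<Sum>j<t. Polynomial.monom (c j) j)"

lemma poly_sign_poly: "poly (sign_poly t c) (exp (\<i> * of_real \<theta>)) = (\<Sum>j<t. c j * exp (\<i> * of_nat j * of_real \<theta>))"
  by (simp add: sign_poly_def poly_sum poly_monom mult_ac flip: exp_of_nat_mult)

lemma has_integral_sign_poly_2:
  assumes c: "\<And>j. c j = 1 \<or> c j = - 1"
  shows "((\<lambda>\<theta>. norm (poly (sign_poly t c) (exp (\<i> * of_real \<theta>))) ^ 2) has_integral (2 * pi * real t)) {0..2 * pi}"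
proof -
  have cc: "cnj (c j) = c j" "c j * c j = 1" for j using c[of j] by auto
  let ?S = "{..<t} \<times> {..<t}"
  have eq: "complex_of_real (norm (poly (sign_poly t c) (exp (\<i> * of_real \<theta>))) ^ 2) =
    (\<Sum>(i, j)\<in>?S. c i * c j * exp (\<i> * of_int (int i - int j) * of_real \<theta>))" for \<theta>
  proof -
    have "complex_of_real (norm (poly (sign_poly t c) (exp (\<i> * of_real \<theta>))) ^ 2) =
      (\<Sum>i<t. c i * exp (\<i> * of_nat i * of_real \<theta>)) * (\<Sum>j<t. c j * exp (- (\<i> * of_nat j * of_real \<theta>)))"
      by (simp add: of_real_norm_square poly_sign_poly cc exp_cnj)
    also have "\<dots> = (\<Sum>(i, j)\<in>?S. c i * c j * exp (\<i> * of_int (int i - int j) * of_real \<theta>))"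
      unfolding sum_product sum.cartesian_product
      by (intro sum.cong refl) (auto simp: exp_diff exp_minus algebra_simps divide_inverse)
    finally show ?thesis .
  qed
  have "((\<lambda>\<theta>. \<Sum>(i, j)\<in>?S. c i * c j * exp (\<i> * of_int (int i - int j) * of_real \<theta>)) has_integral
    (\<Sum>(i, j)\<in>?S. c i * c j * (if int i - int j = 0 then of_real (2 * pi) else 0))) {0..2 * pi}"
    unfolding case_prod_beta by (intro has_integral_sum finite_cartesian_product finite_lessThan has_integral_mult_right has_integral_exp_ii_int)
  also have "(\<Sum>(i, j)\<in>?S. c i * c j * (if int i - int j = 0 then of_real (2 * pi) else 0)) =
    (\<Sum>i<t. \<Sum>j<t. if j = i then c i * c i * of_real (2 * pi) else 0)"
    unfolding sum.cartesian_product by (intro sum.cong refl) auto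
  also have "\<dots> = of_real (2 * pi * real t)" by (simp add: cc)
  finally have "((\<lambda>\<theta>. complex_of_real (norm (poly (sign_poly t c) (exp (\<i> * of_real \<theta>))) ^ 2)) has_integral of_real (2 * pi * real t)) {0..2 * pi}"
    unfolding eq .
  from has_integral_linear[OF this bounded_linear_Re] show ?thesis by (simp add: o_def)
qed

lemma has_integral_sign_poly_4:
  assumes c: "\<And>j. c j = 1 \<or> c j = - 1"
  shows "((\<lambda>\<theta>. norm (poly (sign_poly t c) (exp (\<i> * of_real \<theta>))) ^ 4) has_integral
    (2 * pi * Re (\<Sum>(i, j, k, l)\<in>quads t. c i * c j * c k * c l))) {0..2 * pi}"
proof -
  have cc: "cnj (c j) = c j" for j using c[of j] by auto
  let ?S = "{..<t} \<times> {..<t} \<times> {..<t} \<times> {..<t}"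
  let ?e = "\<lambda>n \<theta>. exp (\<i> * of_int n * of_real \<theta>)"
  have eq: "complex_of_real (norm (poly (sign_poly t c) (exp (\<i> * of_real \<theta>))) ^ 4) =
    (\<Sum>(i, j, k, l)\<in>?S. c i * c j * c k * c l * ?e (int i + int j - int k - int l) \<theta>)" for \<theta>
  proof -
    define z where "z = poly (sign_poly t c) (exp (\<i> * of_real \<theta>))"
    have z: "z = (\<Sum>i<t. c i * ?e (int i) \<theta>)" by (simp add: z_def poly_sign_poly)
    have z': "cnj z = (\<Sum>i<t. c i * ?e (- int i) \<theta>)" by (simp add: z cc exp_cnj)
    have "complex_of_real (norm z ^ 4) = ((complex_of_real (norm z))\<^sup>2)\<^sup>2" by (simp flip: power_mult)
    also have "\<dots> = z * z * cnj z * cnj z"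
      unfolding of_real_norm_square by (simp add: power2_eq_square mult_ac)
    also have "\<dots> = (\<Sum>(i, j, k, l)\<in>?S. (c i * ?e (int i) \<theta>) * (c j * ?e (int j) \<theta>) * (c k * ?e (- int k) \<theta>) * (c l * ?e (- int l) \<theta>))"
      unfolding z' unfolding z by (rule prod4_sum)
    also have "\<dots> = (\<Sum>(i, j, k, l)\<in>?S. c i * c j * c k * c l * ?e (int i + int j - int k - int l) \<theta>)"
    proof (intro sum.cong refl, clarify)
      fix i j k l :: nat
      have "\<i> * of_int (int i + int j - int k - int l) * of_real \<theta> = \<i> * of_int (int i) * of_real \<theta> + \<i> * of_int (int j) * of_real \<theta>
        + \<i> * of_int (- int k) * of_real \<theta> + \<i> * of_int (- int l) * of_real \<theta>" by (simp add: algebra_simps)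
      then have "?e (int i + int j - int k - int l) \<theta> = ?e (int i) \<theta> * ?e (int j) \<theta> * ?e (- int k) \<theta> * ?e (- int l) \<theta>"
        by (simp only: exp_add)
      then show "(c i * ?e (int i) \<theta>) * (c j * ?e (int j) \<theta>) * (c k * ?e (- int k) \<theta>) * (c l * ?e (- int l) \<theta>) =
        c i * c j * c k * c l * ?e (int i + int j - int k - int l) \<theta>" by (simp only: mult_ac)
    qed
    finally show ?thesis by (simp only: z_def)
  qed
  have "((\<lambda>\<theta>. \<Sum>(i, j, k, l)\<in>?S. c i * c j * c k * c l * ?e (int i + int j - int k - int l) \<theta>) has_integral
    (\<Sum>(i, j, k, l)\<in>?S. c i * c j * c k * c l * (if int i + int j - int k - int l = 0 then of_real (2 * pi) else 0))) {0..2 * pi}"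
    unfolding case_prod_beta by (intro has_integral_sum finite_cartesian_product finite_lessThan has_integral_mult_right has_integral_exp_ii_int)
  also have "(\<Sum>(i, j, k, l)\<in>?S. c i * c j * c k * c l * (if int i + int j - int k - int l = 0 then of_real (2 * pi) else 0)) =
    (\<Sum>q\<in>?S. if fst q + fst (snd q) = fst (snd (snd q)) + snd (snd (snd q))
      then (case q of (i, j, k, l) \<Rightarrow> c i * c j * c k * c l) * of_real (2 * pi) else 0)"
    by (intro sum.cong refl) auto
  also have "\<dots> = (\<Sum>q\<in>quads t. (case q of (i, j, k, l) \<Rightarrow> c i * c j * c k * c l) * of_real (2 * pi))"
    unfolding quads_altdef by (rule sum.inter_filter[symmetric]) simp
  also have "\<dots> = of_real (2 * pi) * (\<Sum>(i, j, k, l)\<in>quads t. c i * c j * c k * c l)"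
    unfolding sum_distrib_right[symmetric] by (rule mult.commute)
  finally have "((\<lambda>\<theta>. complex_of_real (norm (poly (sign_poly t c) (exp (\<i> * of_real \<theta>))) ^ 4)) has_integral
     of_real (2 * pi) * (\<Sum>(i, j, k, l)\<in>quads t. c i * c j * c k * c l)) {0..2 * pi}"
    unfolding eq .
  from has_integral_linear[OF this bounded_linear_Re] show ?thesis by (simp add: o_def)
qed

lemma norm_powr_numeral: "norm (z :: complex) powr numeral n = norm z ^ numeral n"
  by (cases "z = 0") (simp_all add: powr_numeral)

text \<open>The squared 2-norm is \<open>t\<close> since every coefficient is a sign; the fourth
  power of the 4-norm is the sum over additive quadruples. With the convention for division by 0 the
  identity also covers a vanishing denominator.\<close>

lemma merit_factor_sign_poly:
  assumes c: "\<And>j. c j = 1 \<or> c j = - 1"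
  shows "merit_factor (sign_poly t c) =
    (real t)\<^sup>2 / (Re (\<Sum>(i, j, k, l)\<in>quads t. c i * c j * c k * c l) - (real t)\<^sup>2)"
proof -
  let ?Q = "Re (\<Sum>(i, j, k, l)\<in>quads t. c i * c j * c k * c l)"
  have 2: "integral {0..2 * pi} (\<lambda>\<theta>. norm (poly (sign_poly t c) (exp (\<i> * of_real \<theta>))) ^ 2) = 2 * pi * real t"
    by (rule integral_unique[OF has_integral_sign_poly_2[OF c]])
  have 4: "integral {0..2 * pi} (\<lambda>\<theta>. norm (poly (sign_poly t c) (exp (\<i> * of_real \<theta>))) ^ 4) = 2 * pi * ?Q"
    by (rule integral_unique[OF has_integral_sign_poly_4[OF c]])
  have "2 * pi * ?Q \<ge> 0"
    by (rule has_integral_nonneg[OF has_integral_sign_poly_4[OF c]]) auto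
  then have Q: "?Q \<ge> 0" using pi_gt_zero by (simp add: zero_le_mult_iff)
  have "poly_norm 2 (sign_poly t c) = real t powr (1 / 2)"
    unfolding poly_norm_def norm_powr_numeral 2 by simp
  then have n2: "poly_norm 2 (sign_poly t c) ^ 4 = (real t)\<^sup>2"
    by (cases "t = 0") (simp_all add: powr_half_sqrt power4_eq_xxxx power2_eq_square)
  have "poly_norm 4 (sign_poly t c) = ?Q powr (1 / 4)"
    unfolding poly_norm_def norm_powr_numeral 4 by simp
  then have n4: "poly_norm 4 (sign_poly t c) ^ 4 = ?Q"
    using Q by (cases "?Q = 0") (simp_all add: powr_powr flip: powr_numeral)
  show ?thesis unfolding merit_factor_def n2 n4 ..
qed

section \<open>Unions of two quartic cyclotomic classes\<close>

text \<open>Two roots that are neither equal nor opposite are orthogonal as real vectors. Hence the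
  real part of \<open>cnj (u + u') * z\<close> is \<open>1 + 0\<close> at \<open>u\<close> and
  \<open>u'\<close>, and -1 at their negatives.\<close>

lemma indicator_adjacent_fourth_roots:
  assumes "u \<in> {1, \<i>, - 1, - \<i>}" "u' \<in> {1, \<i>, - 1, - \<i>}" "z \<in> {1, \<i>, - 1, - \<i>}"
    and "u \<noteq> u'" "u' \<noteq> - u"
  shows "(if z = u \<or> z = u' then 1 else - 1) = cnj (u + u') / 2 * z + cnj (cnj (u + u') / 2 * z)"
    and "(cnj (u + u') / 2) ^ 2 = \<i> / 2 \<or> (cnj (u + u') / 2) ^ 2 = - \<i> / 2"
  using assms by (elim insertE emptyE; simp add: complex_eq_iff power2_eq_square)+

context quartic_character begin

lemma cnj_chi_pow_3: "cnj (chi x) ^ 3 = chi x"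
  using arg_cong[OF chi_pow_3[of x], of cnj] by simp

lemma sum_residues_delta_0: "(\<Sum>j\<in>residues. (if j = 0 then g j else 0) :: complex) = g 0"
  using p_pos by (subst sum.delta) auto

text \<open>With \<open>w k = a * gauss 1 * cnj (chi k)\<close> the transform is
  \<open>w + sg * cnj w\<close> up to the summand \<open>- 1\<close>, hence that part is real or
  purely imaginary. As \<open>|w|^2 = p / 2\<close> for \<open>k\<close> prime to \<open>p\<close>,
  the cross term of its square is \<open>sg * p\<close>, and \<open>2 * Re (w^2)\<close> is the
  perturbation. Because \<open>a^2\<close> is \<open>\<i> / 2\<close> up to sign, the latter is
  governed by the imaginary part of \<open>gauss 1 ^ 2\<close>, that is, by
  \<open>y\<close>.\<close>

lemma flat_sequence_quartic:
  assumes a: "a ^ 2 = \<i> / 2 \<or> a ^ 2 = - \<i> / 2"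
    and s: "\<And>j. \<not> int p dvd j \<Longrightarrow> s j = a * chi j + cnj (a * chi j)" "\<And>j. int p dvd j \<Longrightarrow> s j = - 1"
    and s_cong: "\<And>i j. [i = j] (mod int p) \<Longrightarrow> s i = s j"
    and s_cases: "\<And>j. s j = 1 \<or> s j = - 1"
    and xy: "int p = x\<^sup>2 + 4 * y\<^sup>2"
  shows "\<exists>H \<alpha> \<sigma> \<delta>. flat_sequence p \<omega> s H \<alpha> \<sigma> \<delta> \<and> \<delta>\<^sup>2 \<le> 4 * (real_of_int y)\<^sup>2 / real p"
proof -
  define q where "q = complex_of_real (sqrt (real p))"
  have q: "q * q = of_nat p" "cnj q = q" "q \<noteq> 0" using p_pos by (simp_all add: q_def flip: of_real_mult)
  define w where "w k = a * gauss 1 * cnj (chi k)" for k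
  define H where "H k = (w k + sg * cnj (w k)) / q" for k
  define \<alpha> where "\<alpha> e = (if e = 1 then sg * cnj (a * gauss 1) / q else if e = 3 then a * gauss 1 / q else 0)" for e :: nat
  define \<delta> where "\<delta> = 2 * Re sg * Re (a\<^sup>2 * gauss 1 ^ 2) / real p"
  have na: "norm a ^ 2 = 1 / 2"
  proof -
    have "a ^ 2 \<in> {\<i> / 2, - \<i> / 2}" using a by simp
    then have "norm (a ^ 2) = 1 / 2"
      by (elim insertE emptyE; simp only:) (simp_all add: norm_divide)
    then show ?thesis by (simp add: norm_power)
  qed
  have naG: "norm (a * gauss 1) ^ 2 = real p / 2"
    using na norm_gauss[of 1] by (simp add: norm_mult power_mult_distrib)
  have \<delta>2: "\<delta>\<^sup>2 = 4 * (real_of_int y)\<^sup>2 / real p"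
  proof -
    have sg1: "(Re sg)\<^sup>2 = 1" using sg_cases by auto
    have Re: "Re (a\<^sup>2 * g) \<in> {Im g / 2, - Im g / 2}" for g
      using a by (elim disjE; simp only:) simp_all
    from Re[of "gauss 1 ^ 2"] have "(Re (a\<^sup>2 * gauss 1 ^ 2))\<^sup>2 = (Im (gauss 1 ^ 2))\<^sup>2 / 4"
      by (elim insertE emptyE; simp only: power_divide power2_minus) simp_all
    with sg1 have "\<delta>\<^sup>2 = (Im (gauss 1 ^ 2))\<^sup>2 / (real p)\<^sup>2"
      by (simp add: \<delta>_def power_mult_distrib power_divide)
    then show ?thesis unfolding Im_gauss_1_square[OF xy] using p_pos by (simp add: power2_eq_square)
  qed
  have sg2: "sg * (sg * z) = z" for z by (simp flip: mult.assoc)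
  have "flat_sequence p \<omega> s H \<alpha> sg \<delta>"
  proof (rule flat_sequence.intro[OF quartic_character_axioms], rule flat_sequence_axioms.intro)
    show "(\<Sum>j\<in>{0..<int p}. s j * add_char p (j * k)) = - 1 + of_real (sqrt (real p)) * H k" for k
    proof -
      have "(\<Sum>j\<in>residues. s j * add_char p (j * k)) =
        (\<Sum>j\<in>residues. a * (chi j ^ 1 * add_char p (j * k)) + cnj a * (chi j ^ 3 * add_char p (j * k)) + (if j = 0 then - 1 else 0))"
      proof (intro sum.cong refl)
        fix j assume j: "j \<in> residues"
        show "s j * add_char p (j * k) = a * (chi j ^ 1 * add_char p (j * k)) + cnj a * (chi j ^ 3 * add_char p (j * k)) + (if j = 0 then - 1 else 0)"
        proof (cases "j = 0")
          case True
          then show ?thesis using s(2)[of j] by (simp add: chi_eq_0_iff[THEN iffD2])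
        next
          case False
          then have "\<not> int p dvd j" using j dvd_residue_iff by blast
          then show ?thesis using False by (simp add: s(1) chi_pow_3 algebra_simps)
        qed
      qed
      also have "\<dots> = a * (\<Sum>j\<in>residues. chi j ^ 1 * add_char p (j * k)) + cnj a * (\<Sum>j\<in>residues. chi j ^ 3 * add_char p (j * k)) - 1"
        unfolding sum.distrib sum_distrib_left sum_residues_delta_0 by simp
      also have "\<dots> = w k + sg * cnj (w k) - 1"
      proof -
        have "(\<Sum>j\<in>residues. chi j ^ 1 * add_char p (j * k)) = cnj (chi k) * gauss 1"
          using gauss_twist[of 1 k] by simp
        moreover have "(\<Sum>j\<in>residues. chi j ^ 3 * add_char p (j * k)) = chi k * (sg * cnj (gauss 1))"
          using gauss_twist[of 3 k] by (simp add: cnj_chi_pow_3 gauss_3)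
        ultimately show ?thesis by (simp add: w_def mult_ac)
      qed
      also have "\<dots> = - 1 + q * H k" using q(3) by (simp add: H_def)
      finally show ?thesis by (simp add: q_def)
    qed
    show "H k = (\<Sum>e\<in>{1..3}. \<alpha> e * chi k ^ e)" for k
    proof -
      have "{1..3::nat} = {1, 2, 3}" by auto
      then show ?thesis by (simp add: H_def \<alpha>_def w_def chi_pow_3 add_divide_distrib mult_ac)
    qed
    show "norm (\<alpha> e) \<le> 1" for e
    proof -
      have "norm (a * gauss 1) ^ 2 \<le> sqrt (real p) ^ 2" unfolding naG by simp
      then have "norm (a * gauss 1) \<le> sqrt (real p)" by (rule power2_le_imp_le) simp
      then have "norm (a * gauss 1) / sqrt (real p) \<le> 1" using p_pos by simp
      then show ?thesis by (auto simp: \<alpha>_def q_def norm_divide norm_mult)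
    qed
    show "cnj (H k) = sg * H k" for k
      by (simp add: H_def q(2) sg2 distrib_left add.commute)
    show "H k ^ 2 = sg * (1 + of_real \<delta> * chi k ^ 2)" if k: "\<not> int p dvd k" for k
    proof -
      have nw: "w k * cnj (w k) = of_nat p / 2"
      proof -
        have "w k * cnj (w k) = of_real ((norm (w k))\<^sup>2)" by (simp only: complex_norm_square)
        also have "(norm (w k))\<^sup>2 = norm (a * gauss 1) ^ 2" using k by (simp add: w_def norm_mult norm_chi)
        also note naG
        finally show ?thesis by simp
      qed
      have ws: "w k ^ 2 = (a\<^sup>2 * gauss 1 ^ 2) * chi k ^ 2"
        unfolding w_def power_mult_distrib cnj_chi_square ..
      have "q ^ 2 * H k ^ 2 = (w k + sg * cnj (w k)) ^ 2" using q(3) by (simp add: H_def power_divide)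
      also have "\<dots> = w k ^ 2 + cnj (w k) ^ 2 + 2 * sg * (w k * cnj (w k))"
        using sg_cases by (auto simp: power2_eq_square algebra_simps)
      also have "\<dots> = (a\<^sup>2 * gauss 1 ^ 2 + cnj (a\<^sup>2 * gauss 1 ^ 2)) * chi k ^ 2 + sg * of_nat p"
      proof -
        have "cnj (w k) ^ 2 = cnj (w k ^ 2)" by simp
        also have "\<dots> = cnj (a\<^sup>2 * gauss 1 ^ 2) * chi k ^ 2"
          unfolding ws using cnj_chi_square[of k] by simp
        finally show ?thesis unfolding nw ws by (simp add: algebra_simps)
      qed
      also have "a\<^sup>2 * gauss 1 ^ 2 + cnj (a\<^sup>2 * gauss 1 ^ 2) = of_real (2 * Re (a\<^sup>2 * gauss 1 ^ 2))"
        by (rule complex_add_cnj)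
      also have "of_real (2 * Re (a\<^sup>2 * gauss 1 ^ 2)) * chi k ^ 2 + sg * of_nat p =
        of_nat p * (sg * (1 + of_real \<delta> * chi k ^ 2))"
      proof -
        have "sg = of_real (Re sg)" using sg_cases by auto
        then have 1: "sg * of_real (Re sg) = 1" using sg_simps(2) by metis
        have "real p * (2 * A * B / real p) = A * (2 * B)" for A B using p_pos by simp
        then have "real p * \<delta> = Re sg * (2 * Re (a\<^sup>2 * gauss 1 ^ 2))" unfolding \<delta>_def .
        then have 2: "of_nat p * of_real \<delta> = of_real (Re sg) * (of_real (2 * Re (a\<^sup>2 * gauss 1 ^ 2)) :: complex)"
          by (metis of_real_mult of_real_of_nat_eq)
        have "of_nat p * (sg * (1 + of_real \<delta> * chi k ^ 2)) = sg * (of_nat p * of_real \<delta>) * chi k ^ 2 + sg * of_nat p"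
          by (simp add: algebra_simps)
        also have "\<dots> = (sg * of_real (Re sg)) * of_real (2 * Re (a\<^sup>2 * gauss 1 ^ 2)) * chi k ^ 2 + sg * of_nat p"
          unfolding 2 by (simp only: mult.assoc)
        finally show ?thesis unfolding 1 mult_1 by (rule sym)
      qed
      finally have "of_nat p * H k ^ 2 = of_nat p * (sg * (1 + of_real \<delta> * chi k ^ 2))"
        using q(1) by (simp add: power2_eq_square)
      then show ?thesis using p_pos by simp
    qed
    show "\<bar>\<delta>\<bar> \<le> 1"
    proof -
      have "real p = real_of_int (x\<^sup>2 + 4 * y\<^sup>2)" using xy by (metis of_int_of_nat_eq)
      then have "4 * (real_of_int y)\<^sup>2 \<le> real p" by simp
      then have "\<delta>\<^sup>2 \<le> 1" unfolding \<delta>2 using p_pos by simp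
      then show ?thesis by (simp add: abs_square_le_1)
    qed
  qed (use s_cong s_cases sg_cases in blast)+
  then show ?thesis using \<delta>2 by (metis order_refl)
qed

text \<open>Two opposite classes form the nonzero squares or the nonsquares. The quadratic Gauss sum
  over \<open>sqrt p\<close> is a sign, so \<open>H\<close> is real with \<open>H^2 = 1\<close> off
  the multiples of \<open>p\<close>; thus \<delta> = 0.\<close>

lemma flat_sequence_quadratic:
  assumes \<epsilon>: "\<epsilon> = 1 \<or> \<epsilon> = - 1"
    and s: "\<And>j. \<not> int p dvd j \<Longrightarrow> s j = \<epsilon> * chi j ^ 2" "\<And>j. int p dvd j \<Longrightarrow> s j = - 1"
    and s_cong: "\<And>i j. [i = j] (mod int p) \<Longrightarrow> s i = s j"
    and s_cases: "\<And>j. s j = 1 \<or> s j = - 1"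
  shows "\<exists>H \<alpha> \<sigma> \<delta>. flat_sequence p \<omega> s H \<alpha> \<sigma> \<delta> \<and> \<delta>\<^sup>2 \<le> 4 * (real_of_int y)\<^sup>2 / real p"
proof -
  define q where "q = complex_of_real (sqrt (real p))"
  have q: "q * q = of_nat p" "cnj q = q" "q \<noteq> 0" using p_pos by (simp_all add: q_def flip: of_real_mult)
  define \<gamma> where "\<gamma> = \<epsilon> * gauss 2 / q"
  have \<gamma>2: "\<gamma> ^ 2 = 1"
  proof -
    have "\<gamma> ^ 2 = \<epsilon> ^ 2 * gauss 2 ^ 2 / (q * q)" by (simp add: \<gamma>_def power_divide power_mult_distrib power2_eq_square)
    also have "\<dots> = 1" unfolding gauss_2_square q(1) using \<epsilon> p_pos by auto
    finally show ?thesis .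
  qed
  then have \<gamma>: "\<gamma> = 1 \<or> \<gamma> = - 1" by (simp add: power2_eq_1_iff)
  define H where "H k = \<gamma> * chi k ^ 2" for k
  define \<alpha> where "\<alpha> e = (if e = 2 then \<gamma> else 0)" for e :: nat
  have "flat_sequence p \<omega> s H \<alpha> 1 0"
  proof (rule flat_sequence.intro[OF quartic_character_axioms], rule flat_sequence_axioms.intro)
    show "(\<Sum>j\<in>{0..<int p}. s j * add_char p (j * k)) = - 1 + of_real (sqrt (real p)) * H k" for k
    proof -
      have "(\<Sum>j\<in>residues. s j * add_char p (j * k)) =
        (\<Sum>j\<in>residues. \<epsilon> * (chi j ^ 2 * add_char p (j * k)) + (if j = 0 then - 1 else 0))"
      proof (intro sum.cong refl)
        fix j assume j: "j \<in> residues"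
        show "s j * add_char p (j * k) = \<epsilon> * (chi j ^ 2 * add_char p (j * k)) + (if j = 0 then - 1 else 0)"
        proof (cases "j = 0")
          case True
          then show ?thesis using s(2)[of j] by (simp add: chi_eq_0_iff[THEN iffD2])
        next
          case False
          then have "\<not> int p dvd j" using j dvd_residue_iff by blast
          then show ?thesis using False by (simp add: s(1))
        qed
      qed
      also have "\<dots> = \<epsilon> * (\<Sum>j\<in>residues. chi j ^ 2 * add_char p (j * k)) - 1"
        unfolding sum.distrib sum_distrib_left sum_residues_delta_0 by simp
      also have "(\<Sum>j\<in>residues. chi j ^ 2 * add_char p (j * k)) = chi k ^ 2 * gauss 2"
        by (subst gauss_twist) (simp_all add: cnj_chi_square)
      also have "\<epsilon> * (chi k ^ 2 * gauss 2) - 1 = - 1 + q * H k" using q(3) by (simp add: H_def \<gamma>_def)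
      finally show ?thesis by (simp add: q_def)
    qed
    show "H k = (\<Sum>e\<in>{1..3}. \<alpha> e * chi k ^ e)" for k
    proof -
      have "{1..3::nat} = {1, 2, 3}" by auto
      then show ?thesis by (simp add: H_def \<alpha>_def)
    qed
    show "norm (\<alpha> e) \<le> 1" for e using \<gamma> by (auto simp: \<alpha>_def)
    show "cnj (H k) = 1 * H k" for k using \<gamma> cnj_chi_square[of k] by (auto simp: H_def)
    show "H k ^ 2 = 1 * (1 + of_real 0 * chi k ^ 2)" if "\<not> int p dvd k" for k
      using chi_pow_4[OF that] \<gamma>2 by (simp add: H_def power_mult_distrib flip: power_mult)
  qed (use s_cong s_cases in auto)
  then show ?thesis by (metis divide_nonneg_nonneg mult_nonneg_nonneg of_nat_0_le_iff zero_le_numeral zero_le_power2 power_zero_numeral)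
qed

text \<open>On the fourth roots of unity, the indicator of \<open>{u, u'}\<close> with values \<open>\<plusminus>1\<close> is a real multiple
  of the square map if \<open>u' = - u\<close>, and the real part of a multiple of the identity otherwise.\<close>

lemma flat_sequence_two_classes:
  assumes nm: "\<i> ^ n \<noteq> \<i> ^ m"
    and s: "\<And>j. s j = (if chi j = \<i> ^ n \<or> chi j = \<i> ^ m then 1 else - 1)"
    and xy: "int p = x\<^sup>2 + 4 * y\<^sup>2"
  shows "\<exists>H \<alpha> \<sigma> \<delta>. flat_sequence p \<omega> s H \<alpha> \<sigma> \<delta> \<and> \<delta>\<^sup>2 \<le> 4 * (real_of_int y)\<^sup>2 / real p"
proof -
  have root: "\<exists>u\<in>{1, \<i>, - 1, - \<i>}. \<i> ^ k = u" for k
    by (induction k) auto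
  obtain u where u: "u \<in> {1, \<i>, - 1, - \<i>}" "\<i> ^ n = u" using root by blast
  obtain u' where u': "u' \<in> {1, \<i>, - 1, - \<i>}" "\<i> ^ m = u'" using root by blast
  have ne: "u \<noteq> u'" using nm u u' by simp
  have chi_root: "chi j \<in> {1, \<i>, - 1, - \<i>}" if "\<not> int p dvd j" for j
    using chi_cases[OF that] root by metis
  have s_cong: "s i = s j" if "[i = j] (mod int p)" for i j
    using chi_cong[OF that] by (simp add: s)
  have s_cases: "s j = 1 \<or> s j = - 1" for j by (simp add: s)
  have s0: "s j = - 1" if "int p dvd j" for j
  proof -
    have "chi j = 0" using that by (simp add: chi_eq_0_iff)
    then show ?thesis by (simp add: s)
  qed
  show ?thesis
  proof (cases "u' = - u")
    case True
    have "u ^ 2 = 1 \<or> u ^ 2 = - 1" using u by auto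
    moreover have "s j = u ^ 2 * chi j ^ 2" if "\<not> int p dvd j" for j
    proof -
      have "\<i> \<noteq> - 1" "- 1 \<noteq> \<i>" by (simp_all add: complex_eq_iff)
      then show ?thesis unfolding s u(2) u'(2) True using chi_root[OF that] u(1) by auto
    qed
    ultimately show ?thesis by (rule flat_sequence_quadratic[OF _ _ s0 s_cong s_cases])
  next
    case False
    define a where "a = cnj (u + u') / 2"
    have "a ^ 2 = \<i> / 2 \<or> a ^ 2 = - \<i> / 2"
      unfolding a_def using indicator_adjacent_fourth_roots(2)[OF u(1) u'(1) u(1) ne False] .
    moreover have "s j = a * chi j + cnj (a * chi j)" if "\<not> int p dvd j" for j
      unfolding s u(2) u'(2) a_def
      by (rule indicator_adjacent_fourth_roots(1)[OF u(1) u'(1) chi_root[OF that] ne False])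
    ultimately show ?thesis by (rule flat_sequence_quartic[OF _ _ s0 s_cong s_cases xy])
  qed
qed

end

section \<open>The residue ring and its cyclotomic classes in terms of integers\<close>

lemma prime_field_simps:
  assumes "prime p"
  shows "carrier (prime_field p) = {0..<int p}"
    and "x \<otimes>\<^bsub>prime_field p\<^esub> y = (x * y) mod int p"
    and "x \<oplus>\<^bsub>prime_field p\<^esub> y = (x + y) mod int p"
    and "\<zero>\<^bsub>prime_field p\<^esub> = 0" and "\<one>\<^bsub>prime_field p\<^esub> = 1"
    and "\<ominus>\<^bsub>prime_field p\<^esub> x = (- x) mod int p"
proof -
  interpret residues_prime p "prime_field p" using assms by (simp add: residues_prime_def)
  show "carrier (prime_field p) = {0..<int p}" unfolding res_carrier_eq by auto
  show "x \<otimes>\<^bsub>prime_field p\<^esub> y = (x * y) mod int p" by (rule res_mult_eq)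
  show "x \<oplus>\<^bsub>prime_field p\<^esub> y = (x + y) mod int p" by (rule res_add_eq)
  show "\<zero>\<^bsub>prime_field p\<^esub> = 0" by (rule res_zero_eq)
  show "\<one>\<^bsub>prime_field p\<^esub> = 1" by (rule res_one_eq)
  show "\<ominus>\<^bsub>prime_field p\<^esub> x = (- x) mod int p" by (rule res_neg_eq)
qed

lemma group_mult_prime_field: "prime p \<Longrightarrow> group (mult_of (prime_field p))"
proof -
  assume "prime p"
  then interpret residues_prime p "prime_field p" by (simp add: residues_prime_def)
  show ?thesis by (rule field_mult_group)
qed

lemma carrier_mult_prime_field: "prime p \<Longrightarrow> carrier (mult_of (prime_field p)) = {1..<int p}"
  by (auto simp: prime_field_simps)

lemma mult_prime_field_nat_pow:
  assumes p: "prime p"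
  shows "x [^]\<^bsub>mult_of (prime_field p)\<^esub> (n :: nat) = x ^ n mod int p"
proof (induction n)
  case 0
  have "int p > 1" using p prime_gt_1_nat by force
  then show ?case by (simp add: prime_field_simps[OF p] nat_pow_def)
next
  case (Suc n)
  have "x [^]\<^bsub>mult_of (prime_field p)\<^esub> Suc n =
    x [^]\<^bsub>mult_of (prime_field p)\<^esub> n \<otimes>\<^bsub>mult_of (prime_field p)\<^esub> x"
    by (simp add: nat_pow_def)
  also have "\<dots> = (x ^ n mod int p) * x mod int p"
    unfolding Suc.IH mult_mult_of by (rule prime_field_simps(2)[OF p])
  finally show ?case by (simp add: mod_simps mult.commute)
qed

lemma prime_field_add_pow:
  assumes p: "prime p"
  shows "add_pow (prime_field p) (k :: int) v = k * v mod int p"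
proof -
  have nat: "add_pow (prime_field p) (n :: nat) v = int n * v mod int p" for n
    by (induction n) (simp_all add: add_pow_def nat_pow_def prime_field_simps[OF p] mod_simps algebra_simps)
  show ?thesis
  proof (cases "k \<ge> 0")
    case True
    then show ?thesis using add_pow_int_ge[OF True, of "prime_field p" v] nat[of "nat k"] by simp
  next
    case False
    then have "add_pow (prime_field p) k v = (- (int (nat (- k)) * v mod int p)) mod int p"
      using add_pow_int_lt[of k "prime_field p" v] nat[of "nat (- k)"] prime_field_simps(6)[OF p] by simp
    then show ?thesis using False by (simp add: mod_minus_eq)
  qed
qed

lemma prime_mod_4_of_representation:
  assumes p: "prime p" and xy: "int p = x\<^sup>2 + 4 * y\<^sup>2"
  shows "p mod 4 = 1"
proof -
  have "odd x"
  proof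
    assume "even x"
    then have "4 dvd x\<^sup>2" by (auto simp: power2_eq_square elim!: evenE)
    then have "4 dvd int p" unfolding xy by simp
    then have "4 dvd p" by presburger
    then have "2 * 2 dvd p" by simp
    then have "2 dvd p" by (rule dvd_mult_left)
    then have "p = 2" using primes_dvd_imp_eq[OF two_is_prime_nat p] by simp
    then show False using \<open>4 dvd p\<close> by simp
  qed
  then obtain k where "x = 2 * k + 1" by (auto elim: oddE)
  then have "int p = 4 * (k\<^sup>2 + k + y\<^sup>2) + 1" using xy by (simp add: power2_eq_square algebra_simps)
  then have "int p mod 4 = 1" by presburger
  then show ?thesis by presburger
qed

lemma quartic_character_of_primitive:
  assumes p: "prime p" and p4: "p mod 4 = 1" and prim: "primitive_element p \<omega>"
  shows "quartic_character p \<omega>"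
proof
  interpret G: group "mult_of (prime_field p)" by (rule group_mult_prime_field[OF p])
  have \<omega>: "\<omega> \<in> {1..<int p}" using prim unfolding primitive_element_def carrier_mult_prime_field[OF p] by blast
  have p0: "int p > 0" using p prime_gt_0_nat by simp
  show "\<not> int p dvd \<omega>" using \<omega> zdvd_imp_le by fastforce
  fix x assume x: "\<not> int p dvd x"
  have "x mod int p \<noteq> 0" using x by (simp add: dvd_eq_mod_eq_0)
  moreover have "0 \<le> x mod int p" "x mod int p < int p" using p0 by simp_all
  ultimately have "x mod int p \<in> {1..<int p}" by auto
  then have "x mod int p \<in> generate (mult_of (prime_field p)) {\<omega>}"
    using prim unfolding primitive_element_def carrier_mult_prime_field[OF p] by blast
  \<comment> \<open>A generated subgroup allows inverses; finiteness of the group reduces it to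
    natural exponents.\<close>
  also have "generate (mult_of (prime_field p)) {\<omega>} = {\<omega> [^]\<^bsub>mult_of (prime_field p)\<^esub> k |k. k \<in> (UNIV :: nat set)}"
    by (rule G.generate_pow_on_finite_carrier) (use \<omega> carrier_mult_prime_field[OF p] in auto)
  finally obtain n :: nat where "x mod int p = \<omega> ^ n mod int p" by (auto simp: mult_prime_field_nat_pow[OF p])
  then show "\<exists>n::nat. [x = \<omega> ^ n] (mod int p)" by (auto simp: cong_def)
qed (use p p4 in auto)

context quartic_character begin

text \<open>The fourth powers are exactly the kernel of \<open>chi\<close>: \<open>chi z = 1\<close>
  means that the exponent of \<open>z\<close> to the base \<open>\<omega>\<close> is a multiple of
  4. So cosets of the fourth powers are fibres of \<open>chi\<close>.\<close>

lemma cyclotomic_class_4_eq: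
  assumes prim: "primitive_element p \<omega>"
  shows "\<exists>n. cyclotomic_class p 4 \<omega> t = {y \<in> {1..<int p}. chi y = \<i> ^ n}"
proof -
  interpret G: group "mult_of (prime_field p)" by (rule group_mult_prime_field[OF prime_p])
  note car = carrier_mult_prime_field[OF prime_p]
  define g where "g = \<omega> [^]\<^bsub>mult_of (prime_field p)\<^esub> t"
  have "\<omega> \<in> carrier (mult_of (prime_field p))" using prim by (simp add: primitive_element_def)
  then have "g \<in> carrier (mult_of (prime_field p))" unfolding g_def by (rule G.int_pow_closed)
  then have "g \<in> {1..<int p}" unfolding car .
  then have g: "\<not> int p dvd g" using zdvd_imp_le by fastforce
  obtain n where n: "chi g = \<i> ^ n" using chi_cases[OF g] by blast
  have "cyclotomic_class p 4 \<omega> t = (\<lambda>x. g * (x ^ 4 mod int p) mod int p) ` {1..<int p}"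
    unfolding cyclotomic_class_def g_def[symmetric] l_coset_def mult_prime_field_nat_pow[OF prime_p] car mult_mult_of
      prime_field_simps(2)[OF prime_p] Setcompr_eq_image
    by blast
  also have "\<dots> = (\<lambda>x. g * x ^ 4 mod int p) ` {1..<int p}" unfolding mod_mult_right_eq ..
  also have "\<dots> = {y \<in> {1..<int p}. chi y = \<i> ^ n}"
  proof (intro equalityI subsetI)
    fix y assume "y \<in> (\<lambda>x. g * x ^ 4 mod int p) ` {1..<int p}"
    then obtain x where x: "x \<in> {1..<int p}" "y = g * x ^ 4 mod int p" by auto
    have nx: "\<not> int p dvd x" using x zdvd_imp_le by fastforce
    have cy: "chi y = \<i> ^ n" unfolding x(2) chi_mod chi_mult chi_power chi_pow_4[OF nx] n by simp
    have "0 \<le> y" "y < int p" unfolding x(2) using p_pos by simp_all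
    moreover have "y \<noteq> 0" using cy chi_eq_0_iff[of y] by auto
    ultimately show "y \<in> {y \<in> {1..<int p}. chi y = \<i> ^ n}" using cy by auto
  next
    fix y assume y: "y \<in> {y \<in> {1..<int p}. chi y = \<i> ^ n}"
    define z where "z = y * inv_mod g"
    have gz: "[g * z = y] (mod int p)"
      unfolding z_def using cong_mult[OF inv_mod[OF g] cong_refl[of y]] by (simp add: mult_ac)
    have "chi g * chi z = chi y" using gz chi_cong chi_mult by metis
    then have "chi z = 1" using y n by simp
    then have nz: "\<not> int p dvd z" using chi_eq_0_iff[of z] by auto
    obtain m where m: "chi z = \<i> ^ m" "[z = \<omega> ^ m] (mod int p)" using chi_cases[OF nz] by blast
    have "\<i> ^ m = \<i> ^ 0" using m \<open>chi z = 1\<close> by simp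
    then have "m mod 4 = 0" unfolding ii_power_eq_iff by simp
    then obtain q where q: "m = q * 4" by (metis dvdE mod_0_imp_dvd mult.commute)
    define x where "x = \<omega> ^ q mod int p"
    have "0 \<le> x" "x < int p" unfolding x_def using p_pos by simp_all
    moreover have "x \<noteq> 0" unfolding x_def using not_dvd_omega_power[of q] by (simp add: dvd_eq_mod_eq_0)
    ultimately have "x \<in> {1..<int p}" by auto
    moreover have "[x ^ 4 = (\<omega> ^ q) ^ 4] (mod int p)"
      unfolding x_def by (intro cong_pow) (simp add: cong_def)
    then have "[x ^ 4 = \<omega> ^ m] (mod int p)" by (simp add: q power_mult)
    then have "[x ^ 4 = z] (mod int p)" using m(2) by (meson cong_sym cong_trans)
    then have "[g * x ^ 4 = y] (mod int p)" using gz by (meson cong_refl cong_mult cong_trans)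
    then have "y = g * x ^ 4 mod int p" using y by (simp add: cong_def)
    ultimately show "y \<in> (\<lambda>x. g * x ^ 4 mod int p) ` {1..<int p}" by blast
  qed
  finally show ?thesis by blast
qed

end

text \<open>Multiplication by \<open>v\<close> permutes the classes: if
  \<open>chi v = \<i> ^ l\<close>, then \<open>j * v\<close> lies in a given fibre iff
  \<open>j\<close> lies in the one shifted by the inverse of \<open>\<i> ^ l\<close>, which is
  \<open>\<i> ^ (3 * l)\<close>. So the choice of \<open>v\<close> only changes which two classes
  occur.\<close>

lemma exists_flat_sequence:
  assumes p: "prime p" and xy: "int p = x\<^sup>2 + 4 * y\<^sup>2" and prim: "primitive_element p \<omega>"
    and D: "cyclotomic_class p 4 \<omega> t \<noteq> cyclotomic_class p 4 \<omega> t'"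
      "D = cyclotomic_class p 4 \<omega> t \<union> cyclotomic_class p 4 \<omega> t'"
    and v: "additive_generator p v"
  shows "\<exists>H \<alpha> \<sigma> \<delta>. flat_sequence p \<omega> (\<lambda>j. pm_indicator D (add_pow (prime_field p) j v)) H \<alpha> \<sigma> \<delta>
    \<and> \<delta>\<^sup>2 \<le> 4 * (real_of_int y)\<^sup>2 / real p"
proof -
  interpret quartic_character p \<omega>
    by (rule quartic_character_of_primitive[OF p prime_mod_4_of_representation[OF p xy] prim])
  obtain n where n: "cyclotomic_class p 4 \<omega> t = {y \<in> {1..<int p}. chi y = \<i> ^ n}"
    using cyclotomic_class_4_eq[OF prim] by blast
  obtain m where m: "cyclotomic_class p 4 \<omega> t' = {y \<in> {1..<int p}. chi y = \<i> ^ m}"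
    using cyclotomic_class_4_eq[OF prim] by blast
  have nm: "\<i> ^ n \<noteq> \<i> ^ m" using D n m by auto
  have "v \<in> {1..<int p}" using v unfolding additive_generator_def carrier_mult_prime_field[OF p] by blast
  then have nv: "\<not> int p dvd v" using zdvd_imp_le by fastforce
  then obtain l where l: "chi v = \<i> ^ l" using chi_cases by blast
  have l4: "\<i> ^ l * \<i> ^ (3 * l) = 1" using chi_pow_4[OF nv] unfolding l by (simp flip: power_add power_mult)
  have shift: "chi j * \<i> ^ l = \<i> ^ k \<longleftrightarrow> chi j = \<i> ^ (k + 3 * l)" for j k
  proof
    assume "chi j * \<i> ^ l = \<i> ^ k"
    then have "chi j * (\<i> ^ l * \<i> ^ (3 * l)) = \<i> ^ k * \<i> ^ (3 * l)" by (metis mult.assoc)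
    then show "chi j = \<i> ^ (k + 3 * l)" unfolding l4 by (simp add: power_add)
  next
    assume "chi j = \<i> ^ (k + 3 * l)"
    then have "chi j * \<i> ^ l = \<i> ^ k * (\<i> ^ l * \<i> ^ (3 * l))" by (simp add: power_add mult_ac)
    then show "chi j * \<i> ^ l = \<i> ^ k" unfolding l4 by simp
  qed
  have mem: "j * v mod int p \<in> {y \<in> {1..<int p}. chi y = \<i> ^ k} \<longleftrightarrow> chi j = \<i> ^ (k + 3 * l)" for j k
  proof -
    have "chi (j * v mod int p) = chi j * \<i> ^ l" by (simp add: chi_mult l)
    moreover have "j * v mod int p \<in> {1..<int p}" if "chi (j * v mod int p) \<noteq> 0"
    proof -
      have "0 \<le> j * v mod int p" "j * v mod int p < int p" using p_pos by simp_all
      moreover have "j * v mod int p \<noteq> 0" using that by (metis chi_eq_0_iff dvd_0_right)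
      ultimately show ?thesis by auto
    qed
    ultimately show ?thesis using shift[of j k] by auto
  qed
  show ?thesis
  proof (rule flat_sequence_two_classes[where n = "n + 3 * l" and m = "m + 3 * l", OF _ _ xy])
    show "\<i> ^ (n + 3 * l) \<noteq> \<i> ^ (m + 3 * l)" using nm by (simp add: power_add)
    show "pm_indicator D (add_pow (prime_field p) j v) =
      (if chi j = \<i> ^ (n + 3 * l) \<or> chi j = \<i> ^ (m + 3 * l) then 1 else - 1)" for j
      unfolding pm_indicator_def D(2) n m prime_field_add_pow[OF p] Un_iff mem ..
  qed
qed

context flat_sequence begin

text \<open>The fourth moment is the sum of the squares of the real autocorrelations
  \<open>C n\<close>. Since \<open>s\<close> has period \<open>p\<close>, all products at the shifts
  0, \<open>p\<close> and \<open>- p\<close> are 1, so these three autocorrelations equal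
  \<open>t\<close>, \<open>t - p\<close> and \<open>t - p\<close>.\<close>

lemma quad_sum_ge:
  assumes "p < t"
  shows "Re (quad_sum r t) \<ge> (real t)\<^sup>2 + 2 * (real t - real p)\<^sup>2"
proof -
  define C where "C n = (\<Sum>(i, k)\<in>diff_pairs t n. s (r + int i) * s (r + int k))" for n
  have "quad_sum r t = (\<Sum>n\<in>{- int t..int t}. C n * C n)"
    unfolding quad_sum_def sum_quads_by_difference C_def sum_product
    by (simp add: case_prod_beta mult_ac)
  moreover have C_real: "Im (C n) = 0" for n
    unfolding C_def Im_sum case_prod_beta
    by (intro sum.neutral ballI) (metis Im_complex_of_real cnj_s complex_cnj_mult Reals_cnj_iff complex_is_Real_iff)
  ultimately have Q: "Re (quad_sum r t) = (\<Sum>n\<in>{- int t..int t}. (Re (C n))\<^sup>2)"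
    by (simp add: power2_eq_square)
  have C_card: "C n = of_nat (card (diff_pairs t n))" if "int p dvd n" for n
  proof -
    have "C n = (\<Sum>(i, k)\<in>diff_pairs t n. 1)"
      unfolding C_def
    proof (intro sum.cong refl, clarify)
      fix i k assume "(i, k) \<in> diff_pairs t n"
      then have "int p dvd (r + int i) - (r + int k)" using that by (simp add: diff_pairs_def)
      then have "s (r + int i) = s (r + int k)" by (intro s_cong) (simp add: cong_iff_dvd_diff)
      then show "s (r + int i) * s (r + int k) = 1" using s_cases[of "r + int k"] by auto
    qed
    then show ?thesis by (simp add: case_prod_beta)
  qed
  have "(real t)\<^sup>2 + 2 * (real t - real p)\<^sup>2 = (\<Sum>n\<in>{0, int p, - int p}. (Re (C n))\<^sup>2)"
    using assms p_pos by (simp add: C_card card_diff_pairs of_nat_diff)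
  also have "\<dots> \<le> (\<Sum>n\<in>{- int t..int t}. (Re (C n))\<^sup>2)"
    using assms by (intro sum_mono2) auto
  finally show ?thesis unfolding Q .
qed

end

section \<open>Passage to the limit along the given primes\<close>

lemma inf_at_top_principal_ne_bot:
  assumes "infinite (P :: nat set)" shows "inf at_top (principal P) \<noteq> bot"
proof
  assume "inf at_top (principal P) = bot"
  then have "eventually (\<lambda>_. False) (inf at_top (principal P))" by simp
  then obtain N where "\<And>n. n \<ge> N \<Longrightarrow> n \<notin> P"
    unfolding eventually_inf_principal eventually_at_top_linorder by auto
  then have "P \<subseteq> {..<N}" by (meson lessThan_iff not_le_imp_less subsetI)
  then show False using assms finite_subset by blast
qed

theorem corollary2p5:
  fixes P :: "nat set"
    and x y :: "nat \<Rightarrow> int"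
    and \<omega> v :: "nat \<Rightarrow> int"
    and D :: "nat \<Rightarrow> int set"
    and r :: "nat \<Rightarrow> int"
    and t :: "nat \<Rightarrow> nat"
    and R T :: real
  assumes "infinite P"
    and "\<And>p. p \<in> P \<Longrightarrow> prime p"
    and "\<And>p. p \<in> P \<Longrightarrow> int p = (x p)\<^sup>2 + 4 * (y p)\<^sup>2"
    and "((\<lambda>p. (real_of_int (y p))\<^sup>2 * (ln (real p)) ^ 3 / real p) \<longlongrightarrow> 0) (inf at_top (principal P))"
    and "\<And>p. p \<in> P \<Longrightarrow> primitive_element p (\<omega> p)"
    and "\<And>p. p \<in> P \<Longrightarrow>
           \<exists>s s'. cyclotomic_class p 4 (\<omega> p) s \<noteq> cyclotomic_class p 4 (\<omega> p) s' \<and>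
                  D p = cyclotomic_class p 4 (\<omega> p) s \<union> cyclotomic_class p 4 (\<omega> p) s'"
    and "\<And>p. p \<in> P \<Longrightarrow> additive_generator p (v p)"
    and "T > 0"
    and "((\<lambda>p. real_of_int (r p) / real p) \<longlongrightarrow> R) (inf at_top (principal P))"
    and "((\<lambda>p. real (t p) / real p) \<longlongrightarrow> T) (inf at_top (principal P))"
  shows "((\<lambda>p. merit_factor (char_poly_segment p (D p) (v p) (r p) (t p))) \<longlongrightarrow> \<phi> 1 R T)
           (inf at_top (principal P))"
proof -
  define F where "F = inf at_top (principal P)"
  have F: "F \<le> at_top" "F \<noteq> bot" "eventually (\<lambda>p. p \<in> P) F"
    unfolding F_def using inf_at_top_principal_ne_bot[OF assms(1)] by (auto simp: eventually_inf_principal)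
  note T = \<open>T > 0\<close>
  note rlim = assms(9)[folded F_def] and tlim = assms(10)[folded F_def] and ylim = assms(4)[folded F_def]
  define s where "s p j = pm_indicator (D p) (add_pow (prime_field p) j (v p))" for p and j :: int
  define Q where "Q p = Re (\<Sum>(i, j, k, l)\<in>quads (t p). s p (r p + int i) * s p (r p + int j) * s p (r p + int k) * s p (r p + int l))" for p
  define Z where "Z p = real (quad_count p (t p) (r p)) - 2 * real (card (quads (t p))) / real p" for p
  \<comment> \<open>Since \<open>t < (T + 1) * p\<close> eventually, this gives
    \<open>2 * t <= p * M\<close>, as detecting the additive relation modulo \<open>p * M\<close>
    requires.\<close>
  define M where "M = nat \<lceil>2 * T + 2\<rceil>"
  define K where "K = nat \<lceil>2 * \<bar>R\<bar> + 2 * T + 4\<rceil>"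
  have M2: "2 * T + 2 \<le> real M" unfolding M_def by (rule real_nat_ceiling_ge)
  then have "real M > 0" using T by linarith
  then have M: "M > 0" "2 * T + 2 \<le> real M" using M2 by simp_all
  have K: "2 * \<bar>R\<bar> + 2 * T + 4 \<le> real K" unfolding K_def by (rule real_nat_ceiling_ge)
  \<comment> \<open>\<open>B1\<close> and \<open>B2\<close> are the two error terms of
    \<open>quad_sum_asymptotic\<close> divided by \<open>t^2\<close>, written in quantities whose
    limits are known.\<close>
  define B1 where "B1 p = 20000000 * real M ^ 3 * ((3 + 2 * ln (real p * real M)) ^ 4 / sqrt (real p)) / (real (t p) / real p)\<^sup>2" for p :: nat
  define B2 where "B2 p = 4 * ((real_of_int (y p))\<^sup>2 / real p) * (real (t p) / real p)" for p :: nat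
  have flat: "\<exists>H \<alpha> \<sigma> \<delta>. flat_sequence p (\<omega> p) (s p) H \<alpha> \<sigma> \<delta> \<and> \<delta>\<^sup>2 \<le> 4 * (real_of_int (y p))\<^sup>2 / real p"
    if pP: "p \<in> P" for p
  proof -
    obtain c c' where "cyclotomic_class p 4 (\<omega> p) c \<noteq> cyclotomic_class p 4 (\<omega> p) c'"
      "D p = cyclotomic_class p 4 (\<omega> p) c \<union> cyclotomic_class p 4 (\<omega> p) c'"
      using assms(6)[OF pP] by blast
    then show ?thesis
      unfolding s_def using exists_flat_sequence[OF assms(2,3,5)[OF pP]] assms(7)[OF pP] by blast
  qed
  have ev_t: "eventually (\<lambda>p. real (t p) / real p > 0) F" "eventually (\<lambda>p. real (t p) / real p < T + 1) F"
    using order_tendstoD[OF tlim] T by auto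
  have bound: "eventually (\<lambda>p. norm (Q p / (real (t p))\<^sup>2 - Z p / (real (t p))\<^sup>2) \<le> B1 p + B2 p) F"
    using F(3) ev_t
  proof eventually_elim
    case (elim p)
    obtain H \<alpha> \<sigma> \<delta> where fl: "flat_sequence p (\<omega> p) (s p) H \<alpha> \<sigma> \<delta>"
      and \<delta>: "\<delta>\<^sup>2 \<le> 4 * (real_of_int (y p))\<^sup>2 / real p" using flat[OF elim(1)] by blast
    interpret flat_sequence p "\<omega> p" "s p" H \<alpha> \<sigma> \<delta> by (rule fl)
    have tp: "real (t p) > 0" and pp: "real p > 0" using elim(2) by (auto simp: zero_less_divide_iff)
    have "2 * real (t p) \<le> (2 * T + 2) * real p" using elim(3) pp by (simp add: pos_divide_less_eq algebra_simps)
    also have "\<dots> \<le> real M * real p" using M(2) by (intro mult_right_mono) auto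
    finally have "real (2 * t p) \<le> real (p * M)" by (simp add: mult.commute)
    then have tM: "2 * t p \<le> p * M" by (simp only: of_nat_le_iff)
    have "\<bar>Q p - Z p\<bar> = \<bar>Re (quad_sum (r p) (t p) - of_real (Z p))\<bar>"
      by (simp add: Q_def quad_sum_def)
    also have "\<dots> \<le> norm (quad_sum (r p) (t p) - of_real (Z p))" by (rule abs_Re_le_cmod)
    also have "\<dots> \<le> 20000000 * real M ^ 3 * real p * sqrt (real p) * (3 + 2 * ln (real (p * M))) ^ 4 + \<delta>\<^sup>2 * real (t p) ^ 3 / real p"
      unfolding Z_def by (rule quad_sum_asymptotic[OF M(1) tM])
    also have "\<delta>\<^sup>2 * real (t p) ^ 3 / real p \<le> (4 * (real_of_int (y p))\<^sup>2 / real p) * real (t p) ^ 3 / real p"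
      using \<delta> by (intro divide_right_mono mult_right_mono) auto
    finally have le: "\<bar>Q p - Z p\<bar> \<le> 20000000 * real M ^ 3 * real p * sqrt (real p) * (3 + 2 * ln (real (p * M))) ^ 4 +
      (4 * (real_of_int (y p))\<^sup>2 / real p) * real (t p) ^ 3 / real p" by simp
    have "norm (Q p / (real (t p))\<^sup>2 - Z p / (real (t p))\<^sup>2) = \<bar>Q p - Z p\<bar> / (real (t p))\<^sup>2"
      by (simp add: abs_divide flip: diff_divide_distrib)
    also have "\<dots> \<le> (20000000 * real M ^ 3 * real p * sqrt (real p) * (3 + 2 * ln (real (p * M))) ^ 4 +
      (4 * (real_of_int (y p))\<^sup>2 / real p) * real (t p) ^ 3 / real p) / (real (t p))\<^sup>2"
      using le by (rule divide_right_mono) simp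
    also have "\<dots> = 20000000 * real M ^ 3 * real p * sqrt (real p) * (3 + 2 * ln (real (p * M))) ^ 4 / (real (t p))\<^sup>2 +
      (4 * (real_of_int (y p))\<^sup>2 / real p) * real (t p) ^ 3 / real p / (real (t p))\<^sup>2" by (rule add_divide_distrib)
    also have "(4 * (real_of_int (y p))\<^sup>2 / real p) * real (t p) ^ 3 / real p / (real (t p))\<^sup>2 = B2 p"
      using tp by (simp add: B2_def power_eq_if)
    also have "20000000 * real M ^ 3 * real p * sqrt (real p) * (3 + 2 * ln (real (p * M))) ^ 4 / (real (t p))\<^sup>2 = B1 p"
    proof -
      define q where "q = sqrt (real p)"
      have q: "real p = q * q" "q > 0" using pp by (simp_all add: q_def)
      show ?thesis unfolding B1_def of_nat_mult q_def[symmetric] unfolding q(1) using q(2) tp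
        by (simp add: field_simps power2_eq_square)
    qed
    finally show ?case .
  qed
  have "(B1 \<longlongrightarrow> 20000000 * real M ^ 3 * 0 / T\<^sup>2) F"
  proof -
    have "((\<lambda>p :: nat. (3 + 2 * ln (real p * real M)) ^ 4 / sqrt (real p)) \<longlongrightarrow> 0) at_top"
      using M(1) by real_asymp
    then have "((\<lambda>p :: nat. (3 + 2 * ln (real p * real M)) ^ 4 / sqrt (real p)) \<longlongrightarrow> 0) F"
      using F(1) tendsto_mono by blast
    then show ?thesis unfolding B1_def using T by (intro tendsto_intros tlim) auto
  qed
  moreover have "(B2 \<longlongrightarrow> 4 * 0 * T) F"
  proof -
    \<comment> \<open>For \<open>p >= 3\<close> the logarithm is at least 1, so
      \<open>y^2 / p\<close> is dominated by the quantity assumed to tend to 0.\<close>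
    have "eventually (\<lambda>p. p \<ge> 3) F" using F(1) eventually_ge_at_top filter_leD by blast
    then have "eventually (\<lambda>p. norm ((real_of_int (y p))\<^sup>2 / real p) \<le> (real_of_int (y p))\<^sup>2 * (ln (real p)) ^ 3 / real p) F"
    proof eventually_elim
      case (elim p)
      have "exp (1 :: real) \<le> 3" by (rule exp_le)
      then have "1 \<le> ln (real p)" using elim by (subst ln_ge_iff) auto
      then have "1 \<le> ln (real p) ^ 3" by (rule one_le_power)
      then have "(real_of_int (y p))\<^sup>2 * 1 \<le> (real_of_int (y p))\<^sup>2 * ln (real p) ^ 3" by (rule mult_left_mono) simp
      then show ?case by (simp add: divide_right_mono)
    qed
    then have "((\<lambda>p. (real_of_int (y p))\<^sup>2 / real p) \<longlongrightarrow> 0) F"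
      using ylim by (rule Lim_null_comparison)
    then show ?thesis unfolding B2_def by (intro tendsto_intros tlim)
  qed
  ultimately have "((\<lambda>p. B1 p + B2 p) \<longlongrightarrow> 0) F" using tendsto_add by fastforce
  with bound have "((\<lambda>p. Q p / (real (t p))\<^sup>2 - Z p / (real (t p))\<^sup>2) \<longlongrightarrow> 0) F"
    by (rule Lim_null_comparison)
  then have "((\<lambda>p. (Q p / (real (t p))\<^sup>2 - Z p / (real (t p))\<^sup>2) + Z p / (real (t p))\<^sup>2) \<longlongrightarrow> 0 + tent_limit K R T) F"
    using quad_count_tendsto[OF F(1) T rlim tlim K] unfolding Z_def by (rule tendsto_add)
  then have Qlim: "((\<lambda>p. Q p / (real (t p))\<^sup>2) \<longlongrightarrow> tent_limit K R T) F" by simp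
  \<comment> \<open>The merit factor is the reciprocal of \<open>Q / t^2 - 1\<close>, so its limit
    can be taken only if this difference does not tend to 0.\<close>
  have gt1: "tent_limit K R T > 1"
  proof (cases "T \<le> 1")
    case True
    then show ?thesis using tent_limit_gt_1[OF T _ K] by simp
  next
    case False
    have "eventually (\<lambda>p. real (t p) / real p > 1) F" using order_tendstoD(1)[OF tlim] False by simp
    \<comment> \<open>The bound of \<open>quad_sum_ge\<close> over \<open>t^2\<close>. Its left-hand
      side tends to \<open>1 + 2 * (1 - 1 / T)^2 > 1\<close>, and the inequality passes to the
      limit.\<close>
    then have "eventually (\<lambda>p. 1 + 2 * (1 - 1 / (real (t p) / real p))\<^sup>2 \<le> Q p / (real (t p))\<^sup>2) F"
      using F(3)
    proof eventually_elim
      case (elim p)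
      obtain H \<alpha> \<sigma> \<delta> where fl: "flat_sequence p (\<omega> p) (s p) H \<alpha> \<sigma> \<delta>" using flat[OF elim(2)] by blast
      interpret flat_sequence p "\<omega> p" "s p" H \<alpha> \<sigma> \<delta> by (rule fl)
      have pt: "p < t p" using elim(1) p_pos by (simp add: pos_less_divide_eq)
      then have tp: "real (t p) > 0" by simp
      have "Q p = Re (quad_sum (r p) (t p))" by (simp add: Q_def quad_sum_def)
      then have "(real (t p))\<^sup>2 + 2 * (real (t p) - real p)\<^sup>2 \<le> Q p" using quad_sum_ge[OF pt] by simp
      moreover have "(real (t p))\<^sup>2 + 2 * (real (t p) - real p)\<^sup>2 = (1 + 2 * (1 - 1 / (real (t p) / real p))\<^sup>2) * (real (t p))\<^sup>2"
      proof -
        have "real (t p) - real p = (1 - 1 / (real (t p) / real p)) * real (t p)" using tp by (simp add: field_simps)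
        then show ?thesis by (simp add: power_mult_distrib distrib_right)
      qed
      ultimately show ?case using tp by (simp add: pos_le_divide_eq)
    qed
    moreover have "((\<lambda>p. 1 + 2 * (1 - 1 / (real (t p) / real p))\<^sup>2) \<longlongrightarrow> 1 + 2 * (1 - 1 / T)\<^sup>2) F"
      using T by (intro tendsto_intros tlim) auto
    ultimately have "1 + 2 * (1 - 1 / T)\<^sup>2 \<le> tent_limit K R T"
      using tendsto_le[OF F(2) Qlim] by blast
    moreover have "(1 - 1 / T)\<^sup>2 > 0" using False T by simp
    ultimately show ?thesis by linarith
  qed
  have "((\<lambda>p. 1 / (Q p / (real (t p))\<^sup>2 - 1)) \<longlongrightarrow> 1 / (tent_limit K R T - 1)) F"
    using gt1 by (intro tendsto_intros Qlim) auto
  moreover have "eventually (\<lambda>p. 1 / (Q p / (real (t p))\<^sup>2 - 1) = merit_factor (char_poly_segment p (D p) (v p) (r p) (t p))) F"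
    using ev_t(1)
  proof eventually_elim
    case (elim p)
    have tp: "real (t p) > 0" using elim by (auto simp: zero_less_divide_iff)
    have "char_poly_segment p (D p) (v p) (r p) (t p) = sign_poly (t p) (\<lambda>j. s p (r p + int j))"
      by (simp add: char_poly_segment_def sign_poly_def s_def add.commute)
    moreover have "s p j = 1 \<or> s p j = - 1" for j by (simp add: s_def pm_indicator_def)
    ultimately have "merit_factor (char_poly_segment p (D p) (v p) (r p) (t p)) = (real (t p))\<^sup>2 / (Q p - (real (t p))\<^sup>2)"
      by (simp add: merit_factor_sign_poly Q_def)
    moreover have "Q p / (real (t p))\<^sup>2 - 1 = (Q p - (real (t p))\<^sup>2) / (real (t p))\<^sup>2"
      using tp by (simp add: diff_divide_distrib)
    ultimately show ?case by simp
  qed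
  ultimately have "((\<lambda>p. merit_factor (char_poly_segment p (D p) (v p) (r p) (t p))) \<longlongrightarrow> 1 / (tent_limit K R T - 1)) F"
    by (simp add: tendsto_cong)
  then show ?thesis unfolding phi_eq_tent_limit[OF T K] F_def .
qed

end
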